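(* Consider the privacy-preserving embedding retrieval stage of the two-server protocol SecEmb (described in the context), with user set $\mathcal{U}$, unified number $m'$ of retrieved items per user, and output groups $\mathbb{G}_1,\dots,\mathbb{G}_{m'}$ of the $m'$ point functions used by each user. For $b\in\{0,1\}$, let $\mathcal{C}\subset\mathcal{U}\cup\{b\}$ denote the union of one server $b$ and any subset of the users, and let $\mathrm{Real}^{\mathcal{C}}_{\lambda,ret}$ be the combined view of the colluding parties $\mathcal{C}$ in experiments executing privacy-preserving embedding retrieval in SecEmb with security parameter $\lambda$. Let $\mathcal{I}_{\mathcal{U}}$ denote the target indices of all users. Then there exists a probabilistic polynomial-time simulator $\mathrm{Sim}^{\mathcal{C}}_{\lambda,ret}$ such that for all user inputs $\mathcal{I}_{\mathcal{U}}$ and all $\mathcal{C}\subset\mathcal{U}\cup\{b\}$ ($b\in\{0,1\}$), the outputs of $\mathrm{Sim}^{\mathcal{C}}_{\lambda,ret}$ and $\mathrm{Real}^{\mathcal{C}}_{\lambda,ret}$ are computationally indistinguishable: $$\mathrm{Real}^{\mathcal{C}}_{\lambda,ret}\bigl(1^\lambda,\mathcal{I}_{\mathcal{U}\setminus\mathcal{C}}\bigr)\;\approx_c\;\mathrm{Sim}^{\mathcal{C}}_{\lambda,ret}\bigl(1^\lambda,(m',\mathbb{G}_1,\dots,\mathbb{G}_{m'})\bigr),$$ where $\mathcal{I}_{\mathcal{U}\setminus\mathcal{C}}$ denotes the target indices of the users outside $\mathcal{C}$.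
   Context: $\approx_c$ denotes computational indistinguishability. The two servers, $0$ and $1$, are assumed not to collude with each other; no restriction is placed on collusion between one server and the users. Both servers hold the item embedding matrix $Q$ with rows $Q_j$, $j\in\mathcal{I}$. **Primitives.** $\mathsf{PRG}:\{0,1\}^\lambda\to\{0,1\}^{2(\lambda+1)}$ is a pseudorandom generator. For an abelian group $\mathbb{G}$, $\mathrm{Convert}_{\mathbb{G}}:\{0,1\}^\lambda\to\mathbb{G}$ is a map converting a random $\lambda$-bit string to a pseudorandom element of $\mathbb{G}$. $\mathcal{I}$ is the set of $m$ items, whose ids are written as $n$-bit strings, $n=\lceil\log_2 m\rceil$. **Function secret sharing (FSS) of a point function.** For $\alpha=\alpha_1\cdots\alpha_n\in\{0,1\}^n$ and $\beta\in\mathbb{G}$, the point function $f_{\alpha,\beta}:\{0,1\}^n\to\mathbb{G}$ satisfies $f_{\alpha,\beta}(\alpha)=\beta$ and $f_{\alpha,\beta}(x)=0$ for $x\ne\alpha$. $\mathrm{FSS.Gen}(1^\lambda,f_{\alpha,\beta})$: sample $s_0^{(0)},s_1^{(0)}\in\{0,1\}^\lambda$ and $t_0^{(0)}\in\{0,1\}$ at random, and let $t_1^{(0)}=t_0^{(0)}\oplus1$. For $i=1,\dots,n$: - For $c=0,1$, parse $\mathsf{PRG}(s_c^{(i-1)})=s_c^L\|t_c^L\|s_c^R\|t_c^R$. - Let $(\mathrm{Keep},\mathrm{Lose})=(L,R)$ if $\alpha_i=0$ and $(R,L)$ if $\alpha_i=1$. - Set $s_{CW}=s_0^{\mathrm{Lose}}\oplus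 s_1^{\mathrm{Lose}}$, $t_{CW}^L=t_0^L\oplus t_1^L\oplus\alpha_i\oplus1$, $t_{CW}^R=t_0^R\oplus t_1^R\oplus\alpha_i$, and $CW^{(i)}=s_{CW}\|t_{CW}^L\|t_{CW}^R$. - For $c=0,1$, set $s_c^{(i)}=s_c^{\mathrm{Keep}}\oplus t_c^{(i-1)}\cdot s_{CW}$ and $t_c^{(i)}=t_c^{\mathrm{Keep}}\oplus t_c^{(i-1)}\cdot t_{CW}^{\mathrm{Keep}}$. Finally set $CW^{(n+1)}=(-1)^{t_1^{(n)}}[\beta-\mathrm{Convert}_{\mathbb{G}}(s_0^{(n)})+\mathrm{Convert}_{\mathbb{G}}(s_1^{(n)})]$. The key of party $c\in\{0,1\}$ is $s_c^{(0)}\|t_c^{(0)}\|CW^{(1)}\|\cdots\|CW^{(n+1)}$. $\mathrm{FSS.Eval}$ of party $c$'s key at $x\in\{0,1\}^n$: start from $(s^{(0)},t^{(0)})=(s_c^{(0)},t_c^{(0)})$. At step $i=1,\dots,n$, with $CW^{(i)}=s_{CW}\|t_{CW}^L\|t_{CW}^R$, compute $\mathsf{PRG}(s^{(i-1)})\oplus\bigl(t^{(i-1)}\cdot[s_{CW}\|t_{CW}^L\|s_{CW}\|t_{CW}^R]\bigr)=s^L\|t^L\|s^R\|t^R$ and set $(s^{(i)},t^{(i)})=(s^L,t^L)$ if $x_i=0$ and $(s^R,t^R)$ if $x_i=1$. Output $(-1)^c[\mathrm{Convert}_{\mathbb{G}}(s^{(n)})+t^{(n)}\cdot CW^{(n+1)}]$.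 The two parties' outputs sum to $f_{\alpha,\beta}(x)$. **Retrieval stage.** 1. User $u$ has target items $\mathcal{I}_u\subset\mathcal{I}$ and standardizes them to $m'$ items $\mathrm{idx}_u(1),\dots,\mathrm{idx}_u(m')$: if $|\mathcal{I}_u|<m'$, random items of $\mathcal{I}\setminus\mathcal{I}_u$ are added; if $|\mathcal{I}_u|>m'$, $m'$ items of $\mathcal{I}_u$ are sampled at random. 2. For each $i\in[m']$, user $u$ encodes $\mathrm{idx}_u(i)$ by the point function $f_{u,i}$ with value $1$ at $\mathrm{idx}_u(i)$ and $0$ elsewhere (with values in the abelian group $\mathbb{G}_i$), computes $(reK^0_{u,i},reK^1_{u,i})=\mathrm{FSS.Gen}(1^\lambda,f_{u,i})$, and sends $reK^c_{u,i}$ to server $c\in\{0,1\}$. 3. Server $c$ computes $\mathbf{v}^c_{u,i}=\sum_{j\in\mathcal{I}}\mathrm{FSS.Eval}(reK^c_{u,i},j)\cdot Q_j$ and sends it to user $u$, for all $i\in[m']$. 4. User $u$ recovers $Q_{\mathrm{idx}_u(i)}=\mathbf{v}^0_{u,i}+\mathbf{v}^1_{u,i}$.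
   Formalization: Besides 1^λ and (m', G_1,…,G_{m'}), the simulator is also given the coalition's own data (b, which users are in C, the matrix Q, and the target indices of the users in C), since otherwise the colluders' own inputs in their view could not be simulated. *)

theory Defs
  imports
    Complex_Main
    "HOL-Probability.Probability_Mass_Function"
    "HOL-Algebra.Ring"
begin

section \<open>Probabilistic polynomial time\<close>

text \<open>
  The machine model is a while-language over S-expressions.  A program maps one S-expression to one
  S-expression.  The first component of the argument serves as the Boolean test: it is
  true iff it is not \<^term>\<open>Atom\<close>.  Every elementary step is charged the size of the value it
  handles (values are copied, not shared), so the size of an output never exceeds the cost of
  computing it.
\<close>

datatype sexp = Atom | Cell sexp sexp

fun car :: "sexp \<Rightarrow> sexp" where
  "car Atom = Atom"
| "car (Cell a b) = a"

fun cdr :: "sexp \<Rightarrow> sexp" where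
  "cdr Atom = Atom"
| "cdr (Cell a b) = b"

fun elements :: "sexp \<Rightarrow> sexp list" where
  "elements Atom = []"
| "elements (Cell a b) = a # elements b"

datatype prog =
    Copy
  | Nul
  | Car
  | Cdr
  | Fork prog prog
  | Seq prog prog
  | Ite prog prog
  | While prog
  | Choose

text \<open>
  \<open>runs p x \<mu>\<close> says that \<open>p\<close>, started on \<open>x\<close>, halts on all random choices, and \<open>\<mu>\<close> is the joint
  distribution of its output and its running time.  The only source of randomness is \<^term>\<open>Choose\<close>,
  which returns a uniformly chosen entry of an explicitly given list (positions are chosen
  uniformly); on a list of two entries this is a fair coin toss.
\<close>

inductive runs :: "prog \<Rightarrow> sexp \<Rightarrow> (sexp \<times> nat) pmf \<Rightarrow> bool" where
  Copy: "runs Copy x (return_pmf (x, Suc (size x)))"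
| Nul: "runs Nul x (return_pmf (Atom, Suc (size x)))"
| Car: "runs Car x (return_pmf (car x, Suc (size x)))"
| Cdr: "runs Cdr x (return_pmf (cdr x, Suc (size x)))"
| Fork: "runs p x \<mu> \<Longrightarrow> runs q x \<nu> \<Longrightarrow>
    runs (Fork p q) x
      (bind_pmf \<mu> (\<lambda>(y, t). map_pmf (\<lambda>(z, t'). (Cell y z, Suc (size x) + t + t')) \<nu>))"
| Seq: "runs p x \<mu> \<Longrightarrow> (\<forall>y t. (y, t) \<in> set_pmf \<mu> \<longrightarrow> runs q y (\<nu> y)) \<Longrightarrow>
    runs (Seq p q) x
      (bind_pmf \<mu> (\<lambda>(y, t). map_pmf (\<lambda>(z, t'). (z, Suc (size x) + t + t')) (\<nu> y)))"
| Ite_true: "car x \<noteq> Atom \<Longrightarrow> runs p x \<mu> \<Longrightarrow>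
    runs (Ite p q) x (map_pmf (\<lambda>(y, t). (y, Suc (size x) + t)) \<mu>)"
| Ite_false: "car x = Atom \<Longrightarrow> runs q x \<mu> \<Longrightarrow>
    runs (Ite p q) x (map_pmf (\<lambda>(y, t). (y, Suc (size x) + t)) \<mu>)"
| While_false: "car x = Atom \<Longrightarrow> runs (While p) x (return_pmf (x, Suc (size x)))"
| While_true: "car x \<noteq> Atom \<Longrightarrow> runs p x \<mu> \<Longrightarrow>
    (\<forall>y t. (y, t) \<in> set_pmf \<mu> \<longrightarrow> runs (While p) y (\<nu> y)) \<Longrightarrow>
    runs (While p) x
      (bind_pmf \<mu> (\<lambda>(y, t). map_pmf (\<lambda>(z, t'). (z, Suc (size x) + t + t')) (\<nu> y)))"
| Choose_nil: "elements x = [] \<Longrightarrow> runs Choose x (return_pmf (Atom, Suc (size x)))"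
| Choose: "elements x \<noteq> [] \<Longrightarrow>
    runs Choose x
      (map_pmf (\<lambda>i. (elements x ! i, Suc (size x))) (pmf_of_set {..<length (elements x)}))"

lemma runs_deterministic: "runs p x \<mu> \<Longrightarrow> runs p x \<mu>' \<Longrightarrow> \<mu> = \<mu>'"
proof (induction arbitrary: \<mu>' rule: runs.induct)
  case (Fork p x \<mu> q \<nu>)
  from Fork.prems obtain \<mu>1 \<nu>1 where
    "\<mu>' = bind_pmf \<mu>1 (\<lambda>(y, t). map_pmf (\<lambda>(z, t'). (Cell y z, Suc (size x) + t + t')) \<nu>1)"
    "runs p x \<mu>1" "runs q x \<nu>1"
    by (auto elim: runs.cases)
  with Fork.IH show ?case by metis
next
  case (Seq p x \<mu> q \<nu>)
  from Seq.prems obtain \<mu>1 \<nu>1 where *: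
    "\<mu>' = bind_pmf \<mu>1 (\<lambda>(y, t). map_pmf (\<lambda>(z, t'). (z, Suc (size x) + t + t')) (\<nu>1 y))"
    "runs p x \<mu>1" "\<forall>y t. (y, t) \<in> set_pmf \<mu>1 \<longrightarrow> runs q y (\<nu>1 y)"
    by (auto elim: runs.cases)
  have [simp]: "\<mu>1 = \<mu>" using Seq.IH(1) *(2) by metis
  have "\<nu> y = \<nu>1 y" if "(y, t) \<in> set_pmf \<mu>" for y t using Seq.IH(2) *(3) that by (simp (no_asm_use)) blast
  then show ?case unfolding *(1) by (intro bind_pmf_cong) auto
next
  case (While_true x p \<mu> \<nu>)
  from While_true.prems While_true.hyps(1) obtain \<mu>1 \<nu>1 where *:
    "\<mu>' = bind_pmf \<mu>1 (\<lambda>(y, t). map_pmf (\<lambda>(z, t'). (z, Suc (size x) + t + t')) (\<nu>1 y))"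
    "runs p x \<mu>1" "\<forall>y t. (y, t) \<in> set_pmf \<mu>1 \<longrightarrow> runs (While p) y (\<nu>1 y)"
    by (auto elim: runs.cases)
  have [simp]: "\<mu>1 = \<mu>" using While_true.IH(1) *(2) by metis
  have "\<nu> y = \<nu>1 y" if "(y, t) \<in> set_pmf \<mu>" for y t using While_true.IH(2) *(3) that by (simp (no_asm_use)) blast
  then show ?case unfolding *(1) by (intro bind_pmf_cong) auto
qed (erule runs.cases; auto)+

text \<open>
  The randomized function \<open>F\<close> is computed in probabilistic polynomial time on inputs from \<open>A\<close>, which
  are handed over in the encoding \<open>enc\<close>.  The bound holds for every run, not just on average.
\<close>

definition ppt :: "('a \<Rightarrow> sexp) \<Rightarrow> 'a set \<Rightarrow> ('a \<Rightarrow> sexp pmf) \<Rightarrow> bool" where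
  "ppt enc A F \<longleftrightarrow>
     (\<exists>p k. \<forall>a\<in>A. \<exists>\<mu>. runs p (enc a) \<mu> \<and> map_pmf fst \<mu> = F a \<and>
        (\<forall>(y, t)\<in>set_pmf \<mu>. t \<le> size (enc a) ^ k + k))"

definition poly_time :: "('a \<Rightarrow> sexp) \<Rightarrow> 'a set \<Rightarrow> ('a \<Rightarrow> sexp) \<Rightarrow> bool" where
  "poly_time enc A f \<longleftrightarrow> ppt enc A (\<lambda>a. return_pmf (f a))"

definition polynomially_bounded :: "(nat \<Rightarrow> nat) \<Rightarrow> bool" where
  "polynomially_bounded f \<longleftrightarrow> (\<exists>k. \<forall>n. f n \<le> n ^ k + k)"


section \<open>Bit strings and encodings\<close>

type_synonym bits = "bool list"

definition xorb :: "bool \<Rightarrow> bool \<Rightarrow> bool" (infixl "xorb" 65) where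
  "a xorb b = (a \<noteq> b)"

definition xors :: "bits \<Rightarrow> bits \<Rightarrow> bits" (infixl "xors" 65) where
  "a xors b = map2 (xorb) a b"

definition scale :: "bool \<Rightarrow> bits \<Rightarrow> bits" where
  "scale t s = map (\<lambda>x. t \<and> x) s"

definition uniform_bits :: "nat \<Rightarrow> bits pmf" where
  "uniform_bits n = pmf_of_set {s. length s = n}"

fun binary :: "nat \<Rightarrow> bits" where
  "binary n = (if n = 0 then [] else odd n # binary (n div 2))"
declare binary.simps [simp del]

fun enc_bool :: "bool \<Rightarrow> sexp" where
  "enc_bool False = Atom"
| "enc_bool True = Cell Atom Atom"

fun enc_list :: "('a \<Rightarrow> sexp) \<Rightarrow> 'a list \<Rightarrow> sexp" where
  "enc_list e [] = Atom"
| "enc_list e (x # xs) = Cell (e x) (enc_list e xs)"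

abbreviation enc_bits :: "bits \<Rightarrow> sexp" where
  "enc_bits \<equiv> enc_list enc_bool"

definition unary :: "nat \<Rightarrow> sexp" where
  "unary n = enc_list (\<lambda>_. Atom) [0..<n]"

definition enc_int :: "int \<Rightarrow> sexp" where
  "enc_int k = Cell (enc_bool (k < 0)) (enc_bits (binary (nat \<bar>k\<bar>)))"


section \<open>Computational indistinguishability\<close>

definition negligible :: "(nat \<Rightarrow> real) \<Rightarrow> bool" where
  "negligible f \<longleftrightarrow> (\<forall>k. \<forall>\<^sub>F n in sequentially. \<bar>f n\<bar> < 1 / real n ^ k)"

definition dist_input :: "nat \<Rightarrow> sexp \<Rightarrow> sexp \<Rightarrow> sexp" where
  "dist_input l z x = Cell (unary l) (Cell z x)"

text \<open>
  Distinguishers are non-uniform: they receive, besides the security parameter in unary and the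
  sample, an advice \<open>z l\<close> of polynomial size.  They have to halt in polynomial time on arbitrary
  samples.
\<close>

definition comp_indist ::
    "(nat \<Rightarrow> sexp pmf) \<Rightarrow> (nat \<Rightarrow> sexp pmf) \<Rightarrow> bool" (infix "\<approx>\<^sub>c" 50) where
  "X \<approx>\<^sub>c Y \<longleftrightarrow>
     (\<forall>z Dst. polynomially_bounded (\<lambda>l. size (z l)) \<and>
        ppt id (range (\<lambda>(l, x). dist_input l (z l) x)) Dst \<longrightarrow>
        negligible (\<lambda>l.
          pmf (bind_pmf (X l) (\<lambda>x. Dst (dist_input l (z l) x))) (enc_bool True) -
          pmf (bind_pmf (Y l) (\<lambda>x. Dst (dist_input l (z l) x))) (enc_bool True)))"


section \<open>Primitives\<close>

definition pseudorandom_generator :: "(bits \<Rightarrow> bits) \<Rightarrow> bool" where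
  "pseudorandom_generator PRG \<longleftrightarrow>
     (\<forall>s. length (PRG s) = 2 * (length s + 1)) \<and>
     poly_time enc_bits UNIV (\<lambda>s. enc_bits (PRG s)) \<and>
     (\<lambda>l. map_pmf (\<lambda>s. enc_bits (PRG s)) (uniform_bits l)) \<approx>\<^sub>c
     (\<lambda>l. map_pmf enc_bits (uniform_bits (2 * (l + 1))))"

definition enc_bits2 :: "bits \<times> bits \<Rightarrow> sexp" where
  "enc_bits2 = (\<lambda>(d, x). Cell (enc_bits d) (enc_bits x))"

definition enc_bits3 :: "bits \<times> bits \<times> bits \<Rightarrow> sexp" where
  "enc_bits3 = (\<lambda>(d, x, y). Cell (enc_bits d) (Cell (enc_bits x) (enc_bits y)))"

text \<open>
  \<open>G d\<close> is the finite abelian group with description \<open>d\<close>; it is written additively and its elements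
  are bit strings.  The ring record is used only for its additive notation: the multiplication
  of \<open>G d\<close> is irrelevant, and \<open>\<one>\<close> is merely the distinguished group element used as the value \<open>1\<close>.
  The algorithms for the group operations halt in polynomial time on all bit strings, but need to be
  correct only for (encodings of) group elements.
\<close>

definition efficient_abelian_groups :: "bits set \<Rightarrow> (bits \<Rightarrow> bits ring) \<Rightarrow> bool" where
  "efficient_abelian_groups \<D> G \<longleftrightarrow>
     (\<forall>d\<in>\<D>. abelian_group (G d) \<and> finite (carrier (G d)) \<and> \<one>\<^bsub>G d\<^esub> \<in> carrier (G d)) \<and>
     (\<exists>k. \<forall>d\<in>\<D>. \<forall>x\<in>carrier (G d). length x \<le> length d ^ k + k) \<and>
     poly_time enc_bits \<D> (\<lambda>d. enc_bits \<zero>\<^bsub>G d\<^esub>) \<and>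
     poly_time enc_bits \<D> (\<lambda>d. enc_bits \<one>\<^bsub>G d\<^esub>) \<and>
     (\<exists>add. poly_time enc_bits3 (\<D> \<times> UNIV \<times> UNIV) add \<and>
        (\<forall>d\<in>\<D>. \<forall>x\<in>carrier (G d). \<forall>y\<in>carrier (G d).
           add (d, x, y) = enc_bits (x \<oplus>\<^bsub>G d\<^esub> y))) \<and>
     (\<exists>neg. poly_time enc_bits2 (\<D> \<times> UNIV) neg \<and>
        (\<forall>d\<in>\<D>. \<forall>x\<in>carrier (G d). neg (d, x) = enc_bits (\<ominus>\<^bsub>G d\<^esub> x)))"

definition pseudorandom_conversion ::
    "bits set \<Rightarrow> (bits \<Rightarrow> bits ring) \<Rightarrow> (bits \<Rightarrow> bits \<Rightarrow> bits) \<Rightarrow> bool" where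
  "pseudorandom_conversion \<D> G Convert \<longleftrightarrow>
     (\<forall>d\<in>\<D>. \<forall>s. Convert d s \<in> carrier (G d)) \<and>
     poly_time enc_bits2 (\<D> \<times> UNIV) (\<lambda>(d, s). enc_bits (Convert d s)) \<and>
     (\<forall>d. range d \<subseteq> \<D> \<and> polynomially_bounded (\<lambda>l. length (d l)) \<longrightarrow>
        (\<lambda>l. map_pmf (\<lambda>s. enc_bits (Convert (d l) s)) (uniform_bits l)) \<approx>\<^sub>c
        (\<lambda>l. map_pmf enc_bits (pmf_of_set (carrier (G (d l))))))"


section \<open>Function secret sharing of point functions\<close>

text \<open>
  Parties, path directions and control bits are Booleans, with \<^term>\<open>False\<close> for \<open>0\<close> (left) and
  \<^term>\<open>True\<close> for \<open>1\<close> (right).  A node of the evaluation tree is a pair of a seed and a control bit.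
\<close>

type_synonym node = "bits \<times> bool"
type_synonym corr_word = "bits \<times> bool \<times> bool"
type_synonym fss_key = "bits \<times> bool \<times> corr_word list \<times> bits"
type_synonym fss_coins = "bits \<times> bits \<times> bool"

definition split_children :: "nat \<Rightarrow> bits \<Rightarrow> node \<times> node" where
  "split_children l y =
     ((take l y, y ! l), (take l (drop (l + 1) y), y ! (2 * l + 1)))"

definition fss_gen_step ::
    "(bits \<Rightarrow> bits) \<Rightarrow> bool \<Rightarrow> node \<times> node \<Rightarrow> corr_word \<times> node \<times> node" where
  "fss_gen_step PRG a = (\<lambda>((s0, t0), (s1, t1)).
     let ((sL0, tL0), (sR0, tR0)) = split_children (length s0) (PRG s0);
         ((sL1, tL1), (sR1, tR1)) = split_children (length s1) (PRG s1);
         (sKeep0, tKeep0) = (if a then (sR0, tR0) else (sL0, tL0));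
         (sKeep1, tKeep1) = (if a then (sR1, tR1) else (sL1, tL1));
         sLose0 = (if a then sL0 else sR0);
         sLose1 = (if a then sL1 else sR1);
         sCW = sLose0 xors sLose1;
         tCWL = tL0 xorb tL1 xorb a xorb True;
         tCWR = tR0 xorb tR1 xorb a;
         tCWKeep = (if a then tCWR else tCWL)
     in ((sCW, tCWL, tCWR),
         (sKeep0 xors scale t0 sCW, tKeep0 xorb (t0 \<and> tCWKeep)),
         (sKeep1 xors scale t1 sCW, tKeep1 xorb (t1 \<and> tCWKeep))))"

fun fss_gen_path ::
    "(bits \<Rightarrow> bits) \<Rightarrow> bits \<Rightarrow> node \<times> node \<Rightarrow> corr_word list \<times> node \<times> node" where
  "fss_gen_path PRG [] st = ([], st)"
| "fss_gen_path PRG (a # as) st =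
     (let (cw, st') = fss_gen_step PRG a st;
          (cws, st'') = fss_gen_path PRG as st'
      in (cw # cws, st''))"

definition signed :: "bits ring \<Rightarrow> bool \<Rightarrow> bits \<Rightarrow> bits" where
  "signed H t g = (if t then \<ominus>\<^bsub>H\<^esub> g else g)"

text \<open>
  In \<open>fss_gen\<close> and \<open>fss_eval\<close>, \<open>H\<close> is the output group and \<open>conv\<close> its conversion map.  The random
  choices \<open>(s0, s1, t0)\<close> of the key generation are an explicit argument of \<open>fss_gen\<close>, since they
  belong to the view of the user who makes them.
\<close>

definition fss_gen ::
    "(bits \<Rightarrow> bits) \<Rightarrow> bits ring \<Rightarrow> (bits \<Rightarrow> bits) \<Rightarrow> bits \<Rightarrow> bits \<Rightarrow> fss_coins
     \<Rightarrow> fss_key \<times> fss_key" where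
  "fss_gen PRG H conv \<alpha> \<beta> = (\<lambda>(s0, s1, t0).
     let t1 = t0 xorb True;
         (cws, (s0n, t0n), (s1n, t1n)) = fss_gen_path PRG \<alpha> ((s0, t0), (s1, t1));
         cw_last = signed H t1n ((\<beta> \<ominus>\<^bsub>H\<^esub> conv s0n) \<oplus>\<^bsub>H\<^esub> conv s1n)
     in ((s0, t0, cws, cw_last), (s1, t1, cws, cw_last)))"

definition fss_coins :: "nat \<Rightarrow> fss_coins pmf" where
  "fss_coins l = do {
     s0 \<leftarrow> uniform_bits l;
     s1 \<leftarrow> uniform_bits l;
     t0 \<leftarrow> pmf_of_set (UNIV :: bool set);
     return_pmf (s0, s1, t0)}"

fun fss_eval_path :: "(bits \<Rightarrow> bits) \<Rightarrow> corr_word list \<Rightarrow> bits \<Rightarrow> node \<Rightarrow> node" where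
  "fss_eval_path PRG ((sCW, tCWL, tCWR) # cws) (x # xs) (s, t) =
     (let (left, right) = split_children (length s)
            (PRG s xors scale t (sCW @ [tCWL] @ sCW @ [tCWR]))
      in fss_eval_path PRG cws xs (if x then right else left))"
| "fss_eval_path PRG _ _ st = st"

definition fss_eval ::
    "(bits \<Rightarrow> bits) \<Rightarrow> bits ring \<Rightarrow> (bits \<Rightarrow> bits) \<Rightarrow> bool \<Rightarrow> fss_key \<Rightarrow> bits \<Rightarrow> bits" where
  "fss_eval PRG H conv c = (\<lambda>(s, t, cws, cw_last) x.
     let (sn, tn) = fss_eval_path PRG cws x (s, t)
     in signed H c (conv sn \<oplus>\<^bsub>H\<^esub> (if tn then cw_last else \<zero>\<^bsub>H\<^esub>)))"


section \<open>The embedding retrieval stage\<close>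

text \<open>
  Users are \<open>0, \<dots>, num_users - 1\<close>, items are \<open>0, \<dots>, num_items - 1\<close>.  The row \<open>j\<close> of the item
  embedding matrix is \<open>(emb j 0, \<dots>, emb j (emb_dim - 1))\<close>, with integer (fixed-point) entries, which
  act on every abelian group.  \<open>groups\<close> lists the descriptions of the output groups, so its length is
  the unified number of retrieved items per user.
\<close>

record retrieval_params =
  num_users :: nat
  num_items :: nat
  emb_dim :: nat
  emb :: "nat \<Rightarrow> nat \<Rightarrow> int"
  groups :: "bits list"

abbreviation num_retrieved :: "retrieval_params \<Rightarrow> nat" where
  "num_retrieved P \<equiv> length (groups P)"

definition id_length :: "nat \<Rightarrow> nat" where
  "id_length m = nat \<lceil>log 2 (real m)\<rceil>"

definition item_id :: "nat \<Rightarrow> nat \<Rightarrow> bits" where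
  "item_id m j = map (\<lambda>i. bit j (id_length m - 1 - i)) [0..<id_length m]"

definition standardize :: "nat \<Rightarrow> nat \<Rightarrow> nat set \<Rightarrow> nat list pmf" where
  "standardize m m' T =
     (if card T \<le> m' then
        map_pmf (\<lambda>fill. sorted_list_of_set T @ fill)
          (pmf_of_set {xs. distinct xs \<and> set xs \<subseteq> {..<m} - T \<and> length xs = m' - card T})
      else pmf_of_set {xs. distinct xs \<and> set xs \<subseteq> T \<and> length xs = m'})"

text \<open>All random choices of a user: the standardized items and the coins of the key generations.\<close>

type_synonym user_coins = "nat list \<times> fss_coins list"

definition user_coins :: "nat \<Rightarrow> retrieval_params \<Rightarrow> nat set \<Rightarrow> user_coins pmf" where
  "user_coins l P T =
     pair_pmf (standardize (num_items P) (num_retrieved P) T)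
       (replicate_pmf (num_retrieved P) (fss_coins l))"

fun sequence_pmf :: "'a pmf list \<Rightarrow> 'a list pmf" where
  "sequence_pmf [] = return_pmf []"
| "sequence_pmf (p # ps) = do {x \<leftarrow> p; xs \<leftarrow> sequence_pmf ps; return_pmf (x # xs)}"

context
  fixes PRG :: "bits \<Rightarrow> bits"
    and G :: "bits \<Rightarrow> bits ring"
    and Convert :: "bits \<Rightarrow> bits \<Rightarrow> bits"
    and P :: retrieval_params
begin

definition retrieval_keys :: "user_coins \<Rightarrow> nat \<Rightarrow> fss_key \<times> fss_key" where
  "retrieval_keys = (\<lambda>(idx, coins) i.
     let d = groups P ! i
     in fss_gen PRG (G d) (Convert d) (item_id (num_items P) (idx ! i)) \<one>\<^bsub>G d\<^esub> (coins ! i))"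

definition retrieval_key :: "bool \<Rightarrow> user_coins \<Rightarrow> nat \<Rightarrow> fss_key" where
  "retrieval_key c r i = (if c then snd else fst) (retrieval_keys r i)"

definition server_response :: "bool \<Rightarrow> fss_key \<Rightarrow> nat \<Rightarrow> bits list" where
  "server_response c K i =
     (let H = G (groups P ! i)
      in map (\<lambda>k. \<Oplus>\<^bsub>H\<^esub>j\<in>{..<num_items P}.
                   [emb P j k] \<cdot>\<^bsub>H\<^esub>
                     fss_eval PRG H (Convert (groups P ! i)) c K (item_id (num_items P) j))
           [0..<emb_dim P])"

end

fun enc_corr_word :: "corr_word \<Rightarrow> sexp" where
  "enc_corr_word (s, tL, tR) = Cell (enc_bits s) (Cell (enc_bool tL) (enc_bool tR))"

fun enc_key :: "fss_key \<Rightarrow> sexp" where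
  "enc_key (s, t, cws, cw_last) =
     Cell (enc_bits s) (Cell (enc_bool t) (Cell (enc_list enc_corr_word cws) (enc_bits cw_last)))"

fun enc_fss_coins :: "fss_coins \<Rightarrow> sexp" where
  "enc_fss_coins (s0, s1, t0) = Cell (enc_bits s0) (Cell (enc_bits s1) (enc_bool t0))"

definition enc_targets :: "nat \<Rightarrow> nat set \<Rightarrow> sexp" where
  "enc_targets m T = enc_list (\<lambda>j. enc_bool (j \<in> T)) [0..<m]"

definition enc_emb :: "retrieval_params \<Rightarrow> sexp" where
  "enc_emb P = enc_list (\<lambda>j. enc_list (\<lambda>k. enc_int (emb P j k)) [0..<emb_dim P]) [0..<num_items P]"

text \<open>
  The view of a semi-honest party consists of its input, its random choices and the messages it
  receives.  A server is deterministic; it receives one key per user and retrieved item.  A user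
  receives the responses of both servers.
\<close>

definition server_view ::
    "(bits \<Rightarrow> bits) \<Rightarrow> (bits \<Rightarrow> bits ring) \<Rightarrow> (bits \<Rightarrow> bits \<Rightarrow> bits) \<Rightarrow> retrieval_params \<Rightarrow>
     bool \<Rightarrow> user_coins list \<Rightarrow> sexp" where
  "server_view PRG G Convert P b rs =
     Cell (enc_emb P)
       (enc_list (\<lambda>r. enc_list (\<lambda>i. enc_key (retrieval_key PRG G Convert P b r i))
                        [0..<num_retrieved P]) rs)"

definition user_view ::
    "(bits \<Rightarrow> bits) \<Rightarrow> (bits \<Rightarrow> bits ring) \<Rightarrow> (bits \<Rightarrow> bits \<Rightarrow> bits) \<Rightarrow> retrieval_params \<Rightarrow>
     nat set \<Rightarrow> user_coins \<Rightarrow> sexp" where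
  "user_view PRG G Convert P T r =
     (let received = (\<lambda>c i. enc_list enc_bits
            (server_response PRG G Convert P c (retrieval_key PRG G Convert P c r i) i))
      in Cell (enc_targets (num_items P) T)
           (Cell (Cell (enc_list (\<lambda>j. enc_bits (item_id (num_items P) j)) (fst r))
                       (enc_list enc_fss_coins (snd r)))
                 (enc_list (\<lambda>i. Cell (received False i) (received True i))
                    [0..<num_retrieved P])))"

text \<open>
  The joint view of server \<open>b\<close> and the users in \<open>C\<close>, when every user \<open>u\<close> has the target items \<open>T u\<close>.
\<close>

definition real_view ::
    "(bits \<Rightarrow> bits) \<Rightarrow> (bits \<Rightarrow> bits ring) \<Rightarrow> (bits \<Rightarrow> bits \<Rightarrow> bits) \<Rightarrow>
     nat \<Rightarrow> retrieval_params \<Rightarrow> (nat \<Rightarrow> nat set) \<Rightarrow> bool \<Rightarrow> nat set \<Rightarrow> sexp pmf" where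
  "real_view PRG G Convert l P T b C =
     map_pmf
       (\<lambda>rs. Cell (server_view PRG G Convert P b rs)
               (enc_list (\<lambda>u. user_view PRG G Convert P (T u) (rs ! u))
                  (filter (\<lambda>u. u \<in> C) [0..<num_users P])))
       (sequence_pmf (map (\<lambda>u. user_coins l P (T u)) [0..<num_users P]))"

text \<open>
  The simulator acts on behalf of the coalition, so it knows who belongs to it and what its members
  hold as their own inputs: the matrix held by server \<open>b\<close> and the target items of the users in \<open>C\<close>.
  Of the target items of the other users nothing is passed on.
\<close>

definition coalition :: "retrieval_params \<Rightarrow> (nat \<Rightarrow> nat set) \<Rightarrow> bool \<Rightarrow> nat set \<Rightarrow> sexp" where
  "coalition P T b C =
     Cell (enc_bool b)
       (Cell (enc_emb P)
          (enc_list
             (\<lambda>u. if u \<in> C then Cell (enc_bool True) (enc_targets (num_items P) (T u))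
                  else Cell (enc_bool False) Atom)
             [0..<num_users P]))"

definition sim_input ::
    "nat \<Rightarrow> retrieval_params \<Rightarrow> (nat \<Rightarrow> nat set) \<Rightarrow> bool \<Rightarrow> nat set \<Rightarrow> sexp" where
  "sim_input l P T b C =
     Cell (unary l)
       (Cell (Cell (unary (num_retrieved P)) (enc_list enc_bits (groups P)))
          (coalition P T b C))"

definition valid_instance ::
    "bits set \<Rightarrow> retrieval_params \<Rightarrow> (nat \<Rightarrow> nat set) \<Rightarrow> nat set \<Rightarrow> bool" where
  "valid_instance \<D> P T C \<longleftrightarrow>
     set (groups P) \<subseteq> \<D> \<and> num_retrieved P \<le> num_items P \<and>
     (\<forall>u<num_users P. T u \<subseteq> {..<num_items P}) \<and> C \<subseteq> {..<num_users P}"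

end

theory Submission
  imports
    Defs
begin

text \<open>
  The simulator hands the coalition keys with uniform correction words whose last word is the
  conversion of a fresh seed. A single key is treated by a hybrid over the levels of the tree: the
  current seed of the other party is uniform and unknown, so its PRG output may be replaced by
  uniform bits; the lost half then masks the correction word, and the kept half is a uniform seed
  for the next level. At the leaf this seed converts to a pseudorandom group element, which masks
  the last correction word. A second hybrid runs over the users and their items. In every reduction
  all remaining randomness is fixed by averaging and passed on as advice of the non-uniform
  distinguisher, so that only deterministic polynomial-time reductions are needed.
\<close>

section \<open>Polynomial bounds\<close>

text \<open>The number of hybrids grows with the security parameter, and averaging leaves a fixed
  value that may vary with the parameter and with the distinguisher. Indistinguishability of single
  sequences is too weak for this: a separate negligible function for each hybrid says nothing about
  their sum. All claims are therefore made for whole families \<open>Q l\<close> with one negligible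
  bound per distinguisher (\<open>unif_indist\<close>), and only the last step returns to sequences.
  The node of the corrupted party is never sampled: it is the evaluation of its key along the path,
  and the control bit of the other party is the complement, so a hybrid needs only the root, the
  words and one fresh seed. The last word is converted from a seed because no sampler for the
  carriers is assumed; hence the conversion assumption is applied twice, to reach a uniform element
  and to leave it again. Users in the coalition are simulated exactly, by running the protocol on
  their own targets; the work there lies in showing that this run is polynomial on a machine without
  numbers.\<close>

named_theorems pb_intros

text \<open>The base n + 2 is at least 2, so one more power absorbs a factor 2, and sums and
  products only add exponents. For \<open>n ^ k + k\<close> this closure is not visible.\<close>

lemma polynomially_bounded_iff: "polynomially_bounded f \<longleftrightarrow> (\<exists>k. \<forall>n. f n \<le> (n + 2) ^ k)"
proof
  assume "polynomially_bounded f"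
  then obtain k where k: "\<And>n. f n \<le> n ^ k + k" by (auto simp: polynomially_bounded_def)
  have "f n \<le> (n + 2) ^ Suc k" for n
  proof -
    have "n ^ k \<le> (n + 2) ^ k" by (intro power_mono) auto
    moreover have "k \<le> (n + 2) ^ k"
      using less_exp[of k] power_mono[of 2 "n + 2" k] by linarith
    ultimately have "f n \<le> 2 * (n + 2) ^ k" using k[of n] by linarith
    also have "\<dots> \<le> (n + 2) * (n + 2) ^ k" by (intro mult_right_mono) auto
    finally show ?thesis by simp
  qed
  then show "\<exists>k. \<forall>n. f n \<le> (n + 2) ^ k" by blast
next
  assume "\<exists>k. \<forall>n. f n \<le> (n + 2) ^ k"
  then obtain k where k: "\<And>n. f n \<le> (n + 2) ^ k" by auto
  \<comment> \<open>For n \<ge> 2, n + 2 \<le> n ^ 2 doubles the exponent; for n \<le> 1 the value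
    is at most 3 ^ k, which goes into the additive constant.\<close>
  let ?K = "2 * k + 3 ^ k"
  have "f n \<le> n ^ ?K + ?K" for n
  proof (cases "n \<ge> 2")
    case True
    have "n + 2 \<le> 2 * n" using True by simp
    also have "\<dots> \<le> n ^ 2" unfolding power2_eq_square by (intro mult_le_mono1 True)
    finally have "n + 2 \<le> n ^ 2" .
    then have "(n + 2) ^ k \<le> (n ^ 2) ^ k" by (intro power_mono) auto
    also have "\<dots> = n ^ (2 * k)" by (simp add: power_mult)
    also have "\<dots> \<le> n ^ ?K" using True by (intro power_increasing) auto
    finally show ?thesis using k[of n] by linarith
  next
    case False
    then have "(n + 2) ^ k \<le> 3 ^ k" by (intro power_mono) auto
    then show ?thesis using k[of n] by linarith
  qed
  then show "polynomially_bounded f" unfolding polynomially_bounded_def by blast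
qed

lemma polynomially_bounded_mono:
  "polynomially_bounded g \<Longrightarrow> (\<And>n. f n \<le> g n) \<Longrightarrow> polynomially_bounded f"
  unfolding polynomially_bounded_def by (meson order_trans)

lemma polynomially_bounded_const [pb_intros]: "polynomially_bounded (\<lambda>_. c)"
  unfolding polynomially_bounded_def by (intro exI[of _ c]) auto

lemma polynomially_bounded_id [pb_intros]: "polynomially_bounded (\<lambda>n. n)"
  unfolding polynomially_bounded_def by (intro exI[of _ 1]) auto

lemma polynomially_bounded_add [pb_intros]:
  assumes "polynomially_bounded f" "polynomially_bounded g"
  shows "polynomially_bounded (\<lambda>n. f n + g n)"
proof -
  from assms obtain a b where a: "\<And>n. f n \<le> (n + 2) ^ a" and b: "\<And>n. g n \<le> (n + 2) ^ b"
    unfolding polynomially_bounded_iff by blast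
  have "f n + g n \<le> (n + 2) ^ Suc (a + b)" for n
  proof -
    have "(n + 2) ^ a \<le> (n + 2) ^ (a + b)" "(n + 2) ^ b \<le> (n + 2) ^ (a + b)"
      by (intro power_increasing; simp)+
    then have "f n + g n \<le> 2 * (n + 2) ^ (a + b)" using a[of n] b[of n] by linarith
    also have "\<dots> \<le> (n + 2) * (n + 2) ^ (a + b)" by (intro mult_right_mono) auto
    finally show ?thesis by simp
  qed
  then show ?thesis unfolding polynomially_bounded_iff by blast
qed

lemma polynomially_bounded_mult [pb_intros]:
  assumes "polynomially_bounded f" "polynomially_bounded g"
  shows "polynomially_bounded (\<lambda>n. f n * g n)"
proof -
  from assms obtain a b where a: "\<And>n. f n \<le> (n + 2) ^ a" and b: "\<And>n. g n \<le> (n + 2) ^ b"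
    unfolding polynomially_bounded_iff by blast
  have "f n * g n \<le> (n + 2) ^ (a + b)" for n
    unfolding power_add by (intro mult_le_mono a b)
  then show ?thesis unfolding polynomially_bounded_iff by blast
qed

lemma polynomially_bounded_Suc [pb_intros]:
  "polynomially_bounded f \<Longrightarrow> polynomially_bounded (\<lambda>n. Suc (f n))"
  using polynomially_bounded_add[OF _ polynomially_bounded_const[of 1], of f] by simp

lemma polynomially_bounded_power [pb_intros]:
  "polynomially_bounded f \<Longrightarrow> polynomially_bounded (\<lambda>n. f n ^ k)"
  by (induction k) (auto intro: pb_intros)

lemma polynomially_bounded_compose:
  assumes "polynomially_bounded f" "polynomially_bounded g"
  shows "polynomially_bounded (\<lambda>n. f (g n))"
proof -
  from assms(1) obtain k where k: "\<And>n. f n \<le> n ^ k + k" unfolding polynomially_bounded_def by blast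
  have "polynomially_bounded (\<lambda>n. g n ^ k + k)" by (intro pb_intros assms)
  then show ?thesis using k by (rule polynomially_bounded_mono)
qed

text \<open>Time bounds are later applied to upper estimates of a size, not to the size itself, and
  this requires monotonicity.\<close>

lemma polynomially_bounded_monoE:
  assumes "polynomially_bounded f"
  obtains g where "polynomially_bounded g" "mono g" "\<And>n. f n \<le> g n"
proof -
  from assms obtain k where k: "\<And>n. f n \<le> n ^ k + k" unfolding polynomially_bounded_def by blast
  show thesis
    by (rule that[of "\<lambda>n. n ^ k + k"]) (auto intro!: pb_intros k monoI power_mono)
qed

section \<open>Running time of programs\<close>

text \<open>The joint law of output and time is forgotten: the output law and a worst-case time
  bound compose separately.\<close>

definition halts_in :: "prog \<Rightarrow> sexp \<Rightarrow> sexp pmf \<Rightarrow> nat \<Rightarrow> bool" where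
  "halts_in p x M T \<longleftrightarrow> (\<exists>\<mu>. runs p x \<mu> \<and> map_pmf fst \<mu> = M \<and> (\<forall>(y, t)\<in>set_pmf \<mu>. t \<le> T))"

lemma halts_in_le: "halts_in p x M T \<Longrightarrow> T \<le> T' \<Longrightarrow> halts_in p x M T'"
  unfolding halts_in_def by (fast elim: order_trans)

lemma halts_in_unique: "halts_in p x M T \<Longrightarrow> halts_in p x M' T' \<Longrightarrow> M = M'"
  unfolding halts_in_def using runs_deterministic by blast

lemma size_elements: "y \<in> set (elements x) \<Longrightarrow> size y \<le> size x"
  by (induction x rule: elements.induct) auto

lemma size_car: "size (car x) \<le> size x" and size_cdr: "size (cdr x) \<le> size x"
  by (cases x; simp)+

text \<open>Every value is charged when it is handled, so a fast program has a small output. This is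
  what makes sequential composition polynomial.\<close>

lemma runs_size: "runs p x \<mu> \<Longrightarrow> (y, t) \<in> set_pmf \<mu> \<Longrightarrow> size y \<le> t"
proof (induction arbitrary: y t rule: runs.induct)
  case (Fork p x \<mu> q \<nu>)
  then show ?case by (fastforce simp: set_bind_pmf)
next
  case (Seq p x \<mu> q \<nu>)
  then show ?case by (fastforce simp: set_bind_pmf)
next
  case (While_true x p \<mu> \<nu>)
  then show ?case by (fastforce simp: set_bind_pmf)
next
  case (Choose x)
  then have "y \<in> set (elements x)" "t = Suc (size x)"
    by (auto simp: set_pmf_of_set lessThan_empty_iff)
  then show ?case using size_elements by (metis le_SucI)
qed (use size_car size_cdr in \<open>fastforce intro: le_SucI\<close>)+

lemma halts_in_size: "halts_in p x M T \<Longrightarrow> y \<in> set_pmf M \<Longrightarrow> size y \<le> T"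
  unfolding halts_in_def using runs_size by fastforce

lemma halts_in_Copy: "halts_in Copy x (return_pmf x) (Suc (size x))"
  and halts_in_Nul: "halts_in Nul x (return_pmf Atom) (Suc (size x))"
  and halts_in_Car: "halts_in Car x (return_pmf (car x)) (Suc (size x))"
  and halts_in_Cdr: "halts_in Cdr x (return_pmf (cdr x)) (Suc (size x))"
  unfolding halts_in_def by (intro exI conjI, rule runs.intros, simp, simp)+

lemma halts_in_Choose:
  assumes "elements x \<noteq> []"
  shows "halts_in Choose x (map_pmf ((!) (elements x)) (pmf_of_set {..<length (elements x)})) (Suc (size x))"
  unfolding halts_in_def
  by (intro exI conjI, rule runs.Choose[OF assms]) (auto simp: pmf.map_comp o_def)

lemma halts_in_Fork:
  assumes "halts_in p x M T1" "halts_in q x N T2"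
  shows "halts_in (Fork p q) x (bind_pmf M (\<lambda>y. map_pmf (Cell y) N)) (Suc (size x) + T1 + T2)"
proof -
  obtain \<mu> \<nu> where \<mu>: "runs p x \<mu>" "map_pmf fst \<mu> = M" "\<And>y t. (y, t) \<in> set_pmf \<mu> \<Longrightarrow> t \<le> T1"
    and \<nu>: "runs q x \<nu>" "map_pmf fst \<nu> = N" "\<And>y t. (y, t) \<in> set_pmf \<nu> \<Longrightarrow> t \<le> T2"
    using assms unfolding halts_in_def by blast
  show ?thesis unfolding halts_in_def
    apply (intro exI conjI, rule runs.Fork[OF \<mu>(1) \<nu>(1)])
    using \<mu>(3) \<nu>(3)
    by (auto simp: map_bind_pmf bind_map_pmf split_beta pmf.map_comp o_def simp flip: \<mu>(2) \<nu>(2)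
        intro!: add_mono)
qed

lemma bind_step_pmf:
  assumes "map_pmf fst \<mu> = M" "\<And>y. y \<in> set_pmf M \<Longrightarrow> map_pmf fst (\<nu> y) = N y"
  shows "map_pmf fst (bind_pmf \<mu> (\<lambda>(y, t). map_pmf (\<lambda>(z, t'). (z, c + t + t')) (\<nu> y))) = bind_pmf M N"
proof -
  have "map_pmf fst (bind_pmf \<mu> (\<lambda>(y, t). map_pmf (\<lambda>(z, t'). (z, c + t + t')) (\<nu> y)))
      = bind_pmf \<mu> (\<lambda>x. map_pmf fst (\<nu> (fst x)))"
    by (simp add: map_bind_pmf split_beta pmf.map_comp o_def)
  also have "\<dots> = bind_pmf \<mu> (\<lambda>x. N (fst x))"
    by (intro bind_pmf_cong refl assms(2)) (auto simp flip: assms(1))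
  also have "\<dots> = bind_pmf M N" by (simp add: bind_map_pmf flip: assms(1))
  finally show ?thesis .
qed

lemma halts_in_Seq:
  assumes "halts_in p x M T1" "\<And>y. y \<in> set_pmf M \<Longrightarrow> halts_in q y (N y) T2"
  shows "halts_in (Seq p q) x (bind_pmf M N) (Suc (size x) + T1 + T2)"
proof -
  obtain \<mu> where \<mu>: "runs p x \<mu>" "map_pmf fst \<mu> = M" "\<And>y t. (y, t) \<in> set_pmf \<mu> \<Longrightarrow> t \<le> T1"
    using assms unfolding halts_in_def by blast
  have "\<forall>y\<in>set_pmf M. \<exists>\<nu>. runs q y \<nu> \<and> map_pmf fst \<nu> = N y \<and> (\<forall>(z, t)\<in>set_pmf \<nu>. t \<le> T2)"
    using assms(2) unfolding halts_in_def by blast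
  \<comment> \<open>The rule for \<open>Seq\<close> asks for a single function from intermediate
    values to continuation laws.\<close>
  from bchoice[OF this] obtain \<nu> where
    "\<forall>y\<in>set_pmf M. runs q y (\<nu> y) \<and> map_pmf fst (\<nu> y) = N y \<and> (\<forall>(z, t)\<in>set_pmf (\<nu> y). t \<le> T2)"
    by blast
  then have \<nu>: "\<And>y. y \<in> set_pmf M \<Longrightarrow> runs q y (\<nu> y)"
    "\<And>y. y \<in> set_pmf M \<Longrightarrow> map_pmf fst (\<nu> y) = N y"
    "\<And>y z t. y \<in> set_pmf M \<Longrightarrow> (z, t) \<in> set_pmf (\<nu> y) \<Longrightarrow> t \<le> T2"
    by fastforce+
  have M: "(y, t) \<in> set_pmf \<mu> \<Longrightarrow> y \<in> set_pmf M" for y t by (force simp flip: \<mu>(2))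
  let ?\<rho> = "bind_pmf \<mu> (\<lambda>(y, t). map_pmf (\<lambda>(z, t'). (z, Suc (size x) + t + t')) (\<nu> y))"
  have "runs (Seq p q) x ?\<rho>" by (rule runs.Seq[OF \<mu>(1)]) (use M \<nu>(1) in blast)
  moreover have "map_pmf fst ?\<rho> = bind_pmf M N" by (rule bind_step_pmf; fact)
  moreover have "\<forall>(y, t)\<in>set_pmf ?\<rho>. t \<le> Suc (size x) + T1 + T2"
    using \<mu>(3) M \<nu>(3) by (force intro!: add_mono)
  ultimately show ?thesis unfolding halts_in_def by blast
qed

lemma halts_in_While_true:
  assumes "car x \<noteq> Atom" "halts_in p x M T1" "\<And>y. y \<in> set_pmf M \<Longrightarrow> halts_in (While p) y (N y) T2"
  shows "halts_in (While p) x (bind_pmf M N) (Suc (size x) + T1 + T2)"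
proof -
  obtain \<mu> where \<mu>: "runs p x \<mu>" "map_pmf fst \<mu> = M" "\<And>y t. (y, t) \<in> set_pmf \<mu> \<Longrightarrow> t \<le> T1"
    using assms unfolding halts_in_def by blast
  have "\<forall>y\<in>set_pmf M. \<exists>\<nu>. runs (While p) y \<nu> \<and> map_pmf fst \<nu> = N y \<and> (\<forall>(z, t)\<in>set_pmf \<nu>. t \<le> T2)"
    using assms(3) unfolding halts_in_def by blast
  from bchoice[OF this] obtain \<nu> where
    "\<forall>y\<in>set_pmf M. runs (While p) y (\<nu> y) \<and> map_pmf fst (\<nu> y) = N y \<and> (\<forall>(z, t)\<in>set_pmf (\<nu> y). t \<le> T2)"
    by blast
  then have \<nu>: "\<And>y. y \<in> set_pmf M \<Longrightarrow> runs (While p) y (\<nu> y)"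
    "\<And>y. y \<in> set_pmf M \<Longrightarrow> map_pmf fst (\<nu> y) = N y"
    "\<And>y z t. y \<in> set_pmf M \<Longrightarrow> (z, t) \<in> set_pmf (\<nu> y) \<Longrightarrow> t \<le> T2"
    by fastforce+
  have M: "(y, t) \<in> set_pmf \<mu> \<Longrightarrow> y \<in> set_pmf M" for y t by (force simp flip: \<mu>(2))
  let ?\<rho> = "bind_pmf \<mu> (\<lambda>(y, t). map_pmf (\<lambda>(z, t'). (z, Suc (size x) + t + t')) (\<nu> y))"
  have "runs (While p) x ?\<rho>" by (rule runs.While_true[OF assms(1) \<mu>(1)]) (use M \<nu>(1) in blast)
  moreover have "map_pmf fst ?\<rho> = bind_pmf M N" by (rule bind_step_pmf; fact)
  moreover have "\<forall>(y, t)\<in>set_pmf ?\<rho>. t \<le> Suc (size x) + T1 + T2"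
    using \<mu>(3) M \<nu>(3) by (force intro!: add_mono)
  ultimately show ?thesis unfolding halts_in_def by blast
qed

lemma halts_in_While_false:
  assumes "car x = Atom" shows "halts_in (While p) x (return_pmf x) (Suc (size x))"
  unfolding halts_in_def by (intro exI conjI, rule runs.While_false[OF assms]) auto

lemma halts_in_Ite:
  assumes "halts_in (if car x \<noteq> Atom then p else q) x M T"
  shows "halts_in (Ite p q) x M (Suc (size x) + T)"
proof -
  obtain \<mu> where \<mu>: "runs (if car x \<noteq> Atom then p else q) x \<mu>" "map_pmf fst \<mu> = M"
    "\<And>y t. (y, t) \<in> set_pmf \<mu> \<Longrightarrow> t \<le> T"
    using assms unfolding halts_in_def by blast
  have "runs (Ite p q) x (map_pmf (\<lambda>(y, t). (y, Suc (size x) + t)) \<mu>)"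
    using \<mu>(1) runs.Ite_true[of x p \<mu> q] runs.Ite_false[of x q \<mu> p] by (cases "car x = Atom") auto
  then show ?thesis unfolding halts_in_def
    by (intro exI[of _ "map_pmf (\<lambda>(y, t). (y, Suc (size x) + t)) \<mu>"] conjI) (use \<mu>(2,3) in \<open>auto simp: pmf.map_comp o_def split_beta\<close>)
qed

text \<open>Bounds of the fixed shape \<open>n ^ k + k\<close> are awkward to compose; any monotone
  polynomially bounded function serves as well.\<close>

lemma ppt_iff:
  "ppt e A F \<longleftrightarrow> (\<exists>p g. polynomially_bounded g \<and> mono g \<and> (\<forall>a\<in>A. halts_in p (e a) (F a) (g (size (e a)))))"
proof
  assume "ppt e A F"
  then obtain p k where "\<forall>a\<in>A. halts_in p (e a) (F a) (size (e a) ^ k + k)"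
    unfolding ppt_def halts_in_def by blast
  then show "\<exists>p g. polynomially_bounded g \<and> mono g \<and> (\<forall>a\<in>A. halts_in p (e a) (F a) (g (size (e a))))"
    by (intro exI[of _ p] exI[of _ "\<lambda>n. n ^ k + k"]) (auto intro!: pb_intros monoI power_mono)
next
  assume "\<exists>p g. polynomially_bounded g \<and> mono g \<and> (\<forall>a\<in>A. halts_in p (e a) (F a) (g (size (e a))))"
  then obtain p g k where "\<And>n. g n \<le> n ^ k + k" "\<forall>a\<in>A. halts_in p (e a) (F a) (g (size (e a)))"
    unfolding polynomially_bounded_def by blast
  then have "\<forall>a\<in>A. halts_in p (e a) (F a) (size (e a) ^ k + k)" using halts_in_le by blast
  then show "ppt e A F" unfolding ppt_def halts_in_def by blast
qed

section \<open>Typed polynomial-time functions\<close>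

text \<open>Encodings on both sides give programs a type. Rules about HOL functions can then replace
  explicit programs almost everywhere.\<close>

definition rt :: "('a \<Rightarrow> sexp) \<Rightarrow> 'a set \<Rightarrow> ('b \<Rightarrow> sexp) \<Rightarrow> ('a \<Rightarrow> 'b pmf) \<Rightarrow> bool" where
  "rt e A e' F \<longleftrightarrow> ppt e A (\<lambda>a. map_pmf e' (F a))"

definition pt :: "('a \<Rightarrow> sexp) \<Rightarrow> 'a set \<Rightarrow> ('b \<Rightarrow> sexp) \<Rightarrow> ('a \<Rightarrow> 'b) \<Rightarrow> bool" where
  "pt e A e' f \<longleftrightarrow> rt e A e' (\<lambda>a. return_pmf (f a))"

definition enc_pair :: "('a \<Rightarrow> sexp) \<Rightarrow> ('b \<Rightarrow> sexp) \<Rightarrow> 'a \<times> 'b \<Rightarrow> sexp" where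
  "enc_pair e1 e2 = (\<lambda>(a, b). Cell (e1 a) (e2 b))"

lemma enc_pair_simp [simp]: "enc_pair e1 e2 (a, b) = Cell (e1 a) (e2 b)"
  by (simp add: enc_pair_def)

lemma rtI:
  assumes "polynomially_bounded g" "\<And>a. a \<in> A \<Longrightarrow> halts_in p (e a) (map_pmf e' (F a)) (g (size (e a)))"
  shows "rt e A e' F"
proof -
  obtain h where h: "polynomially_bounded h" "mono h" "\<And>n. g n \<le> h n"
    using polynomially_bounded_monoE[OF assms(1)] by blast
  show ?thesis unfolding rt_def ppt_iff
    by (rule exI[of _ p], rule exI[of _ h]) (use h assms(2) halts_in_le in blast)
qed

lemma rtD:
  "rt e A e' F \<Longrightarrow> \<exists>g p. polynomially_bounded g \<and> mono g \<and>
    (\<forall>a\<in>A. halts_in p (e a) (map_pmf e' (F a)) (g (size (e a))))"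
  unfolding rt_def ppt_iff by blast

lemma ptI:
  assumes "polynomially_bounded g" "\<And>a. a \<in> A \<Longrightarrow> halts_in p (e a) (return_pmf (e' (f a))) (g (size (e a)))"
  shows "pt e A e' f"
  unfolding pt_def by (rule rtI[OF assms(1)]) (use assms(2) in auto)

lemma rt_return: "pt e A e' f \<Longrightarrow> rt e A e' (\<lambda>a. return_pmf (f a))"
  by (simp add: pt_def)

lemma rt_subset: "rt e A e' F \<Longrightarrow> B \<subseteq> A \<Longrightarrow> rt e B e' F"
  unfolding rt_def ppt_def by blast

lemma pt_subset: "pt e A e' f \<Longrightarrow> B \<subseteq> A \<Longrightarrow> pt e B e' f"
  unfolding pt_def by (rule rt_subset)

lemma rt_cong: "rt e A e' F \<Longrightarrow> (\<And>a. a \<in> A \<Longrightarrow> F a = H a) \<Longrightarrow> rt e A e' H"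
  unfolding rt_def ppt_def by simp

lemma pt_cong: "pt e A e' f \<Longrightarrow> (\<And>a. a \<in> A \<Longrightarrow> f a = h a) \<Longrightarrow> pt e A e' h"
  unfolding pt_def by (erule rt_cong) simp

lemma rt_size:
  assumes "rt e A e' F"
  shows "\<exists>g. polynomially_bounded g \<and> mono g \<and> (\<forall>a\<in>A. \<forall>b\<in>set_pmf (F a). size (e' b) \<le> g (size (e a)))"
proof -
  obtain g p where p: "polynomially_bounded g" "mono g"
    "\<And>a. a \<in> A \<Longrightarrow> halts_in p (e a) (map_pmf e' (F a)) (g (size (e a)))" using rtD[OF assms] by blast
  show ?thesis by (intro exI[of _ g]) (use p halts_in_size[OF p(3)] in auto)
qed

lemma pt_size:
  "pt e A e' f \<Longrightarrow> \<exists>g. polynomially_bounded g \<and> mono g \<and> (\<forall>a\<in>A. size (e' (f a)) \<le> g (size (e a)))"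
  unfolding pt_def by (drule rt_size) simp

lemma poly_time_iff_pt: "poly_time e A (\<lambda>a. e' (f a)) \<longleftrightarrow> pt e A e' f"
  by (simp add: poly_time_def pt_def rt_def)

text \<open>Encodings need not be injective: the output of a program on \<open>e a\<close> depends on \<open>e a\<close> only.\<close>

lemma ppt_to_id:
  assumes "ppt e A F"
  shows "\<exists>H. ppt id (e ` A) H \<and> (\<forall>a\<in>A. H (e a) = F a)"
proof -
  from assms obtain g p where p: "polynomially_bounded g" "mono g"
    "\<And>a. a \<in> A \<Longrightarrow> halts_in p (e a) (F a) (g (size (e a)))"
    unfolding ppt_iff by blast
  \<comment> \<open>Any preimage of a code will do, since equal codes have equal output laws by
    \<open>halts_in_unique\<close>.\<close>
  define H where "H x = F (SOME a. a \<in> A \<and> e a = x)" for x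
  have H: "H (e a) = F a" if "a \<in> A" for a
  proof -
    have "(SOME a'. a' \<in> A \<and> e a' = e a) \<in> A \<and> e (SOME a'. a' \<in> A \<and> e a' = e a) = e a"
      using that by (metis (mono_tags, lifting) someI_ex)
    then show ?thesis unfolding H_def using p(3) that halts_in_unique by metis
  qed
  show ?thesis
    by (intro exI[of _ H]) (use p H in \<open>auto simp: ppt_iff intro!: exI[of _ p] exI[of _ g]\<close>)
qed

text \<open>The second program starts on a value whose size is at most the first running time, which
  gives the summand h (g n) of the bound.\<close>

lemma rt_bind0:
  assumes "rt e A e1 F" "rt e1 B e2 H" "\<And>a b. a \<in> A \<Longrightarrow> b \<in> set_pmf (F a) \<Longrightarrow> b \<in> B"
  shows "rt e A e2 (\<lambda>a. bind_pmf (F a) H)"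
proof -
  obtain g p where p: "polynomially_bounded g" "mono g"
    "\<And>a. a \<in> A \<Longrightarrow> halts_in p (e a) (map_pmf e1 (F a)) (g (size (e a)))" using rtD[OF assms(1)] by blast
  obtain h q where q: "polynomially_bounded h" "mono h"
    "\<And>b. b \<in> B \<Longrightarrow> halts_in q (e1 b) (map_pmf e2 (H b)) (h (size (e1 b)))" using rtD[OF assms(2)] by blast
  \<comment> \<open>The second program sees only the code of the intermediate value, so its law is
    needed as a function \<open>K\<close> of the code.\<close>
  obtain K where K: "\<And>b. b \<in> B \<Longrightarrow> K (e1 b) = map_pmf e2 (H b)"
    using ppt_to_id[OF assms(2)[unfolded rt_def]] by blast
  show ?thesis
  proof (rule rtI[where p = "Seq p q" and g = "\<lambda>n. Suc n + g n + h (g n)"])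
    show "polynomially_bounded (\<lambda>n. Suc n + g n + h (g n))"
      by (intro pb_intros p q polynomially_bounded_compose[OF q(1)])
    fix a assume a: "a \<in> A"
    have "halts_in q y (K y) (h (g (size (e a))))" if "y \<in> set_pmf (map_pmf e1 (F a))" for y
    proof -
      obtain b where b: "b \<in> set_pmf (F a)" "y = e1 b" using \<open>y \<in> _\<close> by auto
      then have "b \<in> B" using assms(3) a by auto
      moreover have "size y \<le> g (size (e a))" using halts_in_size[OF p(3)[OF a] that] .
      ultimately show ?thesis using q(3)[of b] K[of b] b(2) halts_in_le monoD[OF q(2)] by metis
    qed
    note * = halts_in_Seq[OF p(3)[OF a] this]
    have "bind_pmf (map_pmf e1 (F a)) K = map_pmf e2 (bind_pmf (F a) H)"
      unfolding bind_map_pmf map_bind_pmf by (intro bind_pmf_cong) (use K assms(3) a in auto)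
    then show "halts_in (Seq p q) (e a) (map_pmf e2 (bind_pmf (F a) H))
        (Suc (size (e a)) + g (size (e a)) + h (g (size (e a))))" using * by simp
  qed
qed

lemma rt_pair:
  assumes "rt e A e1 F" "rt e A e2 H"
  shows "rt e A (enc_pair e1 e2) (\<lambda>a. pair_pmf (F a) (H a))"
proof -
  obtain g p where p: "polynomially_bounded g" "mono g"
    "\<And>a. a \<in> A \<Longrightarrow> halts_in p (e a) (map_pmf e1 (F a)) (g (size (e a)))" using rtD[OF assms(1)] by blast
  obtain h q where q: "polynomially_bounded h" "mono h"
    "\<And>a. a \<in> A \<Longrightarrow> halts_in q (e a) (map_pmf e2 (H a)) (h (size (e a)))" using rtD[OF assms(2)] by blast
  show ?thesis
  proof (rule rtI[where p = "Fork p q" and g = "\<lambda>n. Suc n + g n + h n"])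
    fix a assume a: "a \<in> A"
    have "map_pmf (enc_pair e1 e2) (pair_pmf (F a) (H a)) =
      bind_pmf (map_pmf e1 (F a)) (\<lambda>y. map_pmf (Cell y) (map_pmf e2 (H a)))"
      by (simp add: pair_pmf_def map_bind_pmf bind_map_pmf map_pmf_def bind_return_pmf bind_assoc_pmf)
    then show "halts_in (Fork p q) (e a) (map_pmf (enc_pair e1 e2) (pair_pmf (F a) (H a)))
        (Suc (size (e a)) + g (size (e a)) + h (size (e a)))"
      using halts_in_Fork[OF p(3)[OF a] q(3)[OF a]] by simp
  qed (intro pb_intros p q)
qed

lemma pt_pair: "pt e A e1 f \<Longrightarrow> pt e A e2 h \<Longrightarrow> pt e A (enc_pair e1 e2) (\<lambda>a. (f a, h a))"
  unfolding pt_def by (drule (1) rt_pair) (simp add: pair_return_pmf1)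

text \<open>When two data share their code, \<open>Copy\<close> converts between them. Many changes
  of view below, such as lists as pairs or numbers as lists of atoms, are of this kind.\<close>

lemma pt_recode: "(\<And>a. a \<in> A \<Longrightarrow> e' (f a) = e a) \<Longrightarrow> pt e A e' f"
  by (rule ptI[where p = Copy and g = Suc]) (use halts_in_Copy in \<open>auto intro: pb_intros\<close>)

lemma pt_id: "pt e A e (\<lambda>a. a)"
  by (rule pt_recode) simp

lemma rt_comp: "rt e1 B e2 F \<Longrightarrow> pt e A e1 f \<Longrightarrow> (\<And>a. a \<in> A \<Longrightarrow> f a \<in> B) \<Longrightarrow> rt e A e2 (\<lambda>a. F (f a))"
  unfolding pt_def using rt_bind0[of e A e1 "\<lambda>a. return_pmf (f a)" B e2 F] by (simp add: bind_return_pmf)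

lemma pt_comp: "pt e1 B e2 h \<Longrightarrow> pt e A e1 f \<Longrightarrow> (\<And>a. a \<in> A \<Longrightarrow> f a \<in> B) \<Longrightarrow> pt e A e2 (\<lambda>a. h (f a))"
  unfolding pt_def[of e1] pt_def[of e A e2] by (rule rt_comp)

text \<open>The input is copied next to the sample, so that the continuation may use both.\<close>

lemma rt_bind:
  assumes "rt e A e1 F" "rt (enc_pair e e1) {(a, b). a \<in> A \<and> b \<in> set_pmf (F a)} e2 (\<lambda>x. H (fst x) (snd x))"
  shows "rt e A e2 (\<lambda>a. bind_pmf (F a) (H a))"
proof -
  have "rt e A (enc_pair e e1) (\<lambda>a. pair_pmf (return_pmf a) (F a))"
    by (intro rt_pair rt_return pt_id assms)
  from rt_bind0[OF this assms(2)] show ?thesis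
    by (auto simp: pair_return_pmf1 bind_map_pmf)
qed

lemma rt_map:
  assumes "rt e A e1 F" "pt (enc_pair e e1) {(a, b). a \<in> A \<and> b \<in> set_pmf (F a)} e2 (\<lambda>x. h (fst x) (snd x))"
  shows "rt e A e2 (\<lambda>a. map_pmf (h a) (F a))"
  unfolding map_pmf_def using assms by (intro rt_bind[OF assms(1)] rt_return) (simp add: split_beta)

lemma pt_fst0: "pt (enc_pair e1 e2) A e1 fst"
proof (rule ptI[where p = Car and g = Suc])
  fix a show "halts_in Car (enc_pair e1 e2 a) (return_pmf (e1 (fst a))) (Suc (size (enc_pair e1 e2 a)))"
    using halts_in_Car[of "enc_pair e1 e2 a"] by (cases a) simp
qed (intro pb_intros)

lemma pt_snd0: "pt (enc_pair e1 e2) A e2 snd"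
proof (rule ptI[where p = Cdr and g = Suc])
  fix a show "halts_in Cdr (enc_pair e1 e2 a) (return_pmf (e2 (snd a))) (Suc (size (enc_pair e1 e2 a)))"
    using halts_in_Cdr[of "enc_pair e1 e2 a"] by (cases a) simp
qed (intro pb_intros)

lemma pt_fst: "pt e A (enc_pair e1 e2) f \<Longrightarrow> pt e A e1 (\<lambda>a. fst (f a))"
  by (rule pt_comp[OF pt_fst0[of _ _ UNIV]]) auto

lemma pt_snd: "pt e A (enc_pair e1 e2) f \<Longrightarrow> pt e A e2 (\<lambda>a. snd (f a))"
  by (rule pt_comp[OF pt_snd0[of _ _ UNIV]]) auto

text \<open>Each elementary step costs the size of the input even if it ignores it; hence the bound
  is linear in the input, with a factor depending on the constant.\<close>

lemma halts_in_const: "\<exists>p. \<exists>k. \<forall>x. halts_in p x (return_pmf c) (k * Suc (size x))"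
proof (induction c)
  case Atom
  show ?case by (rule exI[of _ Nul], rule exI[of _ 1]) (use halts_in_Nul in simp)
next
  case (Cell a b)
  then obtain p k q k' where p: "\<And>x. halts_in p x (return_pmf a) (k * Suc (size x))"
    and q: "\<And>x. halts_in q x (return_pmf b) (k' * Suc (size x))" by blast
  have "halts_in (Fork p q) x (return_pmf (Cell a b)) ((1 + k + k') * Suc (size x))" for x
    using halts_in_Fork[OF p[of x] q[of x]] by (simp add: bind_return_pmf algebra_simps)
  then show ?case by blast
qed

lemma pt_const: "pt e A e' (\<lambda>_. c)"
proof -
  obtain p k where "\<And>x. halts_in p x (return_pmf (e' c)) (k * Suc (size x))"
    using halts_in_const by blast
  then show ?thesis by (intro ptI[where p = p and g = "\<lambda>n. k * Suc n"]) (auto intro!: pb_intros)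
qed

text \<open>\<open>Ite\<close> tests the first component of its argument, so the value of the
  condition is put in front of the input and removed again by \<open>Cdr\<close> in either
  branch.\<close>

lemma rt_if:
  assumes "pt e A enc_bool c" "rt e {a\<in>A. c a} e' F" "rt e {a\<in>A. \<not> c a} e' H"
  shows "rt e A e' (\<lambda>a. if c a then F a else H a)"
proof -
  obtain g p where p: "polynomially_bounded g" "mono g"
    "\<And>a. a \<in> {a\<in>A. c a} \<Longrightarrow> halts_in p (e a) (map_pmf e' (F a)) (g (size (e a)))" using rtD[OF assms(2)] by blast
  obtain h q where q: "polynomially_bounded h" "mono h"
    "\<And>a. a \<in> {a\<in>A. \<not> c a} \<Longrightarrow> halts_in q (e a) (map_pmf e' (H a)) (h (size (e a)))" using rtD[OF assms(3)] by blast
  have "rt (enc_pair enc_bool e) {(b, a). a \<in> A \<and> b = c a} e' (\<lambda>(b, a). if c a then F a else H a)"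
  proof (rule rtI[where p = "Ite (Seq Cdr p) (Seq Cdr q)" and g = "\<lambda>n. Suc n + (Suc n + Suc n + (g n + h n))"])
    fix ba assume "ba \<in> {(b, a). a \<in> A \<and> b = c a}"
    then obtain a where a: "a \<in> A" "ba = (c a, a)" by auto
    let ?x = "Cell (enc_bool (c a)) (e a)" and ?r = "if c a then p else q"
    let ?R = "map_pmf e' (if c a then F a else H a)"
    have le: "g (size (e a)) + h (size (e a)) \<le> g (size ?x) + h (size ?x)"
      by (intro add_mono monoD[OF p(2)] monoD[OF q(2)]) auto
    have "halts_in ?r (e a) ?R (g (size (e a)) + h (size (e a)))"
      using a p(3)[of a] q(3)[of a] by (cases "c a") (auto elim!: halts_in_le)
    then have "halts_in ?r (cdr ?x) ?R (g (size ?x) + h (size ?x))"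
      using le by (auto elim!: halts_in_le)
    then have "halts_in (Seq Cdr ?r) ?x ?R (Suc (size ?x) + Suc (size ?x) + (g (size ?x) + h (size ?x)))"
      using halts_in_Seq[OF halts_in_Cdr, of ?x ?r "\<lambda>_. ?R"] by (simp add: bind_return_pmf)
    then have "halts_in (if car ?x \<noteq> Atom then Seq Cdr p else Seq Cdr q) ?x ?R
        (Suc (size ?x) + Suc (size ?x) + (g (size ?x) + h (size ?x)))"
      by (cases "c a") auto
    from halts_in_Ite[OF this] show "halts_in (Ite (Seq Cdr p) (Seq Cdr q)) (enc_pair enc_bool e ba)
        (map_pmf e' (case ba of (b, a) \<Rightarrow> if c a then F a else H a))
        (Suc (size (enc_pair enc_bool e ba)) + (Suc (size (enc_pair enc_bool e ba)) + Suc (size (enc_pair enc_bool e ba))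
         + (g (size (enc_pair enc_bool e ba)) + h (size (enc_pair enc_bool e ba)))))"
      using a by simp
  qed (intro pb_intros p q)
  from rt_comp[OF this pt_pair[OF assms(1) pt_id]] show ?thesis by simp
qed

lemma pt_if:
  assumes "pt e A enc_bool c" "pt e {a\<in>A. c a} e' f" "pt e {a\<in>A. \<not> c a} e' h"
  shows "pt e A e' (\<lambda>a. if c a then f a else h a)"
  using rt_if[OF assms(1) assms(2,3)[unfolded pt_def]] unfolding pt_def by (rule rt_cong) auto

named_theorems pt_intros

lemmas [pt_intros] = pt_id pt_const pt_pair pt_fst pt_snd

section \<open>Loops over lists\<close>

fun fold_pmf :: "('x \<Rightarrow> 's \<Rightarrow> 's pmf) \<Rightarrow> 'x list \<Rightarrow> 's \<Rightarrow> 's pmf" where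
  "fold_pmf f [] s = return_pmf s"
| "fold_pmf f (x # xs) s = bind_pmf (f x s) (fold_pmf f xs)"

lemma fold_pmf_return: "fold_pmf (\<lambda>x s. return_pmf (f x s)) xs s = return_pmf (fold f xs s)"
  by (induction xs arbitrary: s) (auto simp: bind_return_pmf)

lemma size_enc_list: "size (enc_list e xs) = (\<Sum>x\<leftarrow>xs. size (e x)) + length xs"
  by (induction xs) auto

lemma size_enc_list_le:
  assumes "length xs \<le> n" "\<And>x. x \<in> set xs \<Longrightarrow> size (e x) \<le> m"
  shows "size (enc_list e xs) \<le> n * Suc m"
proof -
  have "size (enc_list e xs) \<le> length xs * Suc m"
    using assms(2)
  proof (induction xs)
    case (Cons x xs)
    then have "size (e x) \<le> m" "size (enc_list e xs) \<le> length xs * Suc m" by auto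
    then show ?case by simp
  qed simp
  also have "\<dots> \<le> n * Suc m" using assms(1) by (intro mult_right_mono) auto
  finally show ?thesis .
qed

lemma length_le_size_enc_list: "length xs \<le> size (enc_list e xs)"
  by (simp add: size_enc_list)

lemma size_le_size_enc_list: "x \<in> set xs \<Longrightarrow> size (e x) \<le> size (enc_list e xs)"
  by (induction xs) auto

lemma size_enc_take: "size (enc_list e (take n xs)) \<le> size (enc_list e xs)"
  by (induction xs arbitrary: n) (auto simp: take_Cons split: nat.splits)

lemma size_enc_drop: "size (enc_list e (drop n xs)) \<le> size (enc_list e xs)"
  by (induction xs arbitrary: n) (auto simp: drop_Cons le_SucI trans_le_add2 split: nat.splits)

lemma size_enc_rev [simp]: "size (enc_list e (rev xs)) = size (enc_list e xs)"
  by (simp add: size_enc_list rev_map[symmetric])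

lemma size_enc_append [simp]: "size (enc_list e (xs @ ys)) = size (enc_list e xs) + size (enc_list e ys)"
  by (simp add: size_enc_list)

lemma size_enc_zip:
  "size (enc_list (enc_pair e1 e2) (zip xs ys)) \<le> size (enc_list e1 xs) + size (enc_list e2 ys)"
  by (induction xs ys rule: list_induct2') auto

lemma enc_list_elements: "enc_list id (elements x) = x"
  by (induction x rule: elements.induct) auto

lemma enc_list_map: "enc_list e (map f xs) = enc_list (\<lambda>x. e (f x)) xs"
  by (induction xs) auto

lemma enc_list_cong: "(\<And>x. x \<in> set xs \<Longrightarrow> e x = e' x) \<Longrightarrow> enc_list e xs = enc_list e' xs"
  by (induction xs) auto

text \<open>\<open>Fork Copy Nul\<close> moves the whole value into the first component, where
  \<open>Ite\<close> can test it; \<open>Fork Nul Nul\<close> and \<open>Nul\<close> produce the two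
  Boolean codes.\<close>

lemma pt_nonatom0: "pt id UNIV enc_bool (\<lambda>x. x \<noteq> Atom)"
proof (rule ptI[where p = "Seq (Fork Copy Nul) (Ite (Fork Nul Nul) Nul)" and g = "\<lambda>n. 20 * n + 20"])
  fix x
  have 1: "halts_in (Fork Copy Nul) x (return_pmf (Cell x Atom)) (3 * size x + 3)"
    using halts_in_Fork[OF halts_in_Copy halts_in_Nul, of x] by (auto simp: bind_return_pmf elim: halts_in_le)
  have 2: "halts_in (if car y \<noteq> Atom then Fork Nul Nul else Nul) y (return_pmf (enc_bool (car y \<noteq> Atom)))
      (3 * size y + 3)" for y
    using halts_in_Fork[OF halts_in_Nul halts_in_Nul, of y] halts_in_Nul[of y]
    by (auto simp: bind_return_pmf elim: halts_in_le)
  have 3: "halts_in (Ite (Fork Nul Nul) Nul) (Cell x Atom) (return_pmf (enc_bool (x \<noteq> Atom))) (4 * size x + 8)"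
    using halts_in_Ite[OF 2, of "Cell x Atom"] by (auto elim: halts_in_le)
  show "halts_in (Seq (Fork Copy Nul) (Ite (Fork Nul Nul) Nul)) (id x)
      (return_pmf (enc_bool (x \<noteq> Atom))) (20 * size (id x) + 20)"
    using halts_in_Seq[OF 1, of _ "\<lambda>_. return_pmf (enc_bool (x \<noteq> Atom))", simplified, OF 3]
    by (auto simp: bind_return_pmf elim!: halts_in_le)
qed (intro pb_intros)

lemma pt_nonatom [pt_intros]: "pt e A id f \<Longrightarrow> pt e A enc_bool (\<lambda>a. f a \<noteq> Atom)"
  by (rule pt_comp[OF pt_nonatom0]) auto

lemma pt_encode: "pt e A e1 f \<Longrightarrow> pt e A id (\<lambda>a. e1 (f a))"
  by (rule pt_comp[OF pt_recode]) auto

lemma pt_nonempty [pt_intros]: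
  assumes "pt e A (enc_list e1) xs" shows "pt e A enc_bool (\<lambda>a. xs a \<noteq> [])"
proof -
  have "pt e A enc_bool (\<lambda>a. enc_list e1 (xs a) \<noteq> Atom)"
    by (intro pt_intros pt_encode assms)
  moreover have "enc_list e1 ys \<noteq> Atom \<longleftrightarrow> ys \<noteq> []" for ys by (cases ys) auto
  ultimately show ?thesis by simp
qed

text \<open>A nonempty list and the pair of its head and tail share their code. Nonemptiness
  matters, since \<open>car Atom\<close> need not be the code of \<open>hd []\<close>.\<close>

lemma pt_hd:
  assumes "pt e A (enc_list e1) xs" "\<And>a. a \<in> A \<Longrightarrow> xs a \<noteq> []"
  shows "pt e A e1 (\<lambda>a. hd (xs a))"
proof -
  have "pt e A (enc_pair e1 (enc_list e1)) (\<lambda>a. (hd (xs a), tl (xs a)))"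
    by (rule pt_comp[OF pt_recode[of "{xs. xs \<noteq> []}"] assms(1)]) (use assms(2) in \<open>auto simp: neq_Nil_conv\<close>)
  from pt_fst[OF this] show ?thesis by simp
qed

lemma pt_tl [pt_intros]:
  assumes "pt e A (enc_list e1) xs"
  shows "pt e A (enc_list e1) (\<lambda>a. tl (xs a))"
proof -
  have "pt (enc_list e1) UNIV (enc_list e1) tl"
  proof (rule ptI[where p = Cdr and g = Suc])
    fix ys show "halts_in Cdr (enc_list e1 ys) (return_pmf (enc_list e1 (tl ys))) (Suc (size (enc_list e1 ys)))"
      using halts_in_Cdr[of "enc_list e1 ys"] by (cases ys) auto
  qed (intro pb_intros)
  from pt_comp[OF this assms] show ?thesis by simp
qed

lemma pt_Cons [pt_intros]:
  assumes "pt e A e1 x" "pt e A (enc_list e1) xs"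
  shows "pt e A (enc_list e1) (\<lambda>a. x a # xs a)"
proof -
  have "pt (enc_pair e1 (enc_list e1)) UNIV (enc_list e1) (\<lambda>p. fst p # snd p)"
    by (rule pt_recode) auto
  from pt_comp[OF this pt_pair[OF assms]] show ?thesis by simp
qed

text \<open>The loop state is typed, but the continuation sees only its code. The law
  \<open>K\<close> is well defined on codes by \<open>halts_in_unique\<close>, although
  \<open>f\<close> need not be injective.\<close>

lemma halts_in_While_step:
  assumes "car x \<noteq> Atom" "halts_in p x (map_pmf f P) T1"
    "\<And>\<sigma>. \<sigma> \<in> set_pmf P \<Longrightarrow> halts_in (While p) (f \<sigma>) (N \<sigma>) T2"
  shows "halts_in (While p) x (bind_pmf P N) (Suc (size x) + T1 + T2)"
proof -
  define K where "K y = N (SOME \<sigma>. \<sigma> \<in> set_pmf P \<and> f \<sigma> = y)" for y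
  have K: "K (f \<sigma>) = N \<sigma>" if "\<sigma> \<in> set_pmf P" for \<sigma>
  proof -
    let ?\<tau> = "SOME \<tau>. \<tau> \<in> set_pmf P \<and> f \<tau> = f \<sigma>"
    have "?\<tau> \<in> set_pmf P \<and> f ?\<tau> = f \<sigma>" by (rule someI[of _ \<sigma>]) (use that in auto)
    then show ?thesis unfolding K_def using assms(3) that halts_in_unique by metis
  qed
  have "halts_in (While p) y (K y) T2" if "y \<in> set_pmf (map_pmf f P)" for y
    using that K assms(3) by auto
  from halts_in_While_true[OF assms(1,2) this] have
    "halts_in (While p) x (bind_pmf (map_pmf f P) K) (Suc (size x) + T1 + T2)" .
  moreover have "bind_pmf (map_pmf f P) K = bind_pmf P N"
    unfolding bind_map_pmf by (intro bind_pmf_cong) (use K in auto)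
  ultimately show ?thesis by simp
qed

text \<open>\<open>S a i\<close> contains all states that are reachable after \<open>i\<close> iterations.\<close>

lemma rt_fold:
  assumes xs: "pt e A (enc_list e1) xs" and init: "pt e A e2 init"
    and body: "rt (enc_pair e (enc_pair e1 e2))
        {(a, x, s). a \<in> A \<and> (\<exists>i<length (xs a). x = xs a ! i \<and> s \<in> S a i)} e2
        (\<lambda>y. F (fst y) (fst (snd y)) (snd (snd y)))"
    and S0: "\<And>a. a \<in> A \<Longrightarrow> init a \<in> S a 0"
    and S: "\<And>a i s. a \<in> A \<Longrightarrow> i < length (xs a) \<Longrightarrow> s \<in> S a i \<Longrightarrow> set_pmf (F a (xs a ! i) s) \<subseteq> S a (Suc i)"
    and g: "polynomially_bounded g"
      "\<And>a i s. a \<in> A \<Longrightarrow> i \<le> length (xs a) \<Longrightarrow> s \<in> S a i \<Longrightarrow> size (e2 s) \<le> g (size (e a))"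
  shows "rt e A e2 (\<lambda>a. fold_pmf (F a) (xs a) (init a))"
proof -
  \<comment> \<open>The remaining list comes first: its code is \<open>Atom\<close> exactly when it
    is empty, which is the test of \<open>While\<close>.\<close>
  define es where "es = enc_pair (enc_list e1) (enc_pair e e2)"
  define D where "D = {(ys, a, s). a \<in> A \<and> (\<exists>i<length (xs a). ys = drop i (xs a) \<and> s \<in> S a i)}"
  define step where "step = (\<lambda>\<sigma>. map_pmf (\<lambda>s'. (tl (fst \<sigma>), fst (snd \<sigma>), s'))
      (F (fst (snd \<sigma>)) (hd (fst \<sigma>)) (snd (snd \<sigma>))))"
  have "rt es D e2 (\<lambda>\<sigma>. F (fst (snd \<sigma>)) (hd (fst \<sigma>)) (snd (snd \<sigma>)))"
    unfolding es_def
    by (rule rt_comp[OF body, where f = "\<lambda>\<sigma>. (fst (snd \<sigma>), hd (fst \<sigma>), snd (snd \<sigma>))", simplified];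
        (rule pt_intros pt_hd | force simp: D_def hd_drop_conv_nth)+)
  then have "rt es D es step"
    unfolding step_def es_def by (rule rt_map) (rule pt_intros)+
  from rtD[OF this] obtain G p where p: "polynomially_bounded G" "mono G"
    "\<And>\<sigma>. \<sigma> \<in> D \<Longrightarrow> halts_in p (es \<sigma>) (map_pmf es (step \<sigma>)) (G (size (es \<sigma>)))" by blast
  obtain h where h: "polynomially_bounded h" "mono h" "\<And>n. g n \<le> h n"
    using polynomially_bounded_monoE[OF g(1)] by blast
  \<comment> \<open>\<open>Z\<close> bounds a state: remaining list, input, accumulator and two
    cells. \<open>c\<close> bounds the cost of one round including the test.\<close>
  define Z where "Z n = n + n + h n + 2" for n
  define c where "c n = Suc (Z n) + G (Z n)" for n
  let ?D0 = "{(xs a, a, s) | a s. a \<in> A \<and> s \<in> S a 0}"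
  have loop: "rt es ?D0 e2 (\<lambda>\<sigma>. fold_pmf (F (fst (snd \<sigma>))) (fst \<sigma>) (snd (snd \<sigma>)))"
  proof -
    \<comment> \<open>The program leaves the whole final state, from which the accumulator is
      projected afterwards. There are at most n rounds and one failing test.\<close>
    have *: "rt es ?D0 es (\<lambda>\<sigma>. map_pmf (\<lambda>s'. ([], fst (snd \<sigma>), s')) (fold_pmf (F (fst (snd \<sigma>))) (fst \<sigma>) (snd (snd \<sigma>))))"
    proof (rule rtI[where p = "While p" and g = "\<lambda>n. Suc n * c n"])
      show "polynomially_bounded (\<lambda>n. Suc n * c n)"
        unfolding c_def Z_def by (intro pb_intros polynomially_bounded_compose[OF p(1)] h)
    next
      fix \<sigma> assume "\<sigma> \<in> ?D0"
      then obtain a s0 where \<sigma>: "\<sigma> = (xs a, a, s0)" "a \<in> A" "s0 \<in> S a 0" by auto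
      let ?n = "size (es \<sigma>)"
      have sz: "size (es (drop i (xs a), a, s)) \<le> Z ?n" if "i \<le> length (xs a)" "s \<in> S a i" for i s
      proof -
        have "size (enc_list e1 (drop i (xs a))) \<le> ?n" using size_enc_drop[of e1 i "xs a"] by (simp add: \<sigma>(1) es_def)
        moreover have "size (e a) \<le> ?n" by (simp add: \<sigma>(1) es_def)
        moreover have "size (e2 s) \<le> h ?n"
          using g(2)[OF \<sigma>(2) that] h(3)[of "size (e a)"] monoD[OF h(2) \<open>size (e a) \<le> ?n\<close>] by linarith
        ultimately show ?thesis unfolding Z_def es_def by simp
      qed
      have "halts_in (While p) (es (drop i (xs a), a, s))
          (map_pmf (\<lambda>s'. es ([], a, s')) (fold_pmf (F a) (drop i (xs a)) s)) (Suc k * c ?n)"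
        if "i + k = length (xs a)" "s \<in> S a i" for i k s using that
      proof (induction k arbitrary: i s)
        case 0
        have "halts_in (While p) (es ([], a, s)) (return_pmf (es ([], a, s))) (Suc (size (es ([], a, s))))"
          by (rule halts_in_While_false) (simp add: es_def)
        then show ?case using 0 sz[of i s] by (auto simp: c_def elim!: halts_in_le)
      next
        case (Suc k)
        let ?x = "(drop i (xs a), a, s)"
        have i: "i < length (xs a)" using Suc.prems by simp
        then have d: "drop i (xs a) = xs a ! i # drop (Suc i) (xs a)" by (simp add: Cons_nth_drop_Suc)
        have "?x \<in> D" unfolding D_def using i \<sigma>(2) Suc.prems(2) by blast
        from p(3)[OF this] have 1: "halts_in p (es ?x) (map_pmf es (step ?x)) (G (Z ?n))"
          by (rule halts_in_le) (intro monoD[OF p(2)] sz; use i Suc.prems in simp)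
        have 2: "halts_in (While p) (es \<tau>) (map_pmf (\<lambda>s'. es ([], a, s')) (fold_pmf (F a) (drop (Suc i) (xs a)) (snd (snd \<tau>))))
            (Suc k * c ?n)" if "\<tau> \<in> set_pmf (step ?x)" for \<tau>
        proof -
          from that obtain s' where s': "\<tau> = (drop (Suc i) (xs a), a, s')" "s' \<in> set_pmf (F a (xs a ! i) s)"
            by (auto simp: step_def d)
          then have "s' \<in> S a (Suc i)" using S[OF \<sigma>(2) i Suc.prems(2)] by auto
          then show ?thesis unfolding s'(1) using Suc.prems by simp (intro Suc.IH[simplified]; simp)
        qed
        have "car (es ?x) \<noteq> Atom" by (simp add: es_def d)
        note w = halts_in_While_step[OF this 1 2]
        have "Suc (size (es ?x)) + G (Z ?n) + Suc k * c ?n \<le> Suc (Suc k) * c ?n"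
          using sz[of i s] i Suc.prems by (simp add: c_def)
        moreover have "bind_pmf (step ?x) (\<lambda>\<tau>. map_pmf (\<lambda>s'. es ([], a, s')) (fold_pmf (F a) (drop (Suc i) (xs a)) (snd (snd \<tau>))))
            = map_pmf (\<lambda>s'. es ([], a, s')) (fold_pmf (F a) (drop i (xs a)) s)"
          by (simp add: step_def d bind_map_pmf map_bind_pmf)
        ultimately show ?case using halts_in_le[OF w] by simp
      qed
      from this[of 0 "length (xs a)" s0] have
        "halts_in (While p) (es \<sigma>) (map_pmf (\<lambda>s'. es ([], a, s')) (fold_pmf (F a) (xs a) s0)) (Suc (length (xs a)) * c ?n)"
        using \<sigma> by simp
      moreover have "Suc (length (xs a)) * c ?n \<le> Suc ?n * c ?n"
        using length_le_size_enc_list[of "xs a" e1] by (intro mult_right_mono) (auto simp: \<sigma>(1) es_def)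
      ultimately show "halts_in (While p) (es \<sigma>) (map_pmf es (map_pmf (\<lambda>s'. ([], fst (snd \<sigma>), s'))
          (fold_pmf (F (fst (snd \<sigma>))) (fst \<sigma>) (snd (snd \<sigma>))))) (Suc ?n * c ?n)"
        using halts_in_le by (auto simp: \<sigma>(1) pmf.map_comp o_def)
    qed
    have "pt (enc_pair es es) X e2 (\<lambda>x. snd (snd (snd x)))" for X
      unfolding es_def by (rule pt_intros)+
    from rt_map[OF *, where h = "\<lambda>_ \<tau>. snd (snd \<tau>)", OF this]
    show ?thesis by (simp add: pmf.map_comp o_def)
  qed
  have "pt e A es (\<lambda>a. (xs a, a, init a))"
    unfolding es_def by (rule xs init pt_intros)+
  from rt_comp[OF loop this] show ?thesis using S0 by auto
qed

text \<open>A deterministic loop has one reachable state per round, so the sets of reachable states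
  are singletons.\<close>

lemma pt_fold:
  assumes xs: "pt e A (enc_list e1) xs" and init: "pt e A e2 init"
    and body: "pt (enc_pair e (enc_pair e1 e2))
        {(a, x, s). a \<in> A \<and> (\<exists>i<length (xs a). x = xs a ! i \<and> s = fold (f a) (take i (xs a)) (init a))} e2
        (\<lambda>y. f (fst y) (fst (snd y)) (snd (snd y)))"
    and g: "polynomially_bounded g"
      "\<And>a i. a \<in> A \<Longrightarrow> i \<le> length (xs a) \<Longrightarrow> size (e2 (fold (f a) (take i (xs a)) (init a))) \<le> g (size (e a))"
  shows "pt e A e2 (\<lambda>a. fold (f a) (xs a) (init a))"
proof -
  have "rt e A e2 (\<lambda>a. fold_pmf (\<lambda>x s. return_pmf (f a x s)) (xs a) (init a))"
    by (rule rt_fold[OF xs init, where S = "\<lambda>a i. {fold (f a) (take i (xs a)) (init a)}" and g = g])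
      (use body g in \<open>auto simp: pt_def take_Suc_conv_app_nth\<close>)
  then show ?thesis by (simp add: pt_def fold_pmf_return)
qed

section \<open>List functions\<close>

lemma pt_rev [pt_intros]:
  assumes "pt e A (enc_list e1) xs"
  shows "pt e A (enc_list e1) (\<lambda>a. rev (xs a))"
proof -
  have *: "fold (\<lambda>x acc. x # acc) us vs = rev us @ vs" for us vs :: "'b list"
    by (induction us arbitrary: vs) auto
  have "pt (enc_list e1) UNIV (enc_list e1) (\<lambda>xs. fold (\<lambda>x acc. x # acc) xs [])"
    by (rule pt_fold[where g = "\<lambda>n. n"]; (rule pt_intros pb_intros | simp add: * size_enc_take)+)
  from pt_comp[OF this assms] show ?thesis by (simp add: *)
qed

lemma pt_append [pt_intros]:
  assumes "pt e A (enc_list e1) xs" "pt e A (enc_list e1) ys"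
  shows "pt e A (enc_list e1) (\<lambda>a. xs a @ ys a)"
proof -
  have *: "fold (\<lambda>x acc. x # acc) us vs = rev us @ vs" for us vs :: "'b list"
    by (induction us arbitrary: vs) auto
  have "pt (enc_pair (enc_list e1) (enc_list e1)) UNIV (enc_list e1)
      (\<lambda>p. fold (\<lambda>x acc. x # acc) (rev (fst p)) (snd p))"
  proof (rule pt_fold[where g = "\<lambda>n. n"])
    fix a :: "'b list \<times> 'b list" and i
    show "size (enc_list e1 (fold (\<lambda>x acc. x # acc) (take i (rev (fst a))) (snd a)))
        \<le> size (enc_pair (enc_list e1) (enc_list e1) a)"
      using size_enc_take[of e1 i "rev (fst a)"] by (cases a) (simp add: *)
  qed (rule pt_intros pb_intros)+
  from pt_comp[OF this pt_pair[OF assms]] show ?thesis by (simp add: *)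
qed

lemma fold_pmf_sequence:
  "fold_pmf (\<lambda>x acc. map_pmf (\<lambda>y. y # acc) (F x)) xs acc = map_pmf (\<lambda>ys. rev ys @ acc) (sequence_pmf (map F xs))"
proof (induction xs arbitrary: acc)
  case (Cons x xs)
  have "fold_pmf (\<lambda>x acc. map_pmf (\<lambda>y. y # acc) (F x)) (x # xs) acc
      = bind_pmf (F x) (\<lambda>y. map_pmf (\<lambda>ys. rev ys @ y # acc) (sequence_pmf (map F xs)))"
    by (simp only: fold_pmf.simps bind_map_pmf Cons.IH)
  also have "\<dots> = map_pmf (\<lambda>ys. rev ys @ acc) (sequence_pmf (map F (x # xs)))"
    by (simp only: list.map sequence_pmf.simps map_pmf_def bind_assoc_pmf bind_return_pmf
        rev.simps append_assoc append.simps)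
  finally show ?case .
qed simp

text \<open>Outputs are accumulated in reverse order. The invariant bounds their number and the size
  of each by a polynomial in the input, which keeps the state small throughout.\<close>

lemma rt_mapM:
  assumes xs: "pt e A (enc_list e1) xs"
    and F: "rt (enc_pair e e1) {(a, x). a \<in> A \<and> x \<in> set (xs a)} e2 (\<lambda>y. F (fst y) (snd y))"
  shows "rt e A (enc_list e2) (\<lambda>a. sequence_pmf (map (F a) (xs a)))"
proof -
  from rt_size[OF F] obtain G where G: "polynomially_bounded G" "mono G"
    "\<And>p y. p \<in> {(a, x). a \<in> A \<and> x \<in> set (xs a)} \<Longrightarrow> y \<in> set_pmf (F (fst p) (snd p)) \<Longrightarrow>
      size (e2 y) \<le> G (size (enc_pair e e1 p))" by blast
  have G3: "\<And>a x y. a \<in> A \<Longrightarrow> x \<in> set (xs a) \<Longrightarrow> y \<in> set_pmf (F a x) \<Longrightarrow> size (e2 y) \<le> G (Suc (size (e a) + size (e1 x)))"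
    using G(3)[of "(_, _)"] by simp
  from pt_size[OF xs] obtain h where h: "polynomially_bounded h" "mono h"
    "\<And>a. a \<in> A \<Longrightarrow> size (enc_list e1 (xs a)) \<le> h (size (e a))" by blast
  define b where "b n = G (Suc (n + h n))" for n
  have b: "size (e2 y) \<le> b (size (e a))" if "a \<in> A" "x \<in> set (xs a)" "y \<in> set_pmf (F a x)" for a x y
  proof -
    have "size (e1 x) \<le> h (size (e a))"
      using size_le_size_enc_list[OF that(2), of e1] h(3)[OF that(1)] by linarith
    then show ?thesis using G3[OF that] monoD[OF G(2), of "Suc (size (e a) + size (e1 x))" "Suc (size (e a) + h (size (e a)))"]
      by (simp add: b_def)
  qed
  have "rt e A (enc_list e2) (\<lambda>a. fold_pmf (\<lambda>x acc. map_pmf (\<lambda>y. y # acc) (F a x)) (xs a) [])"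
  proof (rule rt_fold[OF xs, where g = "\<lambda>n. h n * Suc (b n)" and
        S = "\<lambda>a i. {ys. length ys = i \<and> (\<forall>y\<in>set ys. size (e2 y) \<le> b (size (e a)))}"])
    show "rt (enc_pair e (enc_pair e1 (enc_list e2)))
     {(a, x, s). a \<in> A \<and> (\<exists>i<length (xs a). x = xs a ! i \<and> s \<in> {ys. length ys = i \<and> (\<forall>y\<in>set ys. size (e2 y) \<le> b (size (e a)))})}
     (enc_list e2) (\<lambda>y. map_pmf (\<lambda>ya. ya # snd (snd y)) (F (fst y) (fst (snd y))))"
      by (rule rt_map, rule rt_comp[OF F, where f = "\<lambda>y. (fst y, fst (snd y))", simplified];
          (rule pt_intros | force)+)
    show "polynomially_bounded (\<lambda>n. h n * Suc (b n))"
      unfolding b_def by (intro pb_intros polynomially_bounded_compose[OF G(1)] h)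
    fix a i s assume a: "a \<in> A" "i \<le> length (xs a)" "s \<in> {ys. length ys = i \<and> (\<forall>y\<in>set ys. size (e2 y) \<le> b (size (e a)))}"
    then have "length s \<le> h (size (e a))"
      using length_le_size_enc_list[of "xs a" e1] h(3)[OF a(1)] by simp
    then show "size (enc_list e2 s) \<le> h (size (e a)) * Suc (b (size (e a)))"
      using a by (intro size_enc_list_le) auto
  next
    fix a i s assume a: "a \<in> A" "i < length (xs a)" "s \<in> {ys. length ys = i \<and> (\<forall>y\<in>set ys. size (e2 y) \<le> b (size (e a)))}"
    then show "set_pmf (map_pmf (\<lambda>y. y # s) (F a (xs a ! i))) \<subseteq> {ys. length ys = Suc i \<and> (\<forall>y\<in>set ys. size (e2 y) \<le> b (size (e a)))}"
      using b[OF a(1) nth_mem[OF a(2)]] by auto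
  qed (rule pt_intros | simp)+
  then have "rt e A (enc_list e2) (\<lambda>a. map_pmf rev (fold_pmf (\<lambda>x acc. map_pmf (\<lambda>y. y # acc) (F a x)) (xs a) []))"
    by (rule rt_map) (rule pt_intros)+
  then show ?thesis by (simp add: fold_pmf_sequence pmf.map_comp o_def)
qed

lemma sequence_pmf_return: "sequence_pmf (map (\<lambda>x. return_pmf (f x)) xs) = return_pmf (map f xs)"
  by (induction xs) (auto simp: bind_return_pmf)

lemma pt_map:
  assumes xs: "pt e A (enc_list e1) xs"
    and f: "pt (enc_pair e e1) {(a, x). a \<in> A \<and> x \<in> set (xs a)} e2 (\<lambda>y. f (fst y) (snd y))"
  shows "pt e A (enc_list e2) (\<lambda>a. map (f a) (xs a))"
  using rt_mapM[OF xs f[unfolded pt_def]] by (simp add: pt_def sequence_pmf_return)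

lemma pt_zip [pt_intros]:
  assumes "pt e A (enc_list e1) xs" "pt e A (enc_list e2) ys"
  shows "pt e A (enc_list (enc_pair e1 e2)) (\<lambda>a. zip (xs a) (ys a))"
proof -
  define f where "f x s = (if fst s \<noteq> [] then (tl (fst s), (x, hd (fst s)) # snd s) else s)"
    for x :: 'b and s :: "'c list \<times> ('b \<times> 'c) list"
  have f: "fold f us (vs, acc) = (drop (length us) vs, rev (zip us vs) @ acc)" for us vs acc
    by (induction us arbitrary: vs acc) (auto simp: f_def zip_Cons1 drop_Suc split: list.splits)
  have f0: "fold f us (vs, []) = (drop (length us) vs, rev (zip us vs))" for us vs
    using f[of us vs "[]"] by simp
  let ?e = "enc_pair (enc_list e1) (enc_list e2)"
  have "pt ?e UNIV (enc_pair (enc_list e2) (enc_list (enc_pair e1 e2))) (\<lambda>p. fold f (fst p) (snd p, []))"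
  proof (rule pt_fold[where g = "\<lambda>n. Suc (n + n)"])
    fix a :: "'b list \<times> 'c list" and i assume "i \<le> length (fst a)"
    show "size (enc_pair (enc_list e2) (enc_list (enc_pair e1 e2)) (fold f (take i (fst a)) (snd a, [])))
        \<le> Suc (size (?e a) + size (?e a))"
      using size_enc_drop[of e2 "length (take i (fst a))" "snd a"] size_enc_take[of e1 i "fst a"]
        size_enc_zip[of e1 e2 "take i (fst a)" "snd a"]
      by (cases a) (simp add: f0)
  next
    show "pt (enc_pair ?e (enc_pair e1 (enc_pair (enc_list e2) (enc_list (enc_pair e1 e2)))))
      {(a, x, s). a \<in> UNIV \<and> (\<exists>i<length (fst a). x = fst a ! i \<and> s = fold f (take i (fst a)) (snd a, []))}
      (enc_pair (enc_list e2) (enc_list (enc_pair e1 e2))) (\<lambda>y. f (fst (snd y)) (snd (snd y)))"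
      unfolding f_def by (rule pt_if; (rule pt_intros pt_hd | force)+)
  qed (rule pt_intros pb_intros)+
  then have "pt ?e UNIV (enc_list (enc_pair e1 e2)) (\<lambda>p. rev (snd (fold f (fst p) (snd p, []))))"
    by (intro pt_rev pt_snd)
  from pt_comp[OF this pt_pair[OF assms]] show ?thesis by (simp add: f0)
qed

lemma pt_filter:
  assumes xs: "pt e A (enc_list e1) xs"
    and f: "pt (enc_pair e e1) {(a, x). a \<in> A \<and> x \<in> set (xs a)} enc_bool (\<lambda>y. P (fst y) (snd y))"
  shows "pt e A (enc_list e1) (\<lambda>a. filter (P a) (xs a))"
proof -
  define g where "g a x s = (if P a x then x # s else s)" for a x s
  have g: "fold (g a) us vs = rev (filter (P a) us) @ vs" for a us vs
    by (induction us arbitrary: vs) (auto simp: g_def)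
  have fl: "size (enc_list e1 (filter (P a) us)) \<le> size (enc_list e1 us)" for a us
    by (induction us) auto
  from pt_size[OF xs] obtain h where h: "polynomially_bounded h" "mono h"
    "\<And>a. a \<in> A \<Longrightarrow> size (enc_list e1 (xs a)) \<le> h (size (e a))" by blast
  have "pt e A (enc_list e1) (\<lambda>a. fold (g a) (xs a) [])"
  proof (rule pt_fold[OF xs, where g = h])
    show "pt (enc_pair e (enc_pair e1 (enc_list e1)))
      {(a, x, s). a \<in> A \<and> (\<exists>i<length (xs a). x = xs a ! i \<and> s = fold (g a) (take i (xs a)) [])}
      (enc_list e1) (\<lambda>y. g (fst y) (fst (snd y)) (snd (snd y)))"
      unfolding g_def
      by (rule pt_if, rule pt_comp[OF f, where f = "\<lambda>y. (fst y, fst (snd y))", simplified];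
          (rule pt_intros | force)+)
    fix a i assume "a \<in> A"
    then show "size (enc_list e1 (fold (g a) (take i (xs a)) [])) \<le> h (size (e a))"
      using h(3)[of a] fl[of a "take i (xs a)"] size_enc_take[of e1 i "xs a"] by (simp add: g)
  qed (rule pt_intros h)+
  from pt_rev[OF this] show ?thesis by (simp add: g)
qed

lemma unary_eq: "enc_list (\<lambda>_. Atom) xs = unary (length xs)"
proof -
  have *: "enc_list (\<lambda>_. Atom) us = enc_list (\<lambda>_. Atom) vs" if "length us = length vs" for us :: "'a list" and vs :: "nat list"
    using that by (induction us vs rule: list_induct2) auto
  show ?thesis unfolding unary_def by (rule *) simp
qed

lemma size_unary [simp]: "size (unary n) = n"
  by (simp add: unary_def size_enc_list)

lemma pt_length [pt_intros]:
  assumes "pt e A (enc_list e1) xs" shows "pt e A unary (\<lambda>a. length (xs a))"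
proof -
  have "pt e A (enc_list (\<lambda>_. Atom)) (\<lambda>a. map (\<lambda>_. ()) (xs a))"
    by (rule pt_map[OF assms]) (rule pt_intros)
  from pt_comp[OF pt_recode this, of UNIV unary length] show ?thesis by (simp add: unary_eq)
qed

text \<open>Under the constant encoding, \<open>[0..<n]\<close> is just n atoms: such a list drives
  a loop, but its entries cannot be read.\<close>

lemma pt_upt: "pt e A unary n \<Longrightarrow> pt e A (enc_list (\<lambda>_. Atom)) (\<lambda>a. [0..<n a])"
  by (rule pt_comp[OF pt_recode[where A = UNIV and f = "\<lambda>n. [0..<n]"]]) (auto simp: unary_eq)

lemma pt_replicate [pt_intros]:
  assumes "pt e A unary n" "pt e A e1 x"
  shows "pt e A (enc_list e1) (\<lambda>a. replicate (n a) (x a))"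
proof -
  have "pt e A (enc_list e1) (\<lambda>a. map (\<lambda>_. x a) [0..<n a])"
    by (rule pt_map[OF pt_upt[OF assms(1)]], rule pt_comp[OF assms(2)]; (rule pt_intros | force)+)
  then show ?thesis by (simp add: map_replicate_const)
qed

lemma pt_take [pt_intros]:
  assumes "pt e A unary n" "pt e A (enc_list e1) xs"
  shows "pt e A (enc_list e1) (\<lambda>a. take (n a) (xs a))"
proof -
  have *: "map fst (zip us [0..<k]) = take k us" for us :: "'b list" and k
    by (rule nth_equalityI) auto
  have "pt e A (enc_list e1) (\<lambda>a. map fst (zip (xs a) [0..<n a]))"
    by (rule pt_map[where f = "\<lambda>_. fst"], rule pt_zip[OF assms(2) pt_upt[OF assms(1)]]) (rule pt_intros)+
  then show ?thesis by (simp add: *)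
qed

lemma pt_drop [pt_intros]:
  assumes "pt e A unary n" "pt e A (enc_list e1) xs"
  shows "pt e A (enc_list e1) (\<lambda>a. drop (n a) (xs a))"
proof -
  have *: "fold (\<lambda>_. tl) us ys = drop (length us) ys" for us :: "nat list" and ys :: "'b list"
    by (induction us arbitrary: ys) (auto simp: drop_Suc)
  have "pt (enc_pair unary (enc_list e1)) UNIV (enc_list e1) (\<lambda>p. fold (\<lambda>_. tl) [0..<fst p] (snd p))"
  proof (rule pt_fold[where g = "\<lambda>n. n"])
    fix a :: "nat \<times> 'b list" and i
    show "size (enc_list e1 (fold (\<lambda>_. tl) (take i [0..<fst a]) (snd a))) \<le> size (enc_pair unary (enc_list e1) a)"
      unfolding * using size_enc_drop[of e1 _ "snd a"] by (cases a) (auto intro!: le_SucI trans_le_add2)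
  qed (rule pt_intros pt_upt pb_intros)+
  from pt_comp[OF this pt_pair[OF assms]] show ?thesis by (simp add: *)
qed

lemma pt_nth:
  assumes "pt e A unary n" "pt e A (enc_list e1) xs" "\<And>a. a \<in> A \<Longrightarrow> n a < length (xs a)"
  shows "pt e A e1 (\<lambda>a. xs a ! n a)"
proof -
  have "pt e A e1 (\<lambda>a. hd (drop (n a) (xs a)))"
    using assms(3) by (intro pt_hd pt_drop assms) (auto simp: not_le)
  then show ?thesis by (rule pt_cong) (use assms(3) in \<open>simp add: hd_drop_conv_nth\<close>)
qed

lemma pt_elements [pt_intros]: "pt e A id f \<Longrightarrow> pt e A (enc_list id) (\<lambda>a. elements (f a))"
  by (rule pt_comp[OF pt_recode]) (auto simp: enc_list_elements)

lemma pt_if_total [pt_intros]: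
  "pt e A enc_bool c \<Longrightarrow> pt e A e' f \<Longrightarrow> pt e A e' h \<Longrightarrow> pt e A e' (\<lambda>a. if c a then f a else h a)"
  by (rule pt_if) (auto elim: pt_subset)

lemma pt_Not [pt_intros]: "pt e A enc_bool c \<Longrightarrow> pt e A enc_bool (\<lambda>a. \<not> c a)"
  by (rule pt_cong[OF pt_if_total[OF _ pt_const[where c = False] pt_const[where c = True]]]) auto

lemma pt_conj [pt_intros]:
  assumes "pt e A enc_bool c" "pt e A enc_bool d" shows "pt e A enc_bool (\<lambda>a. c a \<and> d a)"
  using pt_if_total[OF assms pt_const[where c = False]] by (rule pt_cong) auto

lemma pt_xorb [pt_intros]:
  assumes "pt e A enc_bool c" "pt e A enc_bool d" shows "pt e A enc_bool (\<lambda>a. c a xorb d a)"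
  using pt_if_total[OF assms(1) pt_Not[OF assms(2)] assms(2)] by (rule pt_cong) (auto simp: xorb_def)

lemma pt_xors [pt_intros]:
  assumes "pt e A enc_bits x" "pt e A enc_bits y"
  shows "pt e A enc_bits (\<lambda>a. x a xors y a)"
  unfolding xors_def split_beta
  by (rule pt_map[where f = "\<lambda>_ p. fst p xorb snd p", OF pt_zip[OF assms]]) (rule pt_intros)+

lemma pt_scale [pt_intros]:
  assumes "pt e A enc_bool t" "pt e A enc_bits x"
  shows "pt e A enc_bits (\<lambda>a. scale (t a) (x a))"
proof -
  have "pt (enc_pair enc_bool enc_bits) UNIV enc_bits (\<lambda>p. map (\<lambda>x. fst p \<and> x) (snd p))"
    by (rule pt_map) (rule pt_intros)+
  from pt_comp[OF this pt_pair[OF assms]] show ?thesis by (simp add: scale_def)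
qed

text \<open>Distinguishers have to cope with arbitrary samples, hence bit strings are read off tolerantly.\<close>

definition bits_of :: "sexp \<Rightarrow> bits" where
  "bits_of x = map (\<lambda>y. y \<noteq> Atom) (elements x)"

lemma bits_of_enc [simp]: "bits_of (enc_bits s) = s"
proof (induction s)
  case (Cons b s)
  then show ?case by (cases b) (auto simp: bits_of_def)
qed (simp add: bits_of_def)

lemma pt_bits_of [pt_intros]: "pt e A id f \<Longrightarrow> pt e A enc_bits (\<lambda>a. bits_of (f a))"
  unfolding bits_of_def by (rule pt_map[where f = "\<lambda>_ y. y \<noteq> Atom"]) (assumption | rule pt_intros)+

section \<open>Sampling\<close>

lemma sequence_pmf_replicate: "sequence_pmf (replicate n p) = replicate_pmf n p"
  by (induction n) auto

lemma rt_replicate_pmf: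
  assumes "pt e A unary n" "rt e A e1 F"
  shows "rt e A (enc_list e1) (\<lambda>a. replicate_pmf (n a) (F a))"
proof -
  have "rt e A (enc_list e1) (\<lambda>a. sequence_pmf (map (\<lambda>_. F a) [0..<n a]))"
    by (rule rt_mapM[OF pt_upt[OF assms(1)]], rule rt_comp[OF assms(2)]; (rule pt_intros | force)+)
  then show ?thesis by (simp add: map_replicate_const sequence_pmf_replicate)
qed

lemma elements_enc_list: "elements (enc_list e xs) = map e xs"
  by (induction xs) auto

lemma rt_choose:
  assumes "pt e A (enc_list e1) xs" "\<And>a. a \<in> A \<Longrightarrow> xs a \<noteq> []"
  shows "rt e A e1 (\<lambda>a. map_pmf ((!) (xs a)) (pmf_of_set {..<length (xs a)}))"
proof -
  have "rt (enc_list e1) {xs. xs \<noteq> []} e1 (\<lambda>xs. map_pmf ((!) xs) (pmf_of_set {..<length xs}))"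
  proof (rule rtI[where p = Choose and g = Suc])
    fix ys :: "'b list" assume ys: "ys \<in> {xs. xs \<noteq> []}"
    have "map_pmf ((!) (map e1 ys)) (pmf_of_set {..<length ys}) = map_pmf e1 (map_pmf ((!) ys) (pmf_of_set {..<length ys}))"
      unfolding pmf.map_comp by (rule map_pmf_cong) (use ys in \<open>auto simp: set_pmf_of_set lessThan_empty_iff\<close>)
    then show "halts_in Choose (enc_list e1 ys) (map_pmf e1 (map_pmf ((!) ys) (pmf_of_set {..<length ys}))) (Suc (size (enc_list e1 ys)))"
      using halts_in_Choose[of "enc_list e1 ys"] ys by (simp add: elements_enc_list)
  qed (intro pb_intros)
  from rt_comp[OF this assms(1)] assms(2) show ?thesis by auto
qed

lemma rt_coin: "rt e A enc_bool (\<lambda>_. pmf_of_set (UNIV :: bool set))"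
proof -
  have *: "map_pmf ((!) [False, True]) (pmf_of_set {..<length [False, True]}) = pmf_of_set UNIV"
    by (rule map_pmf_of_set_bij_betw)
      (auto simp: bij_betw_def inj_on_def UNIV_bool lessThan_Suc)
  have "rt e A enc_bool (\<lambda>_. map_pmf ((!) [False, True]) (pmf_of_set {..<length [False, True]}))"
    by (rule rt_choose[OF pt_const]) simp
  then show ?thesis unfolding * .
qed

lemma pair_pmf_of_set:
  assumes "finite A" "A \<noteq> {}" "finite B" "B \<noteq> {}"
  shows "pair_pmf (pmf_of_set A) (pmf_of_set B) = pmf_of_set (A \<times> B)"
proof (rule pmf_eqI)
  fix p :: "'a \<times> 'b"
  show "pmf (pair_pmf (pmf_of_set A) (pmf_of_set B)) p = pmf (pmf_of_set (A \<times> B)) p"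
    using assms by (cases p) (simp add: pmf_pair card_cartesian_product indicator_def)
qed

lemma finite_bits: "finite {s :: bits. length s = n}"
  using finite_lists_length_eq[of "UNIV :: bool set" n] by simp

lemma bits_nonempty: "{s :: bits. length s = n} \<noteq> {}"
  using Ex_list_of_length[of n] by auto

lemma set_uniform_bits [simp]: "set_pmf (uniform_bits n) = {s. length s = n}"
  unfolding uniform_bits_def by (intro set_pmf_of_set finite_bits bits_nonempty)

text \<open>The machine tosses coins one at a time, so the uniform law on strings is needed as a
  product.\<close>

lemma uniform_bits_eq: "uniform_bits n = replicate_pmf n (pmf_of_set UNIV)"
proof (induction n)
  case 0
  have "{s :: bits. length s = 0} = {[]}" by auto
  then show ?case by (simp add: uniform_bits_def pmf_of_set_singleton)
next
  case (Suc n)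
  have *: "map_pmf (\<lambda>(b, s). b # s) (pmf_of_set (UNIV \<times> {s :: bits. length s = n})) = pmf_of_set {s. length s = Suc n}"
    by (rule map_pmf_of_set_bij_betw)
      (use bits_nonempty[of n] in \<open>auto simp: bij_betw_def inj_on_def length_Suc_conv finite_bits finite_cartesian_product\<close>)
  have "pmf_of_set ((UNIV :: bool set) \<times> {s :: bits. length s = n}) = pair_pmf (pmf_of_set UNIV) (uniform_bits n)"
    unfolding uniform_bits_def
    by (rule pair_pmf_of_set[symmetric]) (use finite_bits[of n] bits_nonempty[of n] in simp_all)
  with * have "uniform_bits (Suc n) = map_pmf (\<lambda>(b, s). b # s) (pair_pmf (pmf_of_set UNIV) (uniform_bits n))"
    by (simp add: uniform_bits_def)
  then show ?case by (simp add: Suc.IH pair_pmf_def map_bind_pmf)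
qed

lemma rt_uniform_bits: "pt e A unary n \<Longrightarrow> rt e A enc_bits (\<lambda>a. uniform_bits (n a))"
  unfolding uniform_bits_eq by (intro rt_replicate_pmf rt_coin)

section \<open>Uniform indistinguishability of families\<close>

lemma negligible_mono:
  assumes "negligible g" "\<And>n. \<bar>f n\<bar> \<le> \<bar>g n\<bar>" shows "negligible f"
  unfolding negligible_def
proof
  fix k
  from assms(1) have "\<forall>\<^sub>F n in sequentially. \<bar>g n\<bar> < 1 / real n ^ k" by (simp add: negligible_def)
  then show "\<forall>\<^sub>F n in sequentially. \<bar>f n\<bar> < 1 / real n ^ k"
    by (rule eventually_mono) (use assms(2) le_less_trans in blast)
qed

lemma negligible_abs: "negligible (\<lambda>n. \<bar>f n\<bar>) \<longleftrightarrow> negligible f"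
  by (simp add: negligible_def)

lemma negligible_poly_mult:
  assumes "polynomially_bounded p" "negligible f"
  shows "negligible (\<lambda>n. real (p n) * f n)"
  unfolding negligible_def
proof
  fix k
  obtain j where j: "\<And>n. p n \<le> n ^ j + j" using assms(1) unfolding polynomially_bounded_def by blast
  \<comment> \<open>One power more than the degree: once n \<ge> 2 + j, p n \<le> n ^ j + j \<le> 2
    * n ^ j \<le> n ^ (j + 1).\<close>
  have "\<forall>\<^sub>F n in sequentially. \<bar>f n\<bar> < 1 / real n ^ (k + Suc j)"
    using assms(2) unfolding negligible_def by blast
  then show "\<forall>\<^sub>F n in sequentially. \<bar>real (p n) * f n\<bar> < 1 / real n ^ k"
    using eventually_ge_at_top[of "2 + j"]
  proof eventually_elim
    case (elim n)
    have "j \<le> n ^ j"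
    proof (cases j)
      case (Suc i)
      have "n ^ 1 \<le> n ^ j" by (rule power_increasing) (use elim Suc in auto)
      then show ?thesis using elim by simp
    qed simp
    then have "p n \<le> 2 * n ^ j" using j[of n] by linarith
    also have "\<dots> \<le> n * n ^ j" using elim by (intro mult_right_mono) auto
    finally have "real (p n) \<le> real n ^ Suc j" by (metis of_nat_le_iff of_nat_power power_Suc)
    then have "\<bar>real (p n) * f n\<bar> \<le> real n ^ Suc j * \<bar>f n\<bar>"
      by (simp add: abs_mult mult_right_mono)
    also have "\<dots> < real n ^ Suc j * (1 / real n ^ (k + Suc j))"
      using elim by (intro mult_strict_left_mono) auto
    also have "\<dots> = 1 / real n ^ k"
      using elim by (simp add: power_add field_simps)
    finally show ?case .
  qed
qed

lemma negligible_add: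
  assumes "negligible f" "negligible g" shows "negligible (\<lambda>n. f n + g n)"
proof -
  have "negligible (\<lambda>n. max \<bar>f n\<bar> \<bar>g n\<bar>)"
    unfolding negligible_def
  proof
    fix k
    have "\<forall>\<^sub>F n in sequentially. \<bar>f n\<bar> < 1 / real n ^ k \<and> \<bar>g n\<bar> < 1 / real n ^ k"
      using assms by (auto simp: negligible_def eventually_conj_iff)
    then show "\<forall>\<^sub>F n in sequentially. \<bar>max \<bar>f n\<bar> \<bar>g n\<bar>\<bar> < 1 / real n ^ k"
      by (rule eventually_mono) auto
  qed
  from negligible_poly_mult[OF polynomially_bounded_const[of 2] this] show ?thesis
    by (rule negligible_mono) (auto simp: max_def)
qed

lemma negligible_zero: "negligible (\<lambda>_. 0)"
  unfolding negligible_def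
proof
  fix k show "\<forall>\<^sub>F n in sequentially. \<bar>0\<bar> < 1 / real n ^ k"
    using eventually_gt_at_top[of 0] by (rule eventually_mono) auto
qed

section \<open>Distinguishing advantage, averaging and hybrid arguments\<close>

definition adv :: "(sexp \<Rightarrow> sexp pmf) \<Rightarrow> nat \<Rightarrow> sexp \<Rightarrow> sexp pmf \<Rightarrow> sexp pmf \<Rightarrow> real" where
  "adv D l z X Y =
     \<bar>pmf (bind_pmf X (\<lambda>x. D (dist_input l z x))) (enc_bool True) -
      pmf (bind_pmf Y (\<lambda>x. D (dist_input l z x))) (enc_bool True)\<bar>"

definition distinguisher :: "(nat \<Rightarrow> sexp) \<Rightarrow> (sexp \<Rightarrow> sexp pmf) \<Rightarrow> bool" where
  "distinguisher z D \<longleftrightarrow> polynomially_bounded (\<lambda>l. size (z l)) \<and>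
     ppt id (range (\<lambda>(l, x). dist_input l (z l) x)) D"

text \<open>The advantage is bounded for all members of \<open>Q l\<close> at once, so \<open>q\<close> may depend on \<open>l\<close>.\<close>

definition unif_indist ::
    "(nat \<Rightarrow> 'q set) \<Rightarrow> (nat \<Rightarrow> 'q \<Rightarrow> sexp pmf) \<Rightarrow> (nat \<Rightarrow> 'q \<Rightarrow> sexp pmf) \<Rightarrow> bool" where
  "unif_indist Q X Y \<longleftrightarrow> (\<forall>z D. distinguisher z D \<longrightarrow>
     (\<exists>\<epsilon>. negligible \<epsilon> \<and> (\<forall>l. \<forall>q\<in>Q l. adv D l (z l) (X l q) (Y l q) \<le> \<epsilon> l)))"

lemma comp_indist_iff:
  "X \<approx>\<^sub>c Y \<longleftrightarrow> (\<forall>z D. distinguisher z D \<longrightarrow> negligible (\<lambda>l. adv D l (z l) (X l) (Y l)))"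
  unfolding comp_indist_def distinguisher_def adv_def negligible_abs by blast

lemma adv_nonneg: "0 \<le> adv D l z X Y"
  by (simp add: adv_def)

lemma adv_le_1: "adv D l z X Y \<le> 1"
  unfolding adv_def by (smt (verit) pmf_le_1 pmf_nonneg)

lemma adv_refl [simp]: "adv D l z X X = 0"
  by (simp add: adv_def)

lemma adv_sym: "adv D l z X Y = adv D l z Y X"
  by (simp add: adv_def abs_minus_commute)

lemma adv_triangle: "adv D l z X Y \<le> adv D l z X W + adv D l z W Y"
  unfolding adv_def by linarith

lemma unif_indist_refl: "(\<And>l q. q \<in> Q l \<Longrightarrow> X l q = Y l q) \<Longrightarrow> unif_indist Q X Y"
  unfolding unif_indist_def by (auto intro!: exI[of _ "\<lambda>_. 0"] simp: negligible_zero)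

lemma unif_indist_sym: "unif_indist Q X Y \<Longrightarrow> unif_indist Q Y X"
  unfolding unif_indist_def by (simp add: adv_sym)

lemma unif_indist_trans:
  assumes "unif_indist Q X W" "unif_indist Q W Y" shows "unif_indist Q X Y"
  unfolding unif_indist_def
proof (intro allI impI)
  fix z D assume *: "distinguisher z D"
  obtain \<epsilon> \<delta> where "negligible \<epsilon>" "\<And>l q. q \<in> Q l \<Longrightarrow> adv D l (z l) (X l q) (W l q) \<le> \<epsilon> l"
    "negligible \<delta>" "\<And>l q. q \<in> Q l \<Longrightarrow> adv D l (z l) (W l q) (Y l q) \<le> \<delta> l"
    using assms * unfolding unif_indist_def by meson
  then show "\<exists>\<epsilon>. negligible \<epsilon> \<and> (\<forall>l. \<forall>q\<in>Q l. adv D l (z l) (X l q) (Y l q) \<le> \<epsilon> l)"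
    by (intro exI[of _ "\<lambda>n. \<epsilon> n + \<delta> n"] conjI negligible_add) (auto intro!: order_trans[OF adv_triangle add_mono])
qed

lemma unif_indist_reindex:
  assumes "unif_indist Q X Y"
    and "\<And>l q. q \<in> Q' l \<Longrightarrow> f l q \<in> Q l \<and> X' l q = X l (f l q) \<and> Y' l q = Y l (f l q)"
  shows "unif_indist Q' X' Y'"
  using assms unfolding unif_indist_def by metis

lemma unif_indist_imp_comp_indist:
  assumes "unif_indist Q X Y" "\<And>l. q l \<in> Q l"
  shows "(\<lambda>l. X l (q l)) \<approx>\<^sub>c (\<lambda>l. Y l (q l))"
  unfolding comp_indist_iff
proof (intro allI impI)
  fix z D assume "distinguisher z D"
  then obtain \<epsilon> where "negligible \<epsilon>" "\<And>l. adv D l (z l) (X l (q l)) (Y l (q l)) \<le> \<epsilon> l"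
    using assms unfolding unif_indist_def by meson
  then show "negligible (\<lambda>l. adv D l (z l) (X l (q l)) (Y l (q l)))"
    by (elim negligible_mono) (smt (verit) adv_nonneg)
qed

text \<open>A supremum need not be attained, but if it is positive, some value exceeds half of it.
  This selects a nearly worst index for a given distinguisher.\<close>

lemma almost_maximum:
  fixes f :: "'a \<Rightarrow> real"
  assumes "Q \<noteq> {}" "\<And>q. 0 \<le> f q" "\<And>q. f q \<le> 1"
  shows "\<exists>p\<in>Q. \<forall>q\<in>Q. f q \<le> 2 * f p"
proof (cases "\<forall>q\<in>Q. f q = 0")
  case False
  let ?s = "Sup (f ` Q)"
  have bdd: "bdd_above (f ` Q)" by (rule bdd_aboveI2) (rule assms(3))
  obtain q where "q \<in> Q" "f q \<noteq> 0" using False by blast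
  then have "0 < ?s" using assms(2)[of q] cSUP_upper[OF _ bdd, of q] by linarith
  then obtain p where "p \<in> Q" "?s / 2 < f p"
    using less_cSUP_iff[OF assms(1) bdd, of "?s / 2"] by auto
  moreover have "f q \<le> ?s" if "q \<in> Q" for q using cSUP_upper[OF that bdd] .
  ultimately show ?thesis by (intro bexI[of _ p] ballI) (smt (verit) field_sum_of_halves)+
qed (use assms(1) in auto)

text \<open>The sequence of indices may be chosen after the distinguisher. Taking a nearly worst
  index for each parameter turns the statement about sequences into a uniform bound, at the price of
  a factor 2.\<close>

lemma unif_indistI_choice:
  assumes "\<And>l. Q l \<noteq> {}"
    and "\<And>q. (\<And>l. q l \<in> Q l) \<Longrightarrow> (\<lambda>l. X l (q l)) \<approx>\<^sub>c (\<lambda>l. Y l (q l))"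
  shows "unif_indist Q X Y"
  unfolding unif_indist_def
proof (intro allI impI)
  fix z D assume D: "distinguisher z D"
  have "\<exists>p\<in>Q l. \<forall>q\<in>Q l. adv D l (z l) (X l q) (Y l q) \<le> 2 * adv D l (z l) (X l p) (Y l p)" for l
    by (rule almost_maximum) (auto simp: assms(1) adv_nonneg adv_le_1)
  then obtain p where p: "\<And>l. p l \<in> Q l"
    "\<And>l q. q \<in> Q l \<Longrightarrow> adv D l (z l) (X l q) (Y l q) \<le> 2 * adv D l (z l) (X l (p l)) (Y l (p l))"
    by metis
  from assms(2)[OF p(1)] D have "negligible (\<lambda>l. adv D l (z l) (X l (p l)) (Y l (p l)))"
    unfolding comp_indist_iff by blast
  from negligible_poly_mult[OF polynomially_bounded_const[of 2] this] p(2)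
  show "\<exists>\<epsilon>. negligible \<epsilon> \<and> (\<forall>l. \<forall>q\<in>Q l. adv D l (z l) (X l q) (Y l q) \<le> \<epsilon> l)"
    by (intro exI conjI) auto
qed

text \<open>The difference of two expectations over the same \<open>R\<close> is at most the
  expected difference, so a bound valid for every fixed value of the common randomness survives
  averaging.\<close>

lemma adv_bind_le:
  assumes "\<And>r. r \<in> set_pmf R \<Longrightarrow> adv D l z (X r) (Y r) \<le> \<epsilon>"
  shows "adv D l z (bind_pmf R X) (bind_pmf R Y) \<le> \<epsilon>"
proof -
  define f where "f r = pmf (bind_pmf (X r) (\<lambda>x. D (dist_input l z x))) (enc_bool True)" for r
  define g where "g r = pmf (bind_pmf (Y r) (\<lambda>x. D (dist_input l z x))) (enc_bool True)" for r
  have int: "integrable (measure_pmf R) f" "integrable (measure_pmf R) g"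
    by (rule measure_pmf.integrable_const_bound[where B = 1]; simp add: f_def g_def pmf_le_1)+
  have "adv D l z (bind_pmf R X) (bind_pmf R Y) = \<bar>(\<integral>r. f r \<partial>R) - (\<integral>r. g r \<partial>R)\<bar>"
    by (simp add: adv_def bind_assoc_pmf pmf_bind[of R] f_def g_def)
  also have "\<dots> = \<bar>\<integral>r. f r - g r \<partial>R\<bar>" using int by simp
  also have "\<dots> \<le> (\<integral>r. \<bar>f r - g r\<bar> \<partial>R)" by (rule integral_abs_bound)
  also have "\<dots> \<le> (\<integral>r. \<epsilon> \<partial>R)"
  proof (rule integral_mono_AE)
    show "AE r in R. \<bar>f r - g r\<bar> \<le> \<epsilon>"
      using assms by (auto simp: AE_measure_pmf_iff adv_def f_def g_def)
  qed (use int in auto)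
  also have "\<dots> = \<epsilon>" by simp
  finally show ?thesis .
qed

text \<open>The common randomness becomes part of the index; this is why bounds have to be uniform
  over indices.\<close>

lemma unif_indist_mix:
  assumes "unif_indist (\<lambda>l. {(q, r). q \<in> Q l \<and> r \<in> set_pmf (R l q)})
      (\<lambda>l p. X l (fst p) (snd p)) (\<lambda>l p. Y l (fst p) (snd p))"
  shows "unif_indist Q (\<lambda>l q. bind_pmf (R l q) (X l q)) (\<lambda>l q. bind_pmf (R l q) (Y l q))"
  unfolding unif_indist_def
proof (intro allI impI)
  fix z D assume "distinguisher z D"
  then obtain \<epsilon> where "negligible \<epsilon>"
    "\<And>l q r. q \<in> Q l \<Longrightarrow> r \<in> set_pmf (R l q) \<Longrightarrow> adv D l (z l) (X l q r) (Y l q r) \<le> \<epsilon> l"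
    using assms unfolding unif_indist_def by fastforce
  then show "\<exists>\<epsilon>. negligible \<epsilon> \<and>
      (\<forall>l. \<forall>q\<in>Q l. adv D l (z l) (bind_pmf (R l q) (X l q)) (bind_pmf (R l q) (Y l q)) \<le> \<epsilon> l)"
    by (intro exI[of _ \<epsilon>] conjI allI ballI adv_bind_le)
qed

text \<open>The number of steps depends on l. Telescoping yields a negligible sum because a single
  \<epsilon> serves all neighbouring pairs.\<close>

lemma unif_indist_hybrid:
  assumes N: "polynomially_bounded B" "\<And>l q. q \<in> Q l \<Longrightarrow> N l q \<le> B l"
    and H: "unif_indist (\<lambda>l. {(q, i). q \<in> Q l \<and> i < N l q})
      (\<lambda>l p. H l (fst p) (snd p)) (\<lambda>l p. H l (fst p) (Suc (snd p)))"
  shows "unif_indist Q (\<lambda>l q. H l q 0) (\<lambda>l q. H l q (N l q))"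
  unfolding unif_indist_def
proof (intro allI impI)
  fix z D assume "distinguisher z D"
  then obtain \<epsilon> where \<epsilon>: "negligible \<epsilon>"
    "\<And>l q i. q \<in> Q l \<Longrightarrow> i < N l q \<Longrightarrow> adv D l (z l) (H l q i) (H l q (Suc i)) \<le> \<epsilon> l"
    using H unfolding unif_indist_def by fastforce
  have "adv D l (z l) (H l q 0) (H l q (N l q)) \<le> real (B l) * \<bar>\<epsilon> l\<bar>" if q: "q \<in> Q l" for l q
  proof -
    have "adv D l (z l) (H l q 0) (H l q i) \<le> real i * \<bar>\<epsilon> l\<bar>" if "i \<le> N l q" for i
      using that
    proof (induction i)
      case (Suc i)
      then have "adv D l (z l) (H l q 0) (H l q (Suc i)) \<le> real i * \<bar>\<epsilon> l\<bar> + \<epsilon> l"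
        using adv_triangle[of D l "z l" "H l q 0" "H l q (Suc i)" "H l q i"] \<epsilon>(2)[OF q, of i] by linarith
      then show ?case by (simp add: algebra_simps)
    qed simp
    from this[of "N l q"] have "adv D l (z l) (H l q 0) (H l q (N l q)) \<le> real (N l q) * \<bar>\<epsilon> l\<bar>" by simp
    also have "\<dots> \<le> real (B l) * \<bar>\<epsilon> l\<bar>" using N(2)[OF q] by (intro mult_right_mono) auto
    finally show ?thesis .
  qed
  moreover have "negligible (\<lambda>l. real (B l) * \<bar>\<epsilon> l\<bar>)"
    by (rule negligible_poly_mult[OF N(1)]) (simp add: negligible_abs \<epsilon>(1))
  ultimately show "\<exists>\<epsilon>. negligible \<epsilon> \<and> (\<forall>l. \<forall>q\<in>Q l. adv D l (z l) (H l q 0) (H l q (N l q)) \<le> \<epsilon> l)"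
    by blast
qed

text \<open>The extra cell separates \<open>Some a\<close> from \<open>None\<close> even when
  \<open>a\<close> is encoded by \<open>Atom\<close>.\<close>

definition enc_option :: "('a \<Rightarrow> sexp) \<Rightarrow> 'a option \<Rightarrow> sexp" where
  "enc_option e = case_option Atom (\<lambda>a. Cell Atom (e a))"

lemma pt_the:
  assumes "pt e A (enc_option e1) f" "\<And>a. a \<in> A \<Longrightarrow> f a \<noteq> None"
  shows "pt e A e1 (\<lambda>a. the (f a))"
proof -
  have "pt (enc_option e1) {x. x \<noteq> None} (enc_pair (\<lambda>_. Atom) e1) (\<lambda>x. ((), the x))"
    by (rule pt_recode) (auto simp: enc_option_def)
  from pt_snd[OF pt_comp[OF this assms(1)]] assms(2) show ?thesis by simp
qed

lemma pt_is_Some: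
  assumes "pt e A (enc_option e1) f"
  shows "pt e A enc_bool (\<lambda>a. f a \<noteq> None)"
proof -
  have "enc_option e1 x \<noteq> Atom \<longleftrightarrow> x \<noteq> None" for x by (cases x) (auto simp: enc_option_def)
  then show ?thesis using pt_nonatom[OF pt_encode[OF assms]] by simp
qed

text \<open>
  Post-processing by a deterministic polynomial-time \<open>R\<close> that depends on advice \<open>a\<close>: the advice on
  which a distinguisher performs (almost) best is handed to the reduction as part of its own advice.
\<close>

lemma unif_indist_post:
  fixes ea :: "'a \<Rightarrow> sexp"
  assumes XY: "unif_indist Q X Y"
    and R: "pt (enc_pair unary (enc_pair ea id)) {(l, a, x). a \<in> A l} id (\<lambda>p. R (fst p) (fst (snd p)) (snd (snd p)))"
    and B: "polynomially_bounded B" "\<And>l a. a \<in> A l \<Longrightarrow> size (ea a) \<le> B l"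
  shows "unif_indist (\<lambda>l. Q l \<times> A l)
    (\<lambda>l p. map_pmf (R l (snd p)) (X l (fst p))) (\<lambda>l p. map_pmf (R l (snd p)) (Y l (fst p)))"
  unfolding unif_indist_def
proof (intro allI impI)
  fix z D assume D: "distinguisher z D"
  define f where "f l p = adv D l (z l) (map_pmf (R l (snd p)) (X l (fst p))) (map_pmf (R l (snd p)) (Y l (fst p)))" for l p
  have "\<exists>p. Q l \<times> A l \<noteq> {} \<longrightarrow> p \<in> Q l \<times> A l \<and> (\<forall>q\<in>Q l \<times> A l. f l q \<le> 2 * f l p)" for l
  proof (cases "Q l \<times> A l = {}")
    case False
    then have "\<exists>p\<in>Q l \<times> A l. \<forall>q\<in>Q l \<times> A l. f l q \<le> 2 * f l p"
      by (rule almost_maximum) (auto simp: f_def adv_nonneg adv_le_1)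
    then show ?thesis by blast
  qed auto
  then obtain p where p: "\<And>l. Q l \<times> A l \<noteq> {} \<Longrightarrow> p l \<in> Q l \<times> A l \<and> (\<forall>q\<in>Q l \<times> A l. f l q \<le> 2 * f l (p l))"
    by metis
  \<comment> \<open>For empty \<open>Q l \<times> A l\<close> there is no advice to hand over, but
    the reduction must be defined for all l; it then replaces the sample by
    \<open>Atom\<close>.\<close>
  define opt where "opt l = (if Q l \<times> A l \<noteq> {} then Some (snd (p l)) else None)" for l
  have opt: "a \<in> A l" if "opt l = Some a" for a l
    using that p[of l] by (auto simp: opt_def split: if_splits)
  define z' where "z' l = Cell (z l) (enc_option ea (opt l))" for l
  define g where "g = (\<lambda>(l, x). dist_input l (z l) (if opt l \<noteq> None then R l (the (opt l)) x else Atom))"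
  let ?e = "\<lambda>(l, x). dist_input l (z' l) x"
  let ?e' = "enc_pair unary (enc_pair (enc_pair id (enc_option ea)) id)"
  let ?A = "{(l, (zz, o'), x). \<forall>a. o' = Some a \<longrightarrow> a \<in> A l} :: (nat \<times> (sexp \<times> 'a option) \<times> sexp) set"
  have 1: "pt ?e UNIV ?e' (\<lambda>p. (fst p, (z (fst p), opt (fst p)), snd p))"
    by (rule pt_recode) (auto simp: dist_input_def z'_def)
  have 2: "pt ?e' ?A id (\<lambda>p. dist_input (fst p) (fst (fst (snd p)))
      (if snd (fst (snd p)) \<noteq> None then R (fst p) (the (snd (fst (snd p)))) (snd (snd p)) else Atom))"
  proof -
    have "pt ?e' ?A id (\<lambda>p. if snd (fst (snd p)) \<noteq> None then R (fst p) (the (snd (fst (snd p)))) (snd (snd p)) else Atom)"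
    proof (rule pt_if)
      show "pt ?e' {p \<in> ?A. snd (fst (snd p)) \<noteq> None} id (\<lambda>p. R (fst p) (the (snd (fst (snd p)))) (snd (snd p)))"
        by (rule pt_comp[OF R, where f = "\<lambda>p. (fst p, the (snd (fst (snd p))), snd (snd p))", simplified];
            (rule pt_intros pt_the | force)+)
    qed (rule pt_is_Some pt_intros)+
    note r = this
    have "pt ?e' ?A (enc_pair unary (enc_pair id id)) (\<lambda>p. (fst p, fst (fst (snd p)),
      (if snd (fst (snd p)) \<noteq> None then R (fst p) (the (snd (fst (snd p)))) (snd (snd p)) else Atom)))"
      by (rule r pt_intros)+
    from pt_encode[OF this] show ?thesis by (simp add: dist_input_def)
  qed
  have G: "pt ?e UNIV id g"
    by (rule pt_cong[OF pt_comp[OF 2 1]]) (use opt in \<open>auto simp: g_def\<close>)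
  have "rt id (range (\<lambda>(l, x). dist_input l (z l) x)) id D"
    using D by (simp add: distinguisher_def rt_def)
  moreover have "g y \<in> range (\<lambda>(l, x). dist_input l (z l) x)" for y
    unfolding g_def by (cases y) force
  ultimately have "rt ?e UNIV id (\<lambda>y. D (g y))" using rt_comp[OF _ G] by blast
  then have "ppt ?e UNIV (\<lambda>y. D (g y))" by (simp add: rt_def)
  \<comment> \<open>A distinguisher is a function of the code of its input, and this code contains
    the chosen advice inside \<open>z' l\<close>.\<close>
  from ppt_to_id[OF this] obtain D' where D': "ppt id (range ?e) D'" "\<And>y. D' (?e y) = D (g y)" by blast
  have "polynomially_bounded (\<lambda>l. size (z l) + (B l + 2))"
    using D B(1) by (intro pb_intros) (simp add: distinguisher_def)
  moreover have "size (z' l) \<le> size (z l) + (B l + 2)" for l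
    using B(2)[OF opt, of l] by (cases "opt l") (auto simp: z'_def enc_option_def)
  ultimately have "polynomially_bounded (\<lambda>l. size (z' l))" by (rule polynomially_bounded_mono)
  then have "distinguisher z' D'" using D'(1) by (simp add: distinguisher_def)
  then obtain \<epsilon> where \<epsilon>: "negligible \<epsilon>" "\<And>l q. q \<in> Q l \<Longrightarrow> adv D' l (z' l) (X l q) (Y l q) \<le> \<epsilon> l"
    using XY unfolding unif_indist_def by meson
  have "f l q \<le> 2 * \<epsilon> l" if "q \<in> Q l \<times> A l" for l q
  proof -
    have ne: "Q l \<times> A l \<noteq> {}" using that by blast
    have "D' (dist_input l (z' l) x) = D (dist_input l (z l) (R l (snd (p l)) x))" for x
      using D'(2)[of "(l, x)"] ne by (auto simp: g_def opt_def)
    then have "f l (p l) = adv D' l (z' l) (X l (fst (p l))) (Y l (fst (p l)))"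
      by (simp add: f_def adv_def bind_map_pmf)
    then show ?thesis using \<epsilon>(2)[of "fst (p l)" l] p[OF ne] that by (force simp: mem_Times_iff)
  qed
  moreover have "negligible (\<lambda>l. 2 * \<epsilon> l)"
    using negligible_poly_mult[OF polynomially_bounded_const[of 2] \<epsilon>(1)] by simp
  ultimately show "\<exists>\<epsilon>. negligible \<epsilon> \<and> (\<forall>l. \<forall>q\<in>Q l \<times> A l.
      adv D l (z l) (map_pmf (R l (snd q)) (X l (fst q))) (map_pmf (R l (snd q)) (Y l (fst q))) \<le> \<epsilon> l)"
    unfolding f_def by blast
qed

lemma sequence_pmf_append:
  "sequence_pmf (ps @ qs) = bind_pmf (sequence_pmf ps) (\<lambda>xs. map_pmf ((@) xs) (sequence_pmf qs))"
  by (induction ps) (simp_all add: bind_return_pmf bind_return_pmf' bind_assoc_pmf map_bind_pmf map_pmf_def)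

lemma set_sequence_pmf: "set_pmf (sequence_pmf ps) = {xs. list_all2 (\<lambda>x p. x \<in> set_pmf p) xs ps}"
  by (induction ps) (auto simp: list_all2_Cons2)

lemma list_all2_map_mem: "list_all2 P xs (map f ys) \<Longrightarrow> x \<in> set xs \<Longrightarrow> \<exists>y\<in>set ys. P x (f y)"
  unfolding list_all2_map2 by (metis in_set_conv_nth list_all2_conv_all_nth)

text \<open>Hybrids over the positions: the first i entries come from \<open>Y\<close>, the others
  from \<open>X\<close>. All entries except one are averaged out and become advice, so their sizes
  must be bounded on the supports of both families.\<close>

lemma unif_indist_list:
  assumes XY: "unif_indist Q X Y"
    and B: "polynomially_bounded B"
      "\<And>l q x. q \<in> Q l \<Longrightarrow> x \<in> set_pmf (X l q) \<union> set_pmf (Y l q) \<Longrightarrow> size x \<le> B l"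
    and N: "polynomially_bounded N"
  shows "unif_indist (\<lambda>l. {qs. set qs \<subseteq> Q l \<and> length qs \<le> N l})
    (\<lambda>l qs. map_pmf (enc_list id) (sequence_pmf (map (X l) qs)))
    (\<lambda>l qs. map_pmf (enc_list id) (sequence_pmf (map (Y l) qs)))"
proof -
  define Qs where "Qs l = {qs. set qs \<subseteq> Q l \<and> length qs \<le> N l}" for l
  define H where "H l qs i = map_pmf (enc_list id)
      (sequence_pmf (map (Y l) (take i qs) @ map (X l) (drop i qs)))" for l qs i
  define ctx where "ctx l p = pair_pmf (sequence_pmf (map (Y l) (take (snd p) (fst p))))
      (sequence_pmf (map (X l) (drop (Suc (snd p)) (fst p))))" for l and p :: "'a list \<times> nat"
  define A where "A l = {(us, vs). size (enc_list id us) \<le> N l * Suc (B l) \<and> size (enc_list id vs) \<le> N l * Suc (B l)}" for l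
  have post: "unif_indist (\<lambda>l. Q l \<times> A l)
    (\<lambda>l p. map_pmf (\<lambda>x. enc_list id (fst (snd p) @ x # snd (snd p))) (X l (fst p)))
    (\<lambda>l p. map_pmf (\<lambda>x. enc_list id (fst (snd p) @ x # snd (snd p))) (Y l (fst p)))"
  proof (rule unif_indist_post[OF XY])
    show "pt (enc_pair unary (enc_pair (enc_pair (enc_list id) (enc_list id)) id)) {(l, a, x). a \<in> A l} id
     (\<lambda>p. enc_list id (fst (fst (snd p)) @ snd (snd p) # snd (fst (snd p))))"
      by (rule pt_encode) (rule pt_intros)+
    show "polynomially_bounded (\<lambda>l. Suc (N l * Suc (B l) + N l * Suc (B l)))"
      by (intro pb_intros B N)
  qed (auto simp: A_def)
  have "unif_indist Qs (\<lambda>l qs. H l qs 0) (\<lambda>l qs. H l qs (length qs))"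
  proof (rule unif_indist_hybrid[OF N])
    let ?S = "\<lambda>l. {(q, i). q \<in> Qs l \<and> i < length q}"
    \<comment> \<open>The entry in question is independent of the others and can be sampled
      last.\<close>
    have split: "map_pmf (enc_list id) (sequence_pmf (ps @ w # ps')) =
        bind_pmf (pair_pmf (sequence_pmf ps) (sequence_pmf ps'))
          (\<lambda>r. map_pmf (\<lambda>x. enc_list id (fst r @ x # snd r)) w)" for ps ps' w
    proof -
      have "bind_pmf (sequence_pmf ps') (\<lambda>vs. bind_pmf w (\<lambda>x. return_pmf (enc_list id (us @ x # vs)))) =
         bind_pmf w (\<lambda>x. bind_pmf (sequence_pmf ps') (\<lambda>vs. return_pmf (enc_list id (us @ x # vs))))" for us
        by (rule bind_commute_pmf)
      then show ?thesis
        by (simp add: sequence_pmf_append pair_pmf_def map_pmf_def bind_assoc_pmf bind_return_pmf)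
    qed
    have "unif_indist ?S (\<lambda>l p. bind_pmf (ctx l p) (\<lambda>r. map_pmf (\<lambda>x. enc_list id (fst r @ x # snd r)) (X l (fst p ! snd p))))
      (\<lambda>l p. bind_pmf (ctx l p) (\<lambda>r. map_pmf (\<lambda>x. enc_list id (fst r @ x # snd r)) (Y l (fst p ! snd p))))"
    proof (rule unif_indist_mix, rule unif_indist_reindex[OF post, where f = "\<lambda>l p. (fst (fst p) ! snd (fst p), snd p)"])
      fix l p assume "p \<in> {(q, r). q \<in> ?S l \<and> r \<in> set_pmf (ctx l q)}"
      then obtain qs i us vs where p: "p = ((qs, i), (us, vs))" "set qs \<subseteq> Q l" "length qs \<le> N l" "i < length qs"
        "list_all2 (\<lambda>x p. x \<in> set_pmf p) us (map (Y l) (take i qs))"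
        "list_all2 (\<lambda>x p. x \<in> set_pmf p) vs (map (X l) (drop (Suc i) qs))"
        by (auto simp: ctx_def set_sequence_pmf Qs_def)
      have "size (enc_list id us) \<le> N l * Suc (B l)"
      proof (rule size_enc_list_le)
        show "length us \<le> N l" using p list_all2_lengthD[OF p(5)] by simp
        fix x assume "x \<in> set us"
        then obtain q where "q \<in> set (take i qs)" "x \<in> set_pmf (Y l q)"
          using list_all2_map_mem[OF p(5)] by blast
        moreover from this have "q \<in> Q l" using p(2) by (meson in_set_takeD subsetD)
        ultimately show "size (id x) \<le> B l" using B(2)[of q l x] by simp
      qed
      moreover have "size (enc_list id vs) \<le> N l * Suc (B l)"
      proof (rule size_enc_list_le)
        show "length vs \<le> N l" using p list_all2_lengthD[OF p(6)] by simp
        fix x assume "x \<in> set vs"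
        then obtain q where "q \<in> set (drop (Suc i) qs)" "x \<in> set_pmf (X l q)"
          using list_all2_map_mem[OF p(6)] by blast
        moreover from this have "q \<in> Q l" using p(2) by (meson in_set_dropD subsetD)
        ultimately show "size (id x) \<le> B l" using B(2)[of q l x] by simp
      qed
      ultimately show "(fst (fst p) ! snd (fst p), snd p) \<in> Q l \<times> A l \<and>
        map_pmf (\<lambda>x. enc_list id (fst (snd p) @ x # snd (snd p))) (X l (fst (fst p) ! snd (fst p))) =
        map_pmf (\<lambda>x. enc_list id (fst (snd (fst (fst p) ! snd (fst p), snd p)) @ x # snd (snd (fst (fst p) ! snd (fst p), snd p)))) (X l (fst (fst (fst p) ! snd (fst p), snd p))) \<and>
        map_pmf (\<lambda>x. enc_list id (fst (snd p) @ x # snd (snd p))) (Y l (fst (fst p) ! snd (fst p))) =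
        map_pmf (\<lambda>x. enc_list id (fst (snd (fst (fst p) ! snd (fst p), snd p)) @ x # snd (snd (fst (fst p) ! snd (fst p), snd p)))) (Y l (fst (fst (fst p) ! snd (fst p), snd p)))"
        using p by (auto simp: A_def)
    qed
    then show "unif_indist ?S (\<lambda>l p. H l (fst p) (snd p)) (\<lambda>l p. H l (fst p) (Suc (snd p)))"
    proof (rule unif_indist_reindex[where f = "\<lambda>_ p. p"])
      fix l p assume "p \<in> ?S l"
      then obtain qs i where p: "p = (qs, i)" "i < length qs" "p \<in> ?S l" by auto
      have "H l qs i = bind_pmf (ctx l p) (\<lambda>r. map_pmf (\<lambda>x. enc_list id (fst r @ x # snd r)) (X l (qs ! i)))"
        unfolding H_def ctx_def using p split by (simp add: Cons_nth_drop_Suc[symmetric])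
      moreover have "H l qs (Suc i) = bind_pmf (ctx l p) (\<lambda>r. map_pmf (\<lambda>x. enc_list id (fst r @ x # snd r)) (Y l (qs ! i)))"
        unfolding H_def ctx_def using p split[of "map (Y l) (take i qs)"] by (simp add: take_Suc_conv_app_nth)
      ultimately show "p \<in> ?S l \<and>
        H l (fst p) (snd p) = bind_pmf (ctx l p) (\<lambda>r. map_pmf (\<lambda>x. enc_list id (fst r @ x # snd r)) (X l (fst p ! snd p))) \<and>
        H l (fst p) (Suc (snd p)) = bind_pmf (ctx l p) (\<lambda>r. map_pmf (\<lambda>x. enc_list id (fst r @ x # snd r)) (Y l (fst p ! snd p)))"
        using p by simp
    qed
  qed (simp add: Qs_def)
  then show ?thesis
    by (rule unif_indist_reindex[where f = "\<lambda>_ qs. qs"]) (simp_all add: H_def Qs_def)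
qed

section \<open>Function secret sharing\<close>

lemma size_enc_bool: "size (enc_bool b) \<le> 1"
  by (cases b) auto

lemma size_enc_bits: "size (enc_bits s) \<le> 2 * length s"
  using size_enc_list_le[of s "length s" enc_bool 1] size_enc_bool by simp

abbreviation enc_node :: "node \<Rightarrow> sexp" where
  "enc_node \<equiv> enc_pair enc_bits enc_bool"

lemma enc_corr_word_eq: "enc_corr_word = enc_pair enc_bits (enc_pair enc_bool enc_bool)"
  by (rule ext) auto

lemma enc_key_eq: "enc_key = enc_pair enc_bits (enc_pair enc_bool (enc_pair (enc_list enc_corr_word) enc_bits))"
  by (rule ext) auto

lemma enc_fss_coins_eq: "enc_fss_coins = enc_pair enc_bits (enc_pair enc_bits enc_bool)"
  by (rule ext) auto

lemma enc_bits2_eq: "enc_bits2 = enc_pair enc_bits enc_bits"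
  by (rule ext) (auto simp: enc_bits2_def)

lemma enc_bits3_eq: "enc_bits3 = enc_pair enc_bits (enc_pair enc_bits enc_bits)"
  by (rule ext) (auto simp: enc_bits3_def)

lemma length_xors [simp]: "length (x xors y) = min (length x) (length y)"
  by (simp add: xors_def)

lemma length_scale [simp]: "length (scale t x) = length x"
  by (simp add: scale_def)

lemma nth_xors: "i < length x \<Longrightarrow> i < length y \<Longrightarrow> (x xors y) ! i = (x ! i xorb y ! i)"
  by (simp add: xors_def)

lemma xors_commute: "x xors y = y xors x"
  by (rule nth_equalityI) (auto simp: nth_xors xorb_def)

lemma xorb_commute: "a xorb b = b xorb a"
  by (auto simp: xorb_def)

lemma xors_cancel_right: "x xors z = y xors z \<Longrightarrow> length x = length z \<Longrightarrow> length y = length z \<Longrightarrow> x = y"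
proof (rule nth_equalityI)
  fix i assume *: "x xors z = y xors z" "length x = length z" "length y = length z" "i < length x"
  then have "(x xors z) ! i = (y xors z) ! i" by simp
  then show "x ! i = y ! i" using *(2-4) by (auto simp: nth_xors xorb_def)
qed simp

lemma take_xors: "take n (x xors y) = take n x xors take n y"
  by (simp add: xors_def take_map take_zip)

lemma drop_xors: "drop n (x xors y) = drop n x xors drop n y"
  by (simp add: xors_def drop_map drop_zip)

lemma scale_append: "scale t (x @ y) = scale t x @ scale t y"
  by (simp add: scale_def)

section \<open>One level of the key generation: children and correction words\<close>

definition keep_child :: "bool \<Rightarrow> nat \<Rightarrow> bits \<Rightarrow> node" where
  "keep_child a l y = (if a then snd (split_children l y) else fst (split_children l y))"

definition corr_word_of :: "bool \<Rightarrow> nat \<Rightarrow> bits \<Rightarrow> bits \<Rightarrow> corr_word" where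
  "corr_word_of a l y0 y1 =
     (fst (keep_child (\<not> a) l y0) xors fst (keep_child (\<not> a) l y1),
      y0 ! l xorb y1 ! l xorb a xorb True, y0 ! (2 * l + 1) xorb y1 ! (2 * l + 1) xorb a)"

definition corrected :: "bool \<Rightarrow> corr_word \<Rightarrow> bool \<Rightarrow> node \<Rightarrow> node" where
  "corrected a cw t k =
     (fst k xors scale t (fst cw), snd k xorb (t \<and> (if a then snd (snd cw) else fst (snd cw))))"

text \<open>By this symmetry the corrupted party may be listed first, whichever server it
  is.\<close>

lemma corr_word_of_commute: "corr_word_of a l y0 y1 = corr_word_of a l y1 y0"
  by (auto simp: corr_word_of_def xors_commute xorb_commute)

lemma length_keep_child: "length y = 2 * l + 2 \<Longrightarrow> length (fst (keep_child a l y)) = l"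
  by (simp add: keep_child_def split_children_def)

lemma length_corr_word_of:
  "length y0 = 2 * l + 2 \<Longrightarrow> length y1 = 2 * l + 2 \<Longrightarrow> length (fst (corr_word_of a l y0 y1)) = l"
  by (simp add: corr_word_of_def length_keep_child)

text \<open>For either value of \<open>a\<close>, the correction of the kept control bit is the
  exclusive or of both kept bits and 1, and exactly one party applies it. Along the path the control
  bit of one party thus determines that of the other.\<close>

lemma corrected_bits_differ:
  "snd (corrected a (corr_word_of a l y0 y1) (\<not> t) (keep_child a l y1)) =
   (\<not> snd (corrected a (corr_word_of a l y0 y1) t (keep_child a l y0)))"
  by (cases a; cases t) (auto simp: corrected_def corr_word_of_def keep_child_def split_children_def xorb_def)

lemma pt_Suc [pt_intros]: assumes "pt e A unary n" shows "pt e A unary (\<lambda>a. Suc (n a))"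
proof -
  have "pt (enc_pair (\<lambda>_ :: unit. Atom) unary) UNIV unary (\<lambda>p. Suc (snd p))"
  proof (rule pt_recode)
    fix p :: "unit \<times> nat"
    show "unary (Suc (snd p)) = enc_pair (\<lambda>_. Atom) unary p"
      using unary_eq[of "() # replicate (snd p) ()"] unary_eq[of "replicate (snd p) ()"] by (cases p) simp
  qed
  from pt_comp[OF this pt_pair[OF pt_const assms]] show ?thesis by simp
qed

text \<open>Only l is available in unary, so the last control bit is read at position l after
  dropping l + 1 entries, which is position 2 * l + 1.\<close>

lemma pt_split_children:
  assumes "pt e A unary l" "pt e A enc_bits y" "\<And>a. a \<in> A \<Longrightarrow> length (y a) = 2 * l a + 2"
  shows "pt e A (enc_pair enc_node enc_node) (\<lambda>a. split_children (l a) (y a))"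
proof -
  have "pt e A (enc_pair enc_node enc_node) (\<lambda>a. ((take (l a) (y a), y a ! l a),
      (take (l a) (drop (Suc (l a)) (y a)), drop (Suc (l a)) (y a) ! l a)))"
    by (intro pt_pair pt_take pt_drop pt_nth pt_Suc assms) (auto simp: assms(3))
  then show ?thesis by (rule pt_cong) (simp add: split_children_def assms(3) mult_2)
qed

lemma pt_keep_child:
  assumes "pt e A enc_bool b" "pt e A unary l" "pt e A enc_bits y" "\<And>a. a \<in> A \<Longrightarrow> length (y a) = 2 * l a + 2"
  shows "pt e A enc_node (\<lambda>a. keep_child (b a) (l a) (y a))"
  unfolding keep_child_def by (rule pt_if_total pt_fst pt_snd assms pt_split_children | simp add: assms)+

lemma pt_corr_word_of:
  assumes "pt e A enc_bool b" "pt e A unary l" "pt e A enc_bits y0" "pt e A enc_bits y1"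
    "\<And>a. a \<in> A \<Longrightarrow> length (y0 a) = 2 * l a + 2" "\<And>a. a \<in> A \<Longrightarrow> length (y1 a) = 2 * l a + 2"
  shows "pt e A enc_corr_word (\<lambda>a. corr_word_of (b a) (l a) (y0 a) (y1 a))"
proof -
  have *: "pt e A enc_bool (\<lambda>a. snd (snd (split_children (l a) (z a))))"
    "pt e A enc_bool (\<lambda>a. snd (fst (split_children (l a) (z a))))"
    if "pt e A enc_bits z" "\<And>a. a \<in> A \<Longrightarrow> length (z a) = 2 * l a + 2" for z
    by (rule pt_snd pt_fst, rule pt_snd pt_fst, rule pt_split_children[OF assms(2)]; rule that; assumption)+
  have *: "pt e A enc_bool (\<lambda>a. z a ! (2 * l a + 1))" "pt e A enc_bool (\<lambda>a. z a ! l a)"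
    if "pt e A enc_bits z" "\<And>a. a \<in> A \<Longrightarrow> length (z a) = 2 * l a + 2" for z
    using *[OF that] by (simp_all add: split_children_def)
  show ?thesis unfolding corr_word_of_def enc_corr_word_eq
    by (rule pt_pair pt_xors pt_fst[OF pt_keep_child] pt_Not pt_xorb pt_const assms * | simp add: assms)+
qed

lemma pt_corrected:
  assumes "pt e A enc_bool b" "pt e A enc_corr_word cw" "pt e A enc_bool t" "pt e A enc_node k"
  shows "pt e A enc_node (\<lambda>a. corrected (b a) (cw a) (t a) (k a))"
  unfolding corrected_def
  by (rule assms[unfolded enc_corr_word_eq] pt_intros)+

definition corr_word_pmf :: "nat \<Rightarrow> corr_word pmf" where
  "corr_word_pmf l = pair_pmf (uniform_bits l) (pair_pmf (pmf_of_set UNIV) (pmf_of_set UNIV))"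

lemma set_corr_word_pmf: "set_pmf (corr_word_pmf l) = {cw. length (fst cw) = l}"
  by (auto simp: corr_word_pmf_def)

lemma size_enc_corr_word: "size (enc_corr_word cw) \<le> 2 * length (fst cw) + 4"
proof -
  obtain s tL tR where "cw = (s, tL, tR)" by (cases cw) auto
  then show ?thesis using size_enc_bits[of s] size_enc_bool[of tL] size_enc_bool[of tR] by simp
qed

lemma card_bits: "card {s :: bits. length s = n} = 2 ^ n"
  using card_lists_length_eq[of "UNIV :: bool set" n] by simp

lemma split_bits:
  assumes "length y = 2 * l + 2"
  shows "y = fst (fst (split_children l y)) @ [snd (fst (split_children l y))] @
    fst (snd (split_children l y)) @ [snd (snd (split_children l y))]"
proof -
  have "drop (2 * l + 1) y = [y ! (2 * l + 1)]"
    using assms by (subst Cons_nth_drop_Suc[symmetric]) auto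
  then have "drop (Suc l) y = take l (drop (Suc l) y) @ [y ! (2 * l + 1)]"
    using append_take_drop_id[of l "drop (Suc l) y"] by (simp add: mult_2)
  moreover have "y = take l y @ y ! l # drop (Suc l) y"
    using assms by (intro id_take_nth_drop) simp
  ultimately show ?thesis by (simp add: split_children_def)
qed

text \<open>
  The seed that is lost masks the correction word, and the seed that is kept masks the next seed.
\<close>

lemma corr_word_uniform:
  assumes y: "length y = 2 * l + 2"
  shows "map_pmf (\<lambda>y'. (corr_word_of a l y y', fst (corrected a (corr_word_of a l y y') t (keep_child a l y'))))
      (uniform_bits (2 * (l + 1))) = pair_pmf (corr_word_pmf l) (uniform_bits l)"
proof -
  let ?f = "\<lambda>y'. (corr_word_of a l y y', fst (corrected a (corr_word_of a l y y') t (keep_child a l y')))"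
  let ?A = "{s :: bits. length s = 2 * (l + 1)}" and ?L = "{s :: bits. length s = l}"
  let ?B = "(?L \<times> (UNIV :: bool set) \<times> (UNIV :: bool set)) \<times> ?L"
  have inj: "inj_on ?f ?A"
  proof (rule inj_onI)
    fix u v assume uv: "u \<in> ?A" "v \<in> ?A" "?f u = ?f v"
    have l: "length (fst (keep_child c l w)) = l" if "w \<in> {y, u, v}" for c w
      using that uv y by (intro length_keep_child) auto
    have cw: "corr_word_of a l y u = corr_word_of a l y v" using uv(3) by simp
    \<comment> \<open>The seed of the correction word is the lost seed masked by that of the fixed
      \<open>y\<close>; cancelling the latter recovers it.\<close>
    then have "fst (keep_child (\<not> a) l u) xors fst (keep_child (\<not> a) l y) = fst (keep_child (\<not> a) l v) xors fst (keep_child (\<not> a) l y)"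
      by (simp add: corr_word_of_def xors_commute)
    then have 1: "fst (keep_child (\<not> a) l u) = fst (keep_child (\<not> a) l v)"
      by (rule xors_cancel_right) (simp_all add: l)
    have "length (fst (corr_word_of a l y v)) = l" using uv y by (intro length_corr_word_of) auto
    \<comment> \<open>With equal correction words, the mask on the kept seed is the same for
      \<open>u\<close> and \<open>v\<close> and cancels.\<close>
    moreover have "fst (keep_child a l u) xors scale t (fst (corr_word_of a l y v)) = fst (keep_child a l v) xors scale t (fst (corr_word_of a l y v))"
      using uv(3) cw by (simp add: corrected_def)
    ultimately have 2: "fst (keep_child a l u) = fst (keep_child a l v)"
      by (intro xors_cancel_right[of "fst (keep_child a l u)" "scale t (fst (corr_word_of a l y v))"]) (simp_all add: l)
    have 3: "u ! l = v ! l" "u ! (2 * l + 1) = v ! (2 * l + 1)"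
      using cw by (auto simp: corr_word_of_def xorb_def)
    have "split_children l u = split_children l v"
      using 1 2 3 by (cases a) (auto simp: keep_child_def split_children_def)
    then show "u = v" using split_bits[of u l] split_bits[of v l] uv by simp
  qed
  \<comment> \<open>Both sides have 2 ^ (2 * l + 2) elements, so injectivity suffices.\<close>
  have "?f ` ?A = ?B"
  proof (rule card_subset_eq)
    show "finite ?B" by (intro finite_cartesian_product finite_bits finite)
    show "?f ` ?A \<subseteq> ?B"
    proof
      fix x assume "x \<in> ?f ` ?A"
      then obtain y' where "x = ?f y'" "length y' = 2 * l + 2" by auto
      then show "x \<in> ?B"
        using y length_corr_word_of[of y l y' a] length_keep_child[of y' l a]
        by (cases "corr_word_of a l y y'") (auto simp: corrected_def)
    qed
    show "card (?f ` ?A) = card ?B"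
      unfolding card_image[OF inj] by (simp add: card_cartesian_product card_bits power_add power_mult power2_eq_square mult_ac flip: power_mult_distrib)
  qed
  then have "map_pmf ?f (pmf_of_set ?A) = pmf_of_set ?B"
    using inj bits_nonempty by (intro map_pmf_of_set_bij_betw) (auto simp: bij_betw_def finite_bits)
  moreover have "corr_word_pmf l = pmf_of_set (?L \<times> (UNIV :: bool set) \<times> (UNIV :: bool set))"
    unfolding corr_word_pmf_def uniform_bits_def pair_pmf_of_set[OF finite UNIV_not_empty finite UNIV_not_empty]
    by (rule pair_pmf_of_set) (use bits_nonempty[of l] finite_bits[of l] in auto)
  moreover have "pair_pmf (pmf_of_set (?L \<times> (UNIV :: bool set) \<times> (UNIV :: bool set))) (pmf_of_set ?L) = pmf_of_set ?B"
    by (rule pair_pmf_of_set) (use bits_nonempty[of l] finite_bits[of l] in \<open>auto intro!: finite_cartesian_product\<close>)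
  ultimately show ?thesis by (simp add: uniform_bits_def)
qed

section \<open>The assumed primitives as polynomial-time operations\<close>

locale secemb =
  fixes PRG :: "bits \<Rightarrow> bits" and \<D> :: "bits set" and G :: "bits \<Rightarrow> bits ring"
    and Convert :: "bits \<Rightarrow> bits \<Rightarrow> bits"
  assumes prg: "pseudorandom_generator PRG"
    and groups: "efficient_abelian_groups \<D> G"
    and conversion: "pseudorandom_conversion \<D> G Convert"
begin

lemma length_PRG: "length (PRG s) = 2 * length s + 2"
  using prg by (simp add: pseudorandom_generator_def)

lemma pt_PRG: "pt e A enc_bits s \<Longrightarrow> pt e A enc_bits (\<lambda>a. PRG (s a))"
  by (rule pt_comp[of _ UNIV]) (use prg in \<open>auto simp: pseudorandom_generator_def poly_time_iff_pt\<close>)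

lemma abelian: "d \<in> \<D> \<Longrightarrow> abelian_group (G d)"
  and finite_carrier: "d \<in> \<D> \<Longrightarrow> finite (carrier (G d))"
  and one_carrier: "d \<in> \<D> \<Longrightarrow> \<one>\<^bsub>G d\<^esub> \<in> carrier (G d)"
  using groups by (auto simp: efficient_abelian_groups_def)

lemma Convert_carrier: "d \<in> \<D> \<Longrightarrow> Convert d s \<in> carrier (G d)"
  using conversion by (auto simp: pseudorandom_conversion_def)

lemma pt_Convert:
  assumes "pt e A enc_bits d" "pt e A enc_bits s" "\<And>a. a \<in> A \<Longrightarrow> d a \<in> \<D>"
  shows "pt e A enc_bits (\<lambda>a. Convert (d a) (s a))"
proof -
  have "pt (enc_pair enc_bits enc_bits) (\<D> \<times> UNIV) enc_bits (\<lambda>p. Convert (fst p) (snd p))"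
    using conversion unfolding pseudorandom_conversion_def enc_bits2_eq split_beta
    by (intro poly_time_iff_pt[THEN iffD1]) blast
  from pt_comp[OF this pt_pair[OF assms(1,2)]] assms(3) show ?thesis by auto
qed

lemma pt_group_const:
  assumes "pt e A enc_bits d" "\<And>a. a \<in> A \<Longrightarrow> d a \<in> \<D>"
  shows "pt e A enc_bits (\<lambda>a. \<one>\<^bsub>G (d a)\<^esub>)" "pt e A enc_bits (\<lambda>a. \<zero>\<^bsub>G (d a)\<^esub>)"
proof -
  have "pt enc_bits \<D> enc_bits (\<lambda>d. \<one>\<^bsub>G d\<^esub>)" "pt enc_bits \<D> enc_bits (\<lambda>d. \<zero>\<^bsub>G d\<^esub>)"
    using groups unfolding efficient_abelian_groups_def
    by (intro poly_time_iff_pt[THEN iffD1]; blast)+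
  from this[THEN pt_comp, OF assms]
  show "pt e A enc_bits (\<lambda>a. \<one>\<^bsub>G (d a)\<^esub>)" "pt e A enc_bits (\<lambda>a. \<zero>\<^bsub>G (d a)\<^esub>)" by blast+
qed

text \<open>Total versions of the group operations: outside of the carrier they are unspecified but efficient.\<close>

definition gadd :: "bits \<Rightarrow> bits \<Rightarrow> bits \<Rightarrow> bits" where
  "gadd = (SOME f. pt (enc_pair enc_bits (enc_pair enc_bits enc_bits)) (\<D> \<times> UNIV \<times> UNIV) enc_bits
     (\<lambda>p. f (fst p) (fst (snd p)) (snd (snd p))) \<and>
     (\<forall>d\<in>\<D>. \<forall>x\<in>carrier (G d). \<forall>y\<in>carrier (G d). f d x y = x \<oplus>\<^bsub>G d\<^esub> y))"

definition gneg :: "bits \<Rightarrow> bits \<Rightarrow> bits" where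
  "gneg = (SOME f. pt (enc_pair enc_bits enc_bits) (\<D> \<times> UNIV) enc_bits (\<lambda>p. f (fst p) (snd p)) \<and>
     (\<forall>d\<in>\<D>. \<forall>x\<in>carrier (G d). f d x = \<ominus>\<^bsub>G d\<^esub> x))"

text \<open>Outside the carrier the assumed algorithm may return anything; \<open>bits_of\<close>
  turns every output into a bit string at polynomial cost and leaves codes of bit strings
  intact.\<close>

lemma gadd_props:
  "pt (enc_pair enc_bits (enc_pair enc_bits enc_bits)) (\<D> \<times> UNIV \<times> UNIV) enc_bits
     (\<lambda>p. gadd (fst p) (fst (snd p)) (snd (snd p))) \<and>
   (\<forall>d\<in>\<D>. \<forall>x\<in>carrier (G d). \<forall>y\<in>carrier (G d). gadd d x y = x \<oplus>\<^bsub>G d\<^esub> y)"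
proof -
  obtain add where add: "poly_time enc_bits3 (\<D> \<times> UNIV \<times> UNIV) add"
    "\<forall>d\<in>\<D>. \<forall>x\<in>carrier (G d). \<forall>y\<in>carrier (G d). add (d, x, y) = enc_bits (x \<oplus>\<^bsub>G d\<^esub> y)"
    using groups unfolding efficient_abelian_groups_def by blast
  have "pt enc_bits3 (\<D> \<times> UNIV \<times> UNIV) id add"
    using add(1) poly_time_iff_pt[of enc_bits3 "\<D> \<times> UNIV \<times> UNIV" id add] by simp
  from pt_bits_of[OF this] have "pt enc_bits3 (\<D> \<times> UNIV \<times> UNIV) enc_bits (\<lambda>p. bits_of (add p))" .
  then have "\<exists>f. pt (enc_pair enc_bits (enc_pair enc_bits enc_bits)) (\<D> \<times> UNIV \<times> UNIV) enc_bits
      (\<lambda>p. f (fst p) (fst (snd p)) (snd (snd p))) \<and>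
      (\<forall>d\<in>\<D>. \<forall>x\<in>carrier (G d). \<forall>y\<in>carrier (G d). f d x y = x \<oplus>\<^bsub>G d\<^esub> y)"
    by (intro exI[of _ "\<lambda>d x y. bits_of (add (d, x, y))"]) (use add(2) in \<open>simp add: enc_bits3_eq\<close>)
  from someI_ex[OF this] show ?thesis unfolding gadd_def .
qed

lemma gneg_props:
  "pt (enc_pair enc_bits enc_bits) (\<D> \<times> UNIV) enc_bits (\<lambda>p. gneg (fst p) (snd p)) \<and>
     (\<forall>d\<in>\<D>. \<forall>x\<in>carrier (G d). gneg d x = \<ominus>\<^bsub>G d\<^esub> x)"
proof -
  obtain neg where neg: "poly_time enc_bits2 (\<D> \<times> UNIV) neg"
    "\<forall>d\<in>\<D>. \<forall>x\<in>carrier (G d). neg (d, x) = enc_bits (\<ominus>\<^bsub>G d\<^esub> x)"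
    using groups unfolding efficient_abelian_groups_def by blast
  have "pt enc_bits2 (\<D> \<times> UNIV) id neg"
    using neg(1) poly_time_iff_pt[of enc_bits2 "\<D> \<times> UNIV" id neg] by simp
  from pt_bits_of[OF this] have "pt enc_bits2 (\<D> \<times> UNIV) enc_bits (\<lambda>p. bits_of (neg p))" .
  then have "\<exists>f. pt (enc_pair enc_bits enc_bits) (\<D> \<times> UNIV) enc_bits (\<lambda>p. f (fst p) (snd p)) \<and>
      (\<forall>d\<in>\<D>. \<forall>x\<in>carrier (G d). f d x = \<ominus>\<^bsub>G d\<^esub> x)"
    by (intro exI[of _ "\<lambda>d x. bits_of (neg (d, x))"]) (use neg(2) in \<open>simp add: enc_bits2_eq\<close>)
  from someI_ex[OF this] show ?thesis unfolding gneg_def .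
qed

lemma gadd_eq: "d \<in> \<D> \<Longrightarrow> x \<in> carrier (G d) \<Longrightarrow> y \<in> carrier (G d) \<Longrightarrow> gadd d x y = x \<oplus>\<^bsub>G d\<^esub> y"
  using gadd_props by blast

lemma gneg_eq: "d \<in> \<D> \<Longrightarrow> x \<in> carrier (G d) \<Longrightarrow> gneg d x = \<ominus>\<^bsub>G d\<^esub> x"
  using gneg_props by blast

lemma pt_gadd:
  assumes "pt e A enc_bits d" "pt e A enc_bits x" "pt e A enc_bits y" "\<And>a. a \<in> A \<Longrightarrow> d a \<in> \<D>"
  shows "pt e A enc_bits (\<lambda>a. gadd (d a) (x a) (y a))"
  using pt_comp[OF conjunct1[OF gadd_props] pt_pair[OF assms(1) pt_pair[OF assms(2,3)]]] assms(4) by auto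

lemma pt_gneg:
  assumes "pt e A enc_bits d" "pt e A enc_bits x" "\<And>a. a \<in> A \<Longrightarrow> d a \<in> \<D>"
  shows "pt e A enc_bits (\<lambda>a. gneg (d a) (x a))"
  using pt_comp[OF conjunct1[OF gneg_props] pt_pair[OF assms(1,2)]] assms(3) by auto

definition gsigned :: "bits \<Rightarrow> bool \<Rightarrow> bits \<Rightarrow> bits" where
  "gsigned d t x = (if t then gneg d x else x)"

lemma pt_gsigned:
  assumes "pt e A enc_bits d" "pt e A enc_bool t" "pt e A enc_bits x" "\<And>a. a \<in> A \<Longrightarrow> d a \<in> \<D>"
  shows "pt e A enc_bits (\<lambda>a. gsigned (d a) (t a) (x a))"
  unfolding gsigned_def by (intro pt_if_total pt_gneg assms)

lemma gsigned_eq: "d \<in> \<D> \<Longrightarrow> x \<in> carrier (G d) \<Longrightarrow> gsigned d t x = signed (G d) t x"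
  by (simp add: gsigned_def signed_def gneg_eq)

section \<open>Generation steps and evaluation along a path\<close>

lemma gen_step_eq:
  "length s0 = length s1 \<Longrightarrow> fss_gen_step PRG a ((s0, t0), (s1, t1)) =
    (let cw = corr_word_of a (length s0) (PRG s0) (PRG s1)
     in (cw, corrected a cw t0 (keep_child a (length s0) (PRG s0)), corrected a cw t1 (keep_child a (length s0) (PRG s1))))"
  by (cases a) (auto simp: fss_gen_step_def corr_word_of_def keep_child_def split_children_def corrected_def Let_def)

definition eval_step :: "bool \<Rightarrow> node \<Rightarrow> corr_word \<Rightarrow> node" where
  "eval_step a st cw = corrected a cw (snd st) (keep_child a (length (fst st)) (PRG (fst st)))"

text \<open>Evaluation as a loop, suited to \<open>pt_fold\<close>. Since \<open>zip\<close>
  truncates, evaluating the full path with only i correction words stops at depth i; the hybrids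
  rely on this.\<close>

definition eval_path :: "bits \<Rightarrow> corr_word list \<Rightarrow> node \<Rightarrow> node" where
  "eval_path xs cws = fold (\<lambda>p st. eval_step (fst p) st (snd p)) (zip xs cws)"

lemma length_eval_step: "length (fst cw) = length (fst st) \<Longrightarrow> length (fst (eval_step a st cw)) = length (fst st)"
  by (simp add: eval_step_def corrected_def length_keep_child length_PRG)

lemma length_eval_path:
  assumes "\<forall>cw\<in>set cws. length (fst cw) = length (fst st)"
  shows "length (fst (eval_path xs cws st)) = length (fst st)"
  using assms unfolding eval_path_def
  by (induction xs cws arbitrary: st rule: list_induct2') (auto simp: length_eval_step)

text \<open>The blocks of the correction string and of the PRG output have the same lengths l, 1, l,
  1, so correcting the whole output and correcting the chosen child agree.\<close>

lemma split_children_xors: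
  assumes "length y = 2 * l + 2" "length c = l"
  shows "(if a then snd (split_children l (y xors scale t (c @ [tL] @ c @ [tR])))
          else fst (split_children l (y xors scale t (c @ [tL] @ c @ [tR])))) =
         corrected a (c, tL, tR) t (keep_child a l y)"
  using assms
  by (auto simp: split_children_def corrected_def keep_child_def take_xors drop_xors nth_xors scale_append
      nth_append scale_def min_def xorb_def)

lemma fss_eval_path_eq:
  assumes "length cws = length xs" "\<forall>cw\<in>set cws. length (fst cw) = length (fst st)"
  shows "fss_eval_path PRG cws xs st = eval_path xs cws st"
  using assms
proof (induction cws xs arbitrary: st rule: list_induct2)
  case (Cons cw cws x xs)
  obtain s t c tL tR where st: "st = (s, t)" and cw: "cw = (c, tL, tR)" by (cases st; cases cw) auto
  have len: "length c = length s" using Cons.prems st cw by simp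
  have "fss_eval_path PRG (cw # cws) (x # xs) st = fss_eval_path PRG cws xs (eval_step x st cw)"
    using split_children_xors[of "PRG s" "length s" c x t tL tR] len
    by (cases x) (simp_all add: st cw length_PRG eval_step_def split_beta Let_def)
  also have "\<dots> = eval_path xs cws (eval_step x st cw)"
    using Cons.prems len by (intro Cons.IH) (auto simp: length_eval_step st cw)
  finally show ?case by (simp add: eval_path_def)
qed (simp add: eval_path_def)

lemma pt_eval_step:
  assumes "pt e A enc_bool a" "pt e A enc_node st" "pt e A enc_corr_word cw"
  shows "pt e A enc_node (\<lambda>x. eval_step (a x) (st x) (cw x))"
  unfolding eval_step_def
  by (intro pt_corrected pt_keep_child pt_snd[OF assms(2)] pt_length[OF pt_fst[OF assms(2)]] pt_PRG pt_fst[OF assms(2)] assms)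
    (simp add: length_PRG)

text \<open>Seeds keep the length of the root, because the correction words have this length as
  well; this bounds the state of the loop.\<close>

lemma pt_eval_path:
  assumes "pt e A enc_bits xs" "pt e A (enc_list enc_corr_word) cws" "pt e A enc_node st"
    "\<And>a cw. a \<in> A \<Longrightarrow> cw \<in> set (cws a) \<Longrightarrow> length (fst cw) = length (fst (st a))"
  shows "pt e A enc_node (\<lambda>a. eval_path (xs a) (cws a) (st a))"
proof -
  let ?e = "enc_pair enc_bits (enc_pair (enc_list enc_corr_word) enc_node)"
  let ?A = "{(xs :: bits, cws, st :: node). \<forall>cw\<in>set cws. length (fst cw) = length (fst st)} :: (bits \<times> corr_word list \<times> node) set"
  have "pt ?e ?A enc_node (\<lambda>p. fold (\<lambda>q st. eval_step (fst q) st (snd q)) (zip (fst p) (fst (snd p))) (snd (snd p)))"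
  proof (rule pt_fold[where g = "\<lambda>n. Suc (2 * n + 1)"])
    show "pt (enc_pair ?e (enc_pair (enc_pair enc_bool enc_corr_word) enc_node))
     {(a, x, s). a \<in> ?A \<and> (\<exists>i<length (zip (fst a) (fst (snd a))). x = zip (fst a) (fst (snd a)) ! i \<and>
          s = fold (\<lambda>q st. eval_step (fst q) st (snd q)) (take i (zip (fst a) (fst (snd a)))) (snd (snd a)))}
     enc_node (\<lambda>y. eval_step (fst (fst (snd y))) (snd (snd y)) (snd (fst (snd y))))"
      by (rule pt_eval_step; (rule pt_intros)+)
    fix a i assume a: "a \<in> ?A"
    obtain us ws s t where [simp]: "a = (us, ws, (s, t))" by (cases a) auto
    have "length (fst (eval_path (take i us) (take i ws) (s, t))) = length s"
      using a by (subst length_eval_path) (auto dest: in_set_takeD)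
    then show "size (enc_node (fold (\<lambda>q st. eval_step (fst q) st (snd q)) (take i (zip (fst a) (fst (snd a)))) (snd (snd a))))
        \<le> Suc (2 * size (?e a) + 1)"
      using size_enc_bits[of "fst (eval_path (take i us) (take i ws) (s, t))"]
        size_enc_bool[of "snd (eval_path (take i us) (take i ws) (s, t))"] length_le_size_enc_list[of s enc_bool]
      by (cases "eval_path (take i us) (take i ws) (s, t)") (simp add: eval_path_def take_zip)
  qed (rule pt_intros pb_intros)+
  from pt_comp[OF this pt_pair[OF assms(1) pt_pair[OF assms(2,3)]]] assms(4) show ?thesis
    by (auto simp: eval_path_def)
qed

end

section \<open>Keys of a single point function\<close>

context secemb
begin

lemma gen_path_Cons:
  "fss_gen_path PRG (a # as) st =
    (fst (fss_gen_step PRG a st) # fst (fss_gen_path PRG as (snd (fss_gen_step PRG a st))),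
     snd (fss_gen_path PRG as (snd (fss_gen_step PRG a st))))"
  by (simp add: Let_def split_beta)

lemma length_gen_step:
  assumes "length (fst (fst st)) = l" "length (fst (snd st)) = l"
  shows "length (fst (fst (fss_gen_step PRG a st))) = l"
    and "length (fst (fst (snd (fss_gen_step PRG a st)))) = l"
    and "length (fst (snd (snd (fss_gen_step PRG a st)))) = l"
proof -
  obtain s0 t0 s1 t1 where st: "st = ((s0, t0), (s1, t1))" by (cases st) auto
  show "length (fst (fst (fss_gen_step PRG a st))) = l"
    and "length (fst (fst (snd (fss_gen_step PRG a st)))) = l"
    and "length (fst (snd (snd (fss_gen_step PRG a st)))) = l"
    using assms unfolding st by (simp_all add: gen_step_eq Let_def corrected_def length_corr_word_of length_keep_child length_PRG)
qed

lemma length_gen_path: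
  assumes "length (fst (fst st)) = l" "length (fst (snd st)) = l"
  shows "length (fst (fss_gen_path PRG as st)) = length as \<and>
    (\<forall>cw\<in>set (fst (fss_gen_path PRG as st)). length (fst cw) = l) \<and>
    length (fst (fst (snd (fss_gen_path PRG as st)))) = l \<and> length (fst (snd (snd (fss_gen_path PRG as st)))) = l"
  using assms
proof (induction as arbitrary: st)
  case (Cons a as)
  note IH = Cons.IH[OF length_gen_step(2,3)[OF Cons.prems, of a]]
  show ?case unfolding gen_path_Cons using IH length_gen_step(1)[OF Cons.prems, of a] by simp
qed simp

lemma pt_gen_step:
  assumes "pt e A enc_bool b" "pt e A (enc_pair enc_node enc_node) st"
    "\<And>a. a \<in> A \<Longrightarrow> length (fst (fst (st a))) = length (fst (snd (st a)))"
  shows "pt e A (enc_pair enc_corr_word (enc_pair enc_node enc_node)) (\<lambda>a. fss_gen_step PRG (b a) (st a))"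
proof (rule pt_cong)
  let ?l = "\<lambda>a. length (fst (fst (st a)))"
  let ?y0 = "\<lambda>a. PRG (fst (fst (st a)))" and ?y1 = "\<lambda>a. PRG (fst (snd (st a)))"
  let ?cw = "\<lambda>a. corr_word_of (b a) (?l a) (?y0 a) (?y1 a)"
  note st = pt_fst[OF assms(2)] pt_snd[OF assms(2)]
  have l: "pt e A unary ?l" and y: "pt e A enc_bits ?y0" "pt e A enc_bits ?y1"
    by (rule st pt_length pt_PRG pt_fst)+
  have cw: "pt e A enc_corr_word ?cw"
    by (rule pt_corr_word_of[OF assms(1) l y]) (simp_all add: length_PRG assms(3))
  show "pt e A (enc_pair enc_corr_word (enc_pair enc_node enc_node))
    (\<lambda>a. (?cw a, corrected (b a) (?cw a) (snd (fst (st a))) (keep_child (b a) (?l a) (?y0 a)),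
      corrected (b a) (?cw a) (snd (snd (st a))) (keep_child (b a) (?l a) (?y1 a))))"
    by (intro pt_pair cw pt_corrected pt_keep_child assms(1) l y pt_snd[OF st(1)] pt_snd[OF st(2)])
      (simp_all add: length_PRG assms(3))
  fix a assume "a \<in> A"
  then show "(?cw a, corrected (b a) (?cw a) (snd (fst (st a))) (keep_child (b a) (?l a) (?y0 a)),
      corrected (b a) (?cw a) (snd (snd (st a))) (keep_child (b a) (?l a) (?y1 a))) = fss_gen_step PRG (b a) (st a)"
    using gen_step_eq[of "fst (fst (st a))" "fst (snd (st a))" "b a" "snd (fst (st a))" "snd (snd (st a))"] assms(3)
    by (simp add: Let_def)
qed

lemma pt_gen_path:
  assumes "pt e A enc_bits \<alpha>" "pt e A (enc_pair enc_node enc_node) st"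
    "\<And>a. a \<in> A \<Longrightarrow> length (fst (fst (st a))) = length (fst (snd (st a)))"
  shows "pt e A (enc_pair (enc_list enc_corr_word) (enc_pair enc_node enc_node)) (\<lambda>a. fss_gen_path PRG (\<alpha> a) (st a))"
proof -
  define f where "f a \<sigma> = (fst \<sigma> @ [fst (fss_gen_step PRG a (snd \<sigma>))], snd (fss_gen_step PRG a (snd \<sigma>)))"
    for a and \<sigma> :: "corr_word list \<times> node \<times> node"
  have f: "fold f as (acc, \<sigma>) = (acc @ fst (fss_gen_path PRG as \<sigma>), snd (fss_gen_path PRG as \<sigma>))" for as acc \<sigma>
    by (induction as arbitrary: acc \<sigma>) (simp_all add: f_def gen_path_Cons del: fss_gen_path.simps(2))
  let ?e = "enc_pair enc_bits (enc_pair enc_node enc_node)"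
  let ?e' = "enc_pair (enc_list enc_corr_word) (enc_pair enc_node enc_node)"
  let ?A = "{(as, st). length (fst (fst st)) = length (fst (snd st))} :: (bits \<times> node \<times> node) set"
  have "pt ?e ?A ?e' (\<lambda>p. fold f (fst p) ([], snd p))"
  \<comment> \<open>The state holds at most n correction words of size at most 2 * n + 4 each, and
    two nodes of size at most 2 * n + 2.\<close>
  proof (rule pt_fold[where g = "\<lambda>n. n * Suc (2 * n + 4) + (4 * n + 10)"])
    let ?D = "{(a, x, s). a \<in> ?A \<and> (\<exists>i<length (fst a). x = fst a ! i \<and> s = fold f (take i (fst a)) ([], snd a))}"
    have "pt (enc_pair ?e (enc_pair enc_bool ?e')) ?D (enc_pair enc_corr_word (enc_pair enc_node enc_node))
        (\<lambda>y. fss_gen_step PRG (fst (snd y)) (snd (snd (snd y))))"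
    proof (rule pt_gen_step)
      fix y assume "y \<in> ?D"
      then obtain as st x i where y: "y = ((as, st), x, fold f (take i as) ([], st))"
        and st: "length (fst (fst st)) = length (fst (snd st))" by auto
      from length_gen_path[OF refl st[symmetric], of "take i as"]
      show "length (fst (fst (snd (snd (snd y))))) = length (fst (snd (snd (snd (snd y)))))"
        unfolding y by (simp only: f fst_conv snd_conv)
    qed (rule pt_intros)+
    then show "pt (enc_pair ?e (enc_pair enc_bool ?e')) ?D ?e' (\<lambda>y. f (fst (snd y)) (snd (snd y)))"
      unfolding f_def by - (rule pt_intros | assumption)+
    fix a i assume a: "a \<in> ?A"
    obtain as s0 t0 s1 t1 where [simp]: "a = (as, ((s0, t0), (s1, t1)))" by (cases a) auto
    let ?r = "fss_gen_path PRG (take i as) ((s0, t0), (s1, t1))"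
    obtain cws n0 n1 where r: "?r = (cws, (n0, n1))" by (cases ?r) auto
    have len: "length cws \<le> length as" "\<forall>cw\<in>set cws. length (fst cw) = length s0"
      "length (fst n0) = length s0" "length (fst n1) = length s0"
      using length_gen_path[of "((s0, t0), (s1, t1))" "length s0" "take i as"] a r by auto
    let ?n = "size (?e a)"
    have n: "length as \<le> ?n" "length s0 \<le> ?n"
      using length_le_size_enc_list[of as enc_bool] length_le_size_enc_list[of s0 enc_bool] by simp_all
    have "size (enc_list enc_corr_word cws) \<le> ?n * Suc (2 * ?n + 4)"
    proof (rule size_enc_list_le)
      fix cw assume "cw \<in> set cws"
      then show "size (enc_corr_word cw) \<le> 2 * ?n + 4" using len(2) size_enc_corr_word[of cw] n(2) by simp
    qed (use len n in simp)
    moreover have "size (enc_node m) \<le> 2 * length (fst m) + 2" for m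
      using size_enc_bits[of "fst m"] size_enc_bool[of "snd m"] by (cases m) simp
    from this[of n0] this[of n1] have "size (enc_node n0) + size (enc_node n1) \<le> 4 * ?n + 4"
      using n(2) len(3,4) by linarith
    ultimately show "size (?e' (fold f (take i (fst a)) ([], snd a))) \<le> ?n * Suc (2 * ?n + 4) + (4 * ?n + 10)"
      by (simp add: f r)
  qed (rule pt_intros pb_intros)+
  from pt_comp[OF this pt_pair[OF assms(1,2)]] assms(3) show ?thesis by (simp add: f)
qed

definition last_word :: "bits \<Rightarrow> node \<Rightarrow> node \<Rightarrow> bits" where
  "last_word d n0 n1 = gsigned d (snd n1)
     (gadd d (gadd d \<one>\<^bsub>G d\<^esub> (gneg d (Convert d (fst n0)))) (Convert d (fst n1)))"

lemma last_word_eq: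
  "d \<in> \<D> \<Longrightarrow> last_word d (s0, t0) (s1, t1) = signed (G d) t1 ((\<one>\<^bsub>G d\<^esub> \<ominus>\<^bsub>G d\<^esub> Convert d s0) \<oplus>\<^bsub>G d\<^esub> Convert d s1)"
  unfolding last_word_def using abelian_group.a_inv_closed[OF abelian] abelian_group.minus_closed[OF abelian]
    abelian_monoid.a_closed[OF abelian_group.axioms(1)[OF abelian]]
  by (simp add: gsigned_eq gadd_eq gneg_eq one_carrier Convert_carrier a_minus_def)

lemma pt_last_word:
  assumes "pt e A enc_bits d" "pt e A enc_node n0" "pt e A enc_node n1" "\<And>a. a \<in> A \<Longrightarrow> d a \<in> \<D>"
  shows "pt e A enc_bits (\<lambda>a. last_word (d a) (n0 a) (n1 a))"
  unfolding last_word_def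
  by (intro pt_gsigned pt_gadd pt_gneg pt_Convert pt_group_const assms pt_snd[OF assms(3)] pt_fst[OF assms(2)] pt_fst[OF assms(3)])

text \<open>
  The key of party \<open>b\<close> with root \<open>r0\<close>, when the correction words \<open>cws\<close> have already been fixed, the
  parties have arrived at the nodes \<open>own\<close> and \<open>other\<close>, and \<open>\<alpha>\<close> is the remaining path.
\<close>

definition continue_key :: "bool \<Rightarrow> bits \<Rightarrow> node \<Rightarrow> corr_word list \<Rightarrow> node \<Rightarrow> node \<Rightarrow> bits \<Rightarrow> fss_key" where
  "continue_key b d r0 cws own other \<alpha> =
     (let r = fss_gen_path PRG \<alpha> (if b then (other, own) else (own, other))
      in (fst r0, snd r0, cws @ fst r, last_word d (fst (snd r)) (snd (snd r))))"

lemma pt_continue_key: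
  assumes "pt e A enc_bool b" "pt e A enc_bits d" "pt e A enc_node r0" "pt e A (enc_list enc_corr_word) cws"
    "pt e A enc_node own" "pt e A enc_node other" "pt e A enc_bits \<alpha>"
    "\<And>a. a \<in> A \<Longrightarrow> d a \<in> \<D> \<and> length (fst (own a)) = length (fst (other a))"
  shows "pt e A enc_key (\<lambda>a. continue_key (b a) (d a) (r0 a) (cws a) (own a) (other a) (\<alpha> a))"
proof -
  let ?r = "\<lambda>a. fss_gen_path PRG (\<alpha> a) (if b a then (other a, own a) else (own a, other a))"
  have r: "pt e A (enc_pair (enc_list enc_corr_word) (enc_pair enc_node enc_node)) ?r"
    by (intro pt_gen_path assms pt_if_total pt_pair) (use assms(8) in auto)
  show ?thesis unfolding continue_key_def Let_def enc_key_eq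
    by (rule pt_pair pt_fst[OF assms(3)] pt_snd[OF assms(3)] pt_append assms(4) pt_last_word[OF assms(2)]
        pt_fst[OF r] pt_fst[OF pt_snd[OF r]] pt_snd[OF pt_snd[OF r]] | simp add: assms(8))+
qed

definition party_key :: "bool \<Rightarrow> bits \<Rightarrow> bits \<Rightarrow> fss_coins \<Rightarrow> fss_key" where
  "party_key b d \<alpha> coins = (if b then snd else fst) (fss_gen PRG (G d) (Convert d) \<alpha> \<one>\<^bsub>G d\<^esub> coins)"

lemma party_key_eq:
  assumes "d \<in> \<D>"
  shows "party_key b d \<alpha> (s0, s1, t0) =
    (let own = (if b then (s1, \<not> t0) else (s0, t0)); other = (if b then (s0, t0) else (s1, \<not> t0))
     in continue_key b d own [] own other \<alpha>)"
proof -
  obtain cws n0 n1 where r: "fss_gen_path PRG \<alpha> ((s0, t0), (s1, \<not> t0)) = (cws, (n0, n1))"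
    by (cases "fss_gen_path PRG \<alpha> ((s0, t0), (s1, \<not> t0))") auto
  have "t0 xorb True = (\<not> t0)" by (simp add: xorb_def)
  then show ?thesis using last_word_eq[OF assms, of "fst n0" "snd n0" "fst n1" "snd n1"]
    by (cases b) (simp_all add: party_key_def fss_gen_def continue_key_def r split_beta Let_def)
qed

section \<open>Hybrids over the levels of the tree\<close>

definition real_key :: "nat \<Rightarrow> bool \<Rightarrow> bits \<Rightarrow> bits \<Rightarrow> fss_key pmf" where
  "real_key l b d \<alpha> = map_pmf (party_key b d \<alpha>) (fss_coins l)"

definition prefix_pmf :: "nat \<Rightarrow> nat \<Rightarrow> (node \<times> corr_word list) pmf" where
  "prefix_pmf l i = pair_pmf (pair_pmf (uniform_bits l) (pmf_of_set UNIV)) (replicate_pmf i (corr_word_pmf l))"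

lemma set_prefix_pmf:
  "set_pmf (prefix_pmf l i) = {(r0, cws). length (fst r0) = l \<and> length cws = i \<and> (\<forall>cw\<in>set cws. length (fst cw) = l)}"
  by (auto simp: prefix_pmf_def set_replicate_pmf set_corr_word_pmf lists_eq_set)

text \<open>Neither the point nor the party enters. The last word is a converted seed, since a
  uniform element of the carrier need not be efficiently samplable.\<close>

definition sim_key :: "nat \<Rightarrow> bits \<Rightarrow> nat \<Rightarrow> fss_key pmf" where
  "sim_key l d n = bind_pmf (prefix_pmf l n) (\<lambda>(r0, cws).
     map_pmf (\<lambda>w. (fst r0, snd r0, cws, Convert d w)) (uniform_bits l))"

text \<open>In the \<open>i\<close>-th hybrid, the first \<open>i\<close> correction words and the next seed of the other party are uniform.\<close>

definition hybrid_key :: "nat \<Rightarrow> bool \<Rightarrow> bits \<Rightarrow> bits \<Rightarrow> nat \<Rightarrow> fss_key pmf" where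
  "hybrid_key l b d \<alpha> i = bind_pmf (prefix_pmf l i) (\<lambda>r.
     let own = eval_path \<alpha> (snd r) (fst r)
     in map_pmf (\<lambda>s. continue_key b d (fst r) (snd r) own (s, \<not> snd own) (drop i \<alpha>)) (uniform_bits l))"

lemma map_Not_coin: "map_pmf Not (pmf_of_set UNIV) = pmf_of_set UNIV"
  by (rule map_pmf_of_set_bij_betw) (auto simp: bij_betw_def inj_on_def)

text \<open>Before the first level both roots are as in the protocol; only the order of sampling and
  the choice of the coin differ.\<close>

lemma real_key_eq_hybrid: "d \<in> \<D> \<Longrightarrow> real_key l b d \<alpha> = hybrid_key l b d \<alpha> 0"
proof (cases b)
  case False
  assume d: "d \<in> \<D>"
  have "hybrid_key l b d \<alpha> 0 = bind_pmf (uniform_bits l) (\<lambda>s0. bind_pmf (pmf_of_set UNIV) (\<lambda>t0.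
      bind_pmf (uniform_bits l) (\<lambda>s1. return_pmf (continue_key b d (s0, t0) [] (s0, t0) (s1, \<not> t0) \<alpha>))))"
    by (simp add: hybrid_key_def prefix_pmf_def pair_pmf_def bind_assoc_pmf bind_return_pmf eval_path_def Let_def
        map_pmf_def)
  also have "\<dots> = bind_pmf (uniform_bits l) (\<lambda>s0. bind_pmf (uniform_bits l) (\<lambda>s1.
      bind_pmf (pmf_of_set UNIV) (\<lambda>t0. return_pmf (continue_key b d (s0, t0) [] (s0, t0) (s1, \<not> t0) \<alpha>))))"
    by (subst bind_commute_pmf[of "pmf_of_set UNIV"]) (rule refl)
  finally show ?thesis using False d
    by (simp add: real_key_def fss_coins_def party_key_eq map_bind_pmf Let_def)
next
  case True
  assume d: "d \<in> \<D>"
  \<comment> \<open>Party 1 holds the negated coin. Negation preserves the uniform law, so its own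
    bit may be sampled first and the coin of the protocol recovered as the complement.\<close>
  have "hybrid_key l b d \<alpha> 0 = bind_pmf (uniform_bits l) (\<lambda>s1. bind_pmf (map_pmf Not (pmf_of_set UNIV)) (\<lambda>t1.
      bind_pmf (uniform_bits l) (\<lambda>s0. return_pmf (continue_key b d (s1, t1) [] (s1, t1) (s0, \<not> t1) \<alpha>))))"
    unfolding map_Not_coin
    by (simp add: hybrid_key_def prefix_pmf_def pair_pmf_def bind_assoc_pmf bind_return_pmf eval_path_def Let_def
        map_pmf_def)
  also have "\<dots> = bind_pmf (uniform_bits l) (\<lambda>s1. bind_pmf (uniform_bits l) (\<lambda>s0.
      bind_pmf (pmf_of_set UNIV) (\<lambda>t0. return_pmf (continue_key b d (s1, \<not> t0) [] (s1, \<not> t0) (s0, t0) \<alpha>))))"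
    by (simp only: bind_map_pmf not_not bind_commute_pmf[of "pmf_of_set UNIV" "uniform_bits l"])
  also have "\<dots> = bind_pmf (uniform_bits l) (\<lambda>s0. bind_pmf (uniform_bits l) (\<lambda>s1.
      bind_pmf (pmf_of_set UNIV) (\<lambda>t0. return_pmf (continue_key b d (s1, \<not> t0) [] (s1, \<not> t0) (s0, t0) \<alpha>))))"
    by (rule bind_commute_pmf)
  finally show ?thesis using True d
    by (simp add: real_key_def fss_coins_def party_key_eq map_bind_pmf Let_def)
qed

text \<open>One level of generation with the PRG output \<open>y\<close> of the other party as a
  parameter: \<open>PRG s\<close> gives one hybrid and a uniform \<open>y\<close> the next.\<close>

definition hop_key :: "bool \<Rightarrow> bits \<Rightarrow> node \<Rightarrow> corr_word list \<Rightarrow> node \<Rightarrow> bool \<Rightarrow> bits \<Rightarrow> bits \<Rightarrow> fss_key" where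
  "hop_key b d r0 cws own a as y =
     (let l = length (fst own); y' = PRG (fst own); cw = corr_word_of a l y' y
      in continue_key b d r0 (cws @ [cw]) (corrected a cw (snd own) (keep_child a l y'))
           (corrected a cw (\<not> snd own) (keep_child a l y)) as)"

text \<open>For party 1 the two PRG outputs enter in the opposite order; the symmetry of the
  correction word removes the difference.\<close>

lemma continue_key_Cons:
  assumes "length s = length (fst own)"
  shows "continue_key b d r0 cws own (s, \<not> snd own) (a # as) = hop_key b d r0 cws own a as (PRG s)"
proof -
  obtain s' t where own: "own = (s', t)" by (cases own)
  show ?thesis
    using assms unfolding own
    by (cases b) (simp_all add: continue_key_def hop_key_def gen_path_Cons gen_step_eq Let_def
        corr_word_of_commute[of a _ "PRG s" "PRG s'"] del: fss_gen_path.simps(2))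
qed

lemma eval_path_snoc:
  assumes "length cws < length \<alpha>"
  shows "eval_path \<alpha> (cws @ [cw]) st = eval_step (\<alpha> ! length cws) (eval_path \<alpha> cws st) cw"
proof -
  have \<alpha>: "\<alpha> = take (length cws) \<alpha> @ \<alpha> ! length cws # drop (Suc (length cws)) \<alpha>"
    using assms by (rule id_take_nth_drop)
  have "zip \<alpha> (cws @ [cw]) = zip \<alpha> cws @ [(\<alpha> ! length cws, cw)]"
    by (subst (1 2) \<alpha>) (use assms in \<open>simp add: zip_append1 zip_append2\<close>)
  then show ?thesis by (simp add: eval_path_def)
qed

text \<open>By \<open>corr_word_uniform\<close>, a uniform \<open>y\<close> yields an independent
  uniform pair of correction word and next seed. The remaining data, namely the own node and the
  complementary control bit, are functions of the word.\<close>

lemma hop_key_uniform: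
  assumes "length (fst own) = l"
  shows "map_pmf (hop_key b d r0 cws own a as) (uniform_bits (2 * (l + 1))) =
    bind_pmf (corr_word_pmf l) (\<lambda>cw. map_pmf (\<lambda>s. continue_key b d r0 (cws @ [cw]) (eval_step a own cw)
      (s, \<not> snd (eval_step a own cw)) as) (uniform_bits l))"
proof -
  let ?y = "PRG (fst own)"
  let ?k = "\<lambda>(cw, s). continue_key b d r0 (cws @ [cw]) (eval_step a own cw) (s, \<not> snd (eval_step a own cw)) as"
  let ?f = "\<lambda>y'. (corr_word_of a l ?y y', fst (corrected a (corr_word_of a l ?y y') (\<not> snd own) (keep_child a l y')))"
  have "hop_key b d r0 cws own a as y' = ?k (?f y')" for y'
    by (simp only: hop_key_def Let_def eval_step_def case_prod_conv assms prod.collapse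
        corrected_bits_differ[of a l ?y y' "snd own", symmetric])
  then have "map_pmf (hop_key b d r0 cws own a as) (uniform_bits (2 * (l + 1))) =
      map_pmf ?k (map_pmf ?f (uniform_bits (2 * (l + 1))))"
    unfolding pmf.map_comp by (intro map_pmf_cong) auto
  also have "\<dots> = map_pmf ?k (pair_pmf (corr_word_pmf l) (uniform_bits l))"
    by (subst corr_word_uniform) (simp_all add: length_PRG assms)
  also have "\<dots> = bind_pmf (corr_word_pmf l) (\<lambda>cw. map_pmf (\<lambda>s. ?k (cw, s)) (uniform_bits l))"
    by (simp add: pair_pmf_def map_bind_pmf) (simp add: map_pmf_def)
  finally show ?thesis by simp
qed

lemma replicate_pmf_snoc:
  "replicate_pmf (Suc n) p = bind_pmf (replicate_pmf n p) (\<lambda>xs. map_pmf (\<lambda>x. xs @ [x]) p)"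
  using replicate_pmf_distrib[of n 1 p] by (simp add: replicate_pmf_1[unfolded One_nat_def] bind_assoc_pmf bind_return_pmf map_pmf_def del: replicate_pmf.simps)

text \<open>Neighbouring hybrids become the same function of a PRG output, averaged over the same
  prefix; they differ only in the law of that output.\<close>

lemma hybrid_key_expand:
  assumes "i < length \<alpha>"
  shows "hybrid_key l b d \<alpha> i = bind_pmf (prefix_pmf l i) (\<lambda>r. map_pmf (hop_key b d (fst r) (snd r)
      (eval_path \<alpha> (snd r) (fst r)) (\<alpha> ! i) (drop (Suc i) \<alpha>)) (map_pmf PRG (uniform_bits l)))" (is "_ = ?R")
    and "hybrid_key l b d \<alpha> (Suc i) = bind_pmf (prefix_pmf l i) (\<lambda>r. map_pmf (hop_key b d (fst r) (snd r)
      (eval_path \<alpha> (snd r) (fst r)) (\<alpha> ! i) (drop (Suc i) \<alpha>)) (uniform_bits (2 * (l + 1))))" (is "_ = ?S")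
proof -
  have own: "length (fst (eval_path \<alpha> (snd r) (fst r))) = l" if "r \<in> set_pmf (prefix_pmf l i)" for r
    using that by (auto simp: set_prefix_pmf length_eval_path)
  show "hybrid_key l b d \<alpha> i = ?R"
    unfolding hybrid_key_def Let_def pmf.map_comp
  proof (intro bind_pmf_cong refl map_pmf_cong)
    fix r s assume r: "r \<in> set_pmf (prefix_pmf l i)" and s: "s \<in> set_pmf (uniform_bits l)"
    show "continue_key b d (fst r) (snd r) (eval_path \<alpha> (snd r) (fst r)) (s, \<not> snd (eval_path \<alpha> (snd r) (fst r))) (drop i \<alpha>) =
      (hop_key b d (fst r) (snd r) (eval_path \<alpha> (snd r) (fst r)) (\<alpha> ! i) (drop (Suc i) \<alpha>) \<circ> PRG) s"
      using continue_key_Cons[of s "eval_path \<alpha> (snd r) (fst r)" b d "fst r" "snd r" "\<alpha> ! i" "drop (Suc i) \<alpha>"]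
        own[OF r] s assms by (simp add: Cons_nth_drop_Suc)
  qed
  have "hybrid_key l b d \<alpha> (Suc i) = bind_pmf (prefix_pmf l i) (\<lambda>r. bind_pmf (corr_word_pmf l) (\<lambda>cw.
      map_pmf (\<lambda>s. continue_key b d (fst r) (snd r @ [cw]) (eval_path \<alpha> (snd r @ [cw]) (fst r))
        (s, \<not> snd (eval_path \<alpha> (snd r @ [cw]) (fst r))) (drop (Suc i) \<alpha>)) (uniform_bits l)))"
    by (simp add: hybrid_key_def prefix_pmf_def replicate_pmf_snoc pair_pmf_def bind_assoc_pmf bind_return_pmf
        bind_map_pmf Let_def del: replicate_pmf.simps)
  also have "\<dots> = ?S"
  proof (intro bind_pmf_cong refl)
    fix r assume r: "r \<in> set_pmf (prefix_pmf l i)"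
    then have "length (snd r) = i" by (auto simp: set_prefix_pmf)
    then show "bind_pmf (corr_word_pmf l) (\<lambda>cw.
      map_pmf (\<lambda>s. continue_key b d (fst r) (snd r @ [cw]) (eval_path \<alpha> (snd r @ [cw]) (fst r))
        (s, \<not> snd (eval_path \<alpha> (snd r @ [cw]) (fst r))) (drop (Suc i) \<alpha>)) (uniform_bits l)) =
      map_pmf (hop_key b d (fst r) (snd r) (eval_path \<alpha> (snd r) (fst r)) (\<alpha> ! i) (drop (Suc i) \<alpha>)) (uniform_bits (2 * (l + 1)))"
      using assms by (simp only: hop_key_uniform[OF own[OF r]] eval_path_snoc)
  qed
  finally show "hybrid_key l b d \<alpha> (Suc i) = ?S" .
qed

section \<open>Reductions to the generator and to the conversion\<close>

lemma unif_indist_PRG: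
  "unif_indist (\<lambda>_. UNIV :: unit set) (\<lambda>l _. map_pmf (\<lambda>s. enc_bits (PRG s)) (uniform_bits l))
     (\<lambda>l _. map_pmf enc_bits (uniform_bits (2 * (l + 1))))"
  by (rule unif_indistI_choice) (use prg in \<open>simp_all add: pseudorandom_generator_def\<close>)

lemma unif_indist_Convert:
  assumes B: "polynomially_bounded B"
  shows "unif_indist (\<lambda>l. {d\<in>\<D>. length d \<le> B l}) (\<lambda>l d. map_pmf (\<lambda>s. enc_bits (Convert d s)) (uniform_bits l))
    (\<lambda>l d. map_pmf enc_bits (pmf_of_set (carrier (G d))))"
proof (cases "\<D> = {}")
  case False
  \<comment> \<open>Choosing a nearly worst description needs a nonempty index set for every l.
    Adding the length of some \<open>d0\<close> to the bound ensures this, and the larger family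
    contains the wanted one.\<close>
  then obtain d0 where d0: "d0 \<in> \<D>" by blast
  have "unif_indist (\<lambda>l. {d\<in>\<D>. length d \<le> B l + length d0}) (\<lambda>l d. map_pmf (\<lambda>s. enc_bits (Convert d s)) (uniform_bits l))
    (\<lambda>l d. map_pmf enc_bits (pmf_of_set (carrier (G d))))"
  proof (rule unif_indistI_choice)
    fix d assume d: "\<And>l. d l \<in> {d\<in>\<D>. length d \<le> B l + length d0}"
    have "polynomially_bounded (\<lambda>l. B l + length d0)" by (intro pb_intros B)
    then have "polynomially_bounded (\<lambda>l. length (d l))" by (rule polynomially_bounded_mono) (use d in auto)
    then show "(\<lambda>l. map_pmf (\<lambda>s. enc_bits (Convert (d l) s)) (uniform_bits l)) \<approx>\<^sub>c
        (\<lambda>l. map_pmf enc_bits (pmf_of_set (carrier (G (d l)))))"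
      using conversion d unfolding pseudorandom_conversion_def by blast
  qed (use d0 in auto)
  then show ?thesis by (rule unif_indist_reindex[where f = "\<lambda>_ d. d"]) auto
next
  case True
  then show ?thesis by (intro unif_indist_refl) auto
qed

end

lemma size_enc_node: "size (enc_node m) \<le> 2 * length (fst m) + 2"
  using size_enc_bits[of "fst m"] size_enc_bool[of "snd m"] by (cases m) simp

lemma size_enc_corr_words:
  "length cws \<le> n \<Longrightarrow> \<forall>cw\<in>set cws. length (fst cw) = l \<Longrightarrow> size (enc_list enc_corr_word cws) \<le> n * Suc (2 * l + 4)"
  by (rule size_enc_list_le) (use size_enc_corr_word in \<open>auto simp: order_trans\<close>)

text \<open>Reductions receive arbitrary samples. Forcing the length keeps them within the inputs on
  which the key operations are known to be efficient; samples of the right length are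
  unchanged.\<close>

definition pad :: "nat \<Rightarrow> bits \<Rightarrow> bits" where
  "pad n y = take n (y @ replicate n False)"

lemma length_pad [simp]: "length (pad n y) = n"
  by (simp add: pad_def)

lemma pad_id: "length y = n \<Longrightarrow> pad n y = y"
  by (simp add: pad_def)

context secemb
begin

definition point_params :: "(nat \<Rightarrow> nat) \<Rightarrow> nat \<Rightarrow> (bool \<times> bits \<times> bits) set" where
  "point_params B l = {(b, d, \<alpha>). d \<in> \<D> \<and> length d \<le> B l \<and> length \<alpha> \<le> B l}"

lemma pt_hop_key:
  assumes "pt e A enc_bool b" "pt e A enc_bits d" "pt e A enc_node r0" "pt e A (enc_list enc_corr_word) cws"
    "pt e A enc_node own" "pt e A enc_bool c" "pt e A enc_bits as" "pt e A enc_bits y"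
    "\<And>a. a \<in> A \<Longrightarrow> d a \<in> \<D> \<and> length (y a) = 2 * length (fst (own a)) + 2"
  shows "pt e A enc_key (\<lambda>a. hop_key (b a) (d a) (r0 a) (cws a) (own a) (c a) (as a) (y a))"
proof -
  let ?y = "\<lambda>a. PRG (fst (own a))" and ?l = "\<lambda>a. length (fst (own a))"
  let ?cw = "\<lambda>a. corr_word_of (c a) (?l a) (?y a) (y a)"
  have y: "pt e A enc_bits ?y" and l: "pt e A unary ?l" and t: "pt e A enc_bool (\<lambda>a. snd (own a))"
    by (rule assms pt_PRG pt_length pt_fst pt_snd)+
  have cw: "pt e A enc_corr_word ?cw"
    by (rule pt_corr_word_of[OF assms(6) l y assms(8)]) (simp_all add: length_PRG assms(9))
  show ?thesis unfolding hop_key_def Let_def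
    by (intro pt_continue_key assms pt_append pt_Cons pt_const cw pt_corrected pt_keep_child t l y pt_Not)
      (use assms(9) in \<open>auto simp: length_PRG corrected_def length_keep_child length_corr_word_of\<close>)
qed

text \<open>For a fixed prefix, the seed of the other party is used only inside the PRG. The advice
  holds all other arguments of \<open>hop_key\<close>, including the node of the corrupted party,
  which is not recomputed.\<close>

lemma hybrid_step_indist:
  assumes B: "polynomially_bounded B"
  shows "unif_indist (\<lambda>l. {(q, i). q \<in> point_params B l \<and> i < length (snd (snd q))})
    (\<lambda>l p. map_pmf enc_key (hybrid_key l (fst (fst p)) (fst (snd (fst p))) (snd (snd (fst p))) (snd p)))
    (\<lambda>l p. map_pmf enc_key (hybrid_key l (fst (fst p)) (fst (snd (fst p))) (snd (snd (fst p))) (Suc (snd p))))"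
proof -
  define A where "A l = {(b :: bool, d, r0 :: node, cws :: corr_word list, own :: node, c :: bool, as :: bits). d \<in> \<D> \<and> length d \<le> B l \<and> length (fst r0) = l \<and>
    length cws \<le> B l \<and> (\<forall>cw\<in>set cws. length (fst cw) = l) \<and> length (fst own) = l \<and> length as \<le> B l}"
    for l :: nat
  define R where "R l = (\<lambda>(b, d, r0, cws, own, c, as) x.
      enc_key (hop_key b d r0 cws own c as (pad (2 * l + 2) (bits_of x))))" for l
  let ?ea = "enc_pair enc_bool (enc_pair enc_bits (enc_pair enc_node (enc_pair (enc_list enc_corr_word)
    (enc_pair enc_node (enc_pair enc_bool enc_bits)))))"
  have post: "unif_indist (\<lambda>l. (UNIV :: unit set) \<times> A l)
    (\<lambda>l p. map_pmf (R l (snd p)) (map_pmf (\<lambda>s. enc_bits (PRG s)) (uniform_bits l)))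
    (\<lambda>l p. map_pmf (R l (snd p)) (map_pmf enc_bits (uniform_bits (2 * (l + 1)))))"
  proof (rule unif_indist_post[OF unif_indist_PRG])
    let ?e = "enc_pair unary (enc_pair ?ea id)" and ?D = "{p. fst (snd p) \<in> A (fst p)}"
    \<comment> \<open>The number 2 * l + 2 is obtained in unary as the length of a list built from
      l.\<close>
    have "pt ?e ?D enc_bits (\<lambda>p. pad (length (replicate (fst p) False @ replicate (fst p) False @ [False, False])) (bits_of (snd (snd p))))"
      unfolding pad_def by (rule pt_intros)+
    then have pad: "pt ?e ?D enc_bits (\<lambda>p. pad (2 * fst p + 2) (bits_of (snd (snd p))))"
      by (simp add: mult_2)
    have "pt ?e ?D enc_key (\<lambda>p. hop_key (fst (fst (snd p))) (fst (snd (fst (snd p)))) (fst (snd (snd (fst (snd p)))))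
      (fst (snd (snd (snd (fst (snd p)))))) (fst (snd (snd (snd (snd (fst (snd p)))))))
      (fst (snd (snd (snd (snd (snd (fst (snd p)))))))) (snd (snd (snd (snd (snd (snd (fst (snd p))))))))
      (pad (2 * fst p + 2) (bits_of (snd (snd p)))))"
      by (rule pt_hop_key; (rule pad pt_intros | force simp: A_def split_beta)+)
    from pt_encode[OF this] show "pt ?e {(l, a, x). a \<in> A l} id (\<lambda>p. R (fst p) (fst (snd p)) (snd (snd p)))"
      unfolding R_def split_beta .
    \<comment> \<open>Here \<open>d\<close> and \<open>as\<close> account for 4 * B l, the two nodes
      for 4 * l + 4, and the two flags and six cells for the remaining 8; the product covers the
      correction words.\<close>
    show "polynomially_bounded (\<lambda>l. 4 * B l + B l * Suc (2 * l + 4) + 4 * l + 12)"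
      by (intro pb_intros B)
    fix l a assume "a \<in> A l"
    obtain b d r0 cws own c as where a0: "a = (b, d, r0, cws, own, c, as)" by (rule prod_cases7)
    with \<open>a \<in> A l\<close> have a: "a = (b, d, r0, cws, own, c, as)" "length d \<le> B l" "length (fst r0) = l"
      "length cws \<le> B l" "\<forall>cw\<in>set cws. length (fst cw) = l" "length (fst own) = l" "length as \<le> B l"
      by (simp_all add: A_def)
    show "size (?ea a) \<le> 4 * B l + B l * Suc (2 * l + 4) + 4 * l + 12"
      using size_enc_bool[of b] size_enc_bool[of c] size_enc_bits[of d] size_enc_bits[of as]
        size_enc_node[of r0] size_enc_node[of own] size_enc_corr_words[OF a(4,5)] a(2,3,6,7)
      unfolding a(1) by (simp del: mult_Suc_right)
  qed
  let ?Q = "\<lambda>l. {(q, i). q \<in> point_params B l \<and> i < length (snd (snd q))}"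
  let ?h = "\<lambda>p r. hop_key (fst (fst p)) (fst (snd (fst p))) (fst r) (snd r)
      (eval_path (snd (snd (fst p))) (snd r) (fst r)) (snd (snd (fst p)) ! snd p) (drop (Suc (snd p)) (snd (snd (fst p))))"
  have "unif_indist ?Q
    (\<lambda>l p. bind_pmf (prefix_pmf l (snd p)) (\<lambda>r. map_pmf enc_key (map_pmf (?h p r) (map_pmf PRG (uniform_bits l)))))
    (\<lambda>l p. bind_pmf (prefix_pmf l (snd p)) (\<lambda>r. map_pmf enc_key (map_pmf (?h p r) (uniform_bits (2 * (l + 1))))))"
  proof (rule unif_indist_mix, rule unif_indist_reindex[OF post, where f = "\<lambda>l (p, r). ((), (fst (fst p)), (fst (snd (fst p))), (fst r), (snd r),
      (eval_path (snd (snd (fst p))) (snd r) (fst r)), (snd (snd (fst p)) ! snd p), (drop (Suc (snd p)) (snd (snd (fst p)))))"])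
    fix l pr assume "pr \<in> {(p, r). p \<in> ?Q l \<and> r \<in> set_pmf (prefix_pmf l (snd p))}"
    moreover obtain b d \<alpha> i r0 cws where pr: "pr = (((b, d, \<alpha>), i), (r0, cws))"
      by (cases pr) auto
    ultimately have p: "d \<in> \<D>" "length d \<le> B l" "length \<alpha> \<le> B l"
      "i < length \<alpha>" "length (fst r0) = l" "length cws = i" "\<forall>cw\<in>set cws. length (fst cw) = l"
      by (simp_all add: point_params_def set_prefix_pmf)
    let ?a = "(b, d, r0, cws, eval_path \<alpha> cws r0, \<alpha> ! i, drop (Suc i) \<alpha>)"
    have "?a \<in> A l" using p by (simp add: A_def length_eval_path)
    moreover have "map_pmf enc_key (map_pmf (hop_key b d r0 cws (eval_path \<alpha> cws r0) (\<alpha> ! i) (drop (Suc i) \<alpha>)) (map_pmf PRG (uniform_bits l)))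
        = map_pmf (R l ?a) (map_pmf (\<lambda>s. enc_bits (PRG s)) (uniform_bits l))"
      unfolding pmf.map_comp by (rule map_pmf_cong) (simp_all add: R_def pad_id length_PRG)
    moreover have "map_pmf enc_key (map_pmf (hop_key b d r0 cws (eval_path \<alpha> cws r0) (\<alpha> ! i) (drop (Suc i) \<alpha>)) (uniform_bits (2 * (l + 1))))
        = map_pmf (R l ?a) (map_pmf enc_bits (uniform_bits (2 * (l + 1))))"
      unfolding pmf.map_comp by (rule map_pmf_cong) (simp_all add: R_def pad_id)
    ultimately show "(case pr of (p, r) \<Rightarrow> ((), (fst (fst p)), (fst (snd (fst p))), (fst r), (snd r),
        (eval_path (snd (snd (fst p))) (snd r) (fst r)), (snd (snd (fst p)) ! snd p), (drop (Suc (snd p)) (snd (snd (fst p)))))) \<in> UNIV \<times> A l \<and>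
      map_pmf enc_key (map_pmf (?h (fst pr) (snd pr)) (map_pmf PRG (uniform_bits l))) =
      map_pmf (R l (snd (case pr of (p, r) \<Rightarrow> ((), (fst (fst p)), (fst (snd (fst p))), (fst r), (snd r),
        (eval_path (snd (snd (fst p))) (snd r) (fst r)), (snd (snd (fst p)) ! snd p), (drop (Suc (snd p)) (snd (snd (fst p))))))))
        (map_pmf (\<lambda>s. enc_bits (PRG s)) (uniform_bits l)) \<and>
      map_pmf enc_key (map_pmf (?h (fst pr) (snd pr)) (uniform_bits (2 * (l + 1)))) =
      map_pmf (R l (snd (case pr of (p, r) \<Rightarrow> ((), (fst (fst p)), (fst (snd (fst p))), (fst r), (snd r),
        (eval_path (snd (snd (fst p))) (snd r) (fst r)), (snd (snd (fst p)) ! snd p), (drop (Suc (snd p)) (snd (snd (fst p))))))))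
        (map_pmf enc_bits (uniform_bits (2 * (l + 1))))"
      unfolding pr by (simp only: fst_conv snd_conv case_prod_conv mem_Times_iff UNIV_I simp_thms)
  qed
  then show ?thesis
    by (rule unif_indist_reindex[where f = "\<lambda>_ p. p"])
      (auto simp: hybrid_key_expand map_bind_pmf)
qed

text \<open>The last correction word, as a function of the group element \<open>x\<close> that the other party's seed converts to.\<close>

definition last_word_with :: "bool \<Rightarrow> bits \<Rightarrow> node \<Rightarrow> bits \<Rightarrow> bits" where
  "last_word_with b d own x =
     (if b then gsigned d (snd own) (gadd d (gadd d \<one>\<^bsub>G d\<^esub> (gneg d x)) (Convert d (fst own)))
      else gsigned d (\<not> snd own) (gadd d (gadd d \<one>\<^bsub>G d\<^esub> (gneg d (Convert d (fst own)))) x))"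

lemma continue_key_Nil:
  "continue_key b d r0 cws own (s, \<not> snd own) [] = (fst r0, snd r0, cws, last_word_with b d own (Convert d s))"
  by (simp add: continue_key_def last_word_with_def last_word_def Let_def)

text \<open>For a fixed own node, the last word is a translate of the group element or of its
  negative, possibly negated again; this is injective, hence bijective on the finite
  carrier.\<close>

lemma last_word_uniform:
  assumes d: "d \<in> \<D>"
  shows "map_pmf (last_word_with b d own) (pmf_of_set (carrier (G d))) = pmf_of_set (carrier (G d))"
proof (rule map_pmf_of_set_bij_betw)
  interpret abelian_group "G d" by (rule abelian[OF d])
  have c: "last_word_with b d own x \<in> carrier (G d)" if "x \<in> carrier (G d)" for x
    using that d by (simp add: last_word_with_def gsigned_eq gadd_eq gneg_eq one_carrier Convert_carrier signed_def)
  have neg: "x = y" if "\<ominus>\<^bsub>G d\<^esub> x = \<ominus>\<^bsub>G d\<^esub> y" "x \<in> carrier (G d)" "y \<in> carrier (G d)" for x y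
    using that by (metis minus_minus)
  have cancel: "x = y" if "c \<oplus>\<^bsub>G d\<^esub> x = c \<oplus>\<^bsub>G d\<^esub> y" "c \<in> carrier (G d)" "x \<in> carrier (G d)" "y \<in> carrier (G d)" for c x y
    using that by (metis r_neg1)
  have "inj_on (last_word_with b d own) (carrier (G d))"
    by (rule inj_onI)
      (use d in \<open>auto simp: last_word_with_def gsigned_eq gadd_eq gneg_eq one_carrier Convert_carrier signed_def
        split: if_splits dest!: neg cancel\<close>)
  with c show "bij_betw (last_word_with b d own) (carrier (G d)) (carrier (G d))"
    using endo_inj_surj[OF finite_carrier[OF d], of "last_word_with b d own"] by (simp add: bij_betw_def image_subset_iff)
qed (use d one_carrier finite_carrier in auto)

text \<open>The conversion assumption is used in both directions: to replace the converted seed of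
  the other party by a uniform element, and, after the masking, to replace the uniform last word by
  a converted fresh seed.\<close>

lemma final_indist:
  assumes B: "polynomially_bounded B"
  shows "unif_indist (point_params B)
    (\<lambda>l q. map_pmf enc_key (hybrid_key l (fst q) (fst (snd q)) (snd (snd q)) (length (snd (snd q)))))
    (\<lambda>l q. map_pmf enc_key (sim_key l (fst (snd q)) (length (snd (snd q)))))"
proof -
  define A where "A l = {(b :: bool, d, r0 :: node, cws :: corr_word list, own :: node). d \<in> \<D> \<and> length d \<le> B l \<and> length (fst r0) = l \<and>
    length cws \<le> B l \<and> (\<forall>cw\<in>set cws. length (fst cw) = l) \<and> length (fst own) = l}"
    for l :: nat
  let ?ea = "enc_pair enc_bool (enc_pair enc_bits (enc_pair enc_node (enc_pair (enc_list enc_corr_word) enc_node)))"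
  let ?e = "enc_pair unary (enc_pair ?ea id)" and ?D = "{p. fst (snd p) \<in> A (fst p)}"
  let ?B = "\<lambda>l. 4 * B l + B l * Suc (2 * l + 4) + 4 * l + 12"
  have pb: "polynomially_bounded ?B" by (intro pb_intros B)
  have size: "size (?ea a) \<le> ?B l" if "a \<in> A l" for l a
  proof -
    obtain b d r0 cws own where a0: "a = (b, d, r0, cws, own)" by (rule prod_cases5)
    then have a: "a = (b, d, r0, cws, own)" "length d \<le> B l" "length (fst r0) = l"
      "length cws \<le> B l" "\<forall>cw\<in>set cws. length (fst cw) = l" "length (fst own) = l"
      using that by (simp_all add: A_def)
    show ?thesis
      using size_enc_bool[of b] size_enc_bits[of d]
        size_enc_node[of r0] size_enc_node[of own] size_enc_corr_words[OF a(4,5)] a(2,3,6)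
      unfolding a(1) by (simp del: mult_Suc_right)
  qed
  define R1 where "R1 = (\<lambda>(b, d, r0, cws, own) x. enc_key (fst r0, snd r0, cws, last_word_with b d own (bits_of x)))"
  define R2 where "R2 = (\<lambda>(b :: bool, d :: bits, r0, cws, own :: node) x. enc_key (fst r0, snd r0, cws, bits_of x))"
  let ?conv = "\<lambda>l p. map_pmf (\<lambda>s. enc_bits (Convert (fst p) s)) (uniform_bits l)"
  let ?unif = "\<lambda>l p. map_pmf enc_bits (pmf_of_set (carrier (G (fst p))))"
  have post1: "unif_indist (\<lambda>l. {d\<in>\<D>. length d \<le> B l} \<times> A l) (\<lambda>l p. map_pmf (R1 (snd p)) (?conv l p)) (\<lambda>l p. map_pmf (R1 (snd p)) (?unif l p))"
  proof (rule unif_indist_post[OF unif_indist_Convert[OF B] _ pb size])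
    show "pt ?e {(l, a, x). a \<in> A l} id (\<lambda>p. R1 (fst (snd p)) (snd (snd p)))"
      unfolding R1_def split_beta last_word_with_def
      by (rule pt_encode[where ?e1.0 = enc_key], unfold enc_key_eq;
          (rule pt_intros pt_gsigned pt_gadd pt_gneg pt_Convert pt_group_const | force simp: A_def split_beta)+)
  qed
  have post2: "unif_indist (\<lambda>l. {d\<in>\<D>. length d \<le> B l} \<times> A l) (\<lambda>l p. map_pmf (R2 (snd p)) (?conv l p)) (\<lambda>l p. map_pmf (R2 (snd p)) (?unif l p))"
  proof (rule unif_indist_post[OF unif_indist_Convert[OF B] _ pb size])
    show "pt ?e {(l, a, x). a \<in> A l} id (\<lambda>p. R2 (fst (snd p)) (snd (snd p)))"
      unfolding R2_def split_beta
      by (rule pt_encode[where ?e1.0 = enc_key], unfold enc_key_eq; (rule pt_intros)+)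
  qed
  have eq: "map_pmf (R1 (b, d, r0, cws, own)) (map_pmf enc_bits (pmf_of_set (carrier (G d)))) =
      map_pmf (R2 (b, d, r0, cws, own)) (map_pmf enc_bits (pmf_of_set (carrier (G d))))"
    if "d \<in> \<D>" for b d r0 cws own
  proof -
    have "map_pmf (R1 (b, d, r0, cws, own)) (map_pmf enc_bits (pmf_of_set (carrier (G d)))) =
        map_pmf (\<lambda>g. enc_key (fst r0, snd r0, cws, g)) (map_pmf (last_word_with b d own) (pmf_of_set (carrier (G d))))"
      by (simp add: pmf.map_comp o_def R1_def)
    also have "\<dots> = map_pmf (R2 (b, d, r0, cws, own)) (map_pmf enc_bits (pmf_of_set (carrier (G d))))"
      unfolding last_word_uniform[OF that] by (simp add: pmf.map_comp o_def R2_def)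
    finally show ?thesis .
  qed
  have "unif_indist (\<lambda>l. {d\<in>\<D>. length d \<le> B l} \<times> A l) (\<lambda>l p. map_pmf (R2 (snd p)) (?unif l p)) (\<lambda>l p. map_pmf (R2 (snd p)) (?conv l p))"
    by (rule unif_indist_sym[OF post2])
  \<comment> \<open>Post-processing lets the description of the sampled element and the one inside
    the advice vary independently; the masking step requires them to agree.\<close>
  then have "unif_indist (\<lambda>l. {p \<in> {d\<in>\<D>. length d \<le> B l} \<times> A l. fst p = fst (snd (snd p))})
      (\<lambda>l p. map_pmf (R1 (snd p)) (?unif l p)) (\<lambda>l p. map_pmf (R2 (snd p)) (?conv l p))"
    by (rule unif_indist_reindex[where f = "\<lambda>_ p. p"]) (use eq in fastforce)
  moreover have "unif_indist (\<lambda>l. {p \<in> {d\<in>\<D>. length d \<le> B l} \<times> A l. fst p = fst (snd (snd p))})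
      (\<lambda>l p. map_pmf (R1 (snd p)) (?conv l p)) (\<lambda>l p. map_pmf (R1 (snd p)) (?unif l p))"
    using post1 by (rule unif_indist_reindex[where f = "\<lambda>_ p. p"]) auto
  ultimately have post: "unif_indist (\<lambda>l. {p \<in> {d\<in>\<D>. length d \<le> B l} \<times> A l. fst p = fst (snd (snd p))})
      (\<lambda>l p. map_pmf (R1 (snd p)) (?conv l p)) (\<lambda>l p. map_pmf (R2 (snd p)) (?conv l p))"
    by (rule unif_indist_trans[rotated])
  let ?a = "\<lambda>q r. (fst q, fst (snd q), fst r, snd r, eval_path (snd (snd q)) (snd r) (fst r))"
  have "unif_indist (point_params B)
    (\<lambda>l q. bind_pmf (prefix_pmf l (length (snd (snd q)))) (\<lambda>r. map_pmf (R1 (?a q r)) (?conv l (fst (snd q), ()))))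
    (\<lambda>l q. bind_pmf (prefix_pmf l (length (snd (snd q)))) (\<lambda>r. map_pmf (R2 (?a q r)) (?conv l (fst (snd q), ()))))"
    by (rule unif_indist_mix, rule unif_indist_reindex[OF post, where f = "\<lambda>l p. (fst (snd (fst p)), ?a (fst p) (snd p))"])
      (auto simp: point_params_def set_prefix_pmf A_def length_eval_path)
  then show ?thesis
    by (rule unif_indist_reindex[where f = "\<lambda>_ p. p"])
      (auto simp: hybrid_key_def sim_key_def map_bind_pmf Let_def continue_key_Nil pmf.map_comp o_def R1_def R2_def split_beta
        simp del: enc_key.simps)
qed

lemma key_indist:
  assumes B: "polynomially_bounded B"
  shows "unif_indist (point_params B)
    (\<lambda>l q. map_pmf enc_key (real_key l (fst q) (fst (snd q)) (snd (snd q))))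
    (\<lambda>l q. map_pmf enc_key (sim_key l (fst (snd q)) (length (snd (snd q)))))"
proof (rule unif_indist_trans[OF _ final_indist[OF B]])
  have "unif_indist (point_params B)
     (\<lambda>l q. map_pmf enc_key (hybrid_key l (fst q) (fst (snd q)) (snd (snd q)) 0))
     (\<lambda>l q. map_pmf enc_key (hybrid_key l (fst q) (fst (snd q)) (snd (snd q)) (length (snd (snd q)))))"
    by (rule unif_indist_hybrid[OF B _ hybrid_step_indist[OF B]]) (auto simp: point_params_def)
  then show "unif_indist (point_params B)
     (\<lambda>l q. map_pmf enc_key (real_key l (fst q) (fst (snd q)) (snd (snd q))))
     (\<lambda>l q. map_pmf enc_key (hybrid_key l (fst q) (fst (snd q)) (snd (snd q)) (length (snd (snd q)))))"
    by (rule unif_indist_reindex[where f = "\<lambda>_ p. p"]) (auto simp: point_params_def real_key_eq_hybrid)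
qed

end

section \<open>Evaluating keys\<close>

lemma enc_int_eq: "enc_int = (\<lambda>k. enc_pair enc_bool enc_bits (k < 0, binary (nat \<bar>k\<bar>)))"
  by (simp add: enc_int_def fun_eq_iff)

context secemb
begin

text \<open>A loop over group elements keeps a polynomial state because every element is short, no
  matter how many operations produced it.\<close>

lemma carrier_length:
  "\<exists>h. polynomially_bounded h \<and> mono h \<and>
    (\<forall>d\<in>\<D>. \<forall>x\<in>carrier (G d). size (enc_bits x) \<le> h (size (enc_bits d)))"
proof -
  obtain k where k: "\<forall>d\<in>\<D>. \<forall>x\<in>carrier (G d). length x \<le> length d ^ k + k"
    using groups unfolding efficient_abelian_groups_def by blast
  let ?h = "\<lambda>n. 2 * (n ^ k + k)"
  have "size (enc_bits x) \<le> ?h (size (enc_bits d))" if "d \<in> \<D>" "x \<in> carrier (G d)" for d x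
  proof -
    have "length x \<le> length d ^ k + k" using k that by blast
    also have "\<dots> \<le> size (enc_bits d) ^ k + k"
      by (intro add_right_mono power_mono length_le_size_enc_list) auto
    finally show ?thesis using size_enc_bits[of x] by simp
  qed
  then show ?thesis by (intro exI[of _ ?h]) (auto intro!: pb_intros monoI power_mono)
qed

section \<open>Multiplication of group elements by integers\<close>

definition double_add :: "bits \<Rightarrow> bits \<Rightarrow> bool \<Rightarrow> bits \<Rightarrow> bits" where
  "double_add d x b acc = gadd d (gadd d acc acc) (if b then x else \<zero>\<^bsub>G d\<^esub>)"

text \<open>Double-and-add: the entries of the matrix are encoded in binary, so repeated addition
  would take exponential time.\<close>

definition gmult :: "bits \<Rightarrow> int \<Rightarrow> bits \<Rightarrow> bits" where
  "gmult d k x = gsigned d (k < 0) (fold (double_add d x) (rev (binary (nat \<bar>k\<bar>))) \<zero>\<^bsub>G d\<^esub>)"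

lemma zero_carrier: "d \<in> \<D> \<Longrightarrow> \<zero>\<^bsub>G d\<^esub> \<in> carrier (G d)"
  using abelian by (simp add: abelian_group_def abelian_monoid.zero_closed)

lemma add_carrier: "d \<in> \<D> \<Longrightarrow> x \<in> carrier (G d) \<Longrightarrow> y \<in> carrier (G d) \<Longrightarrow> x \<oplus>\<^bsub>G d\<^esub> y \<in> carrier (G d)"
  using abelian by (simp add: abelian_group_def abelian_monoid.a_closed)

lemma signed_carrier: "d \<in> \<D> \<Longrightarrow> x \<in> carrier (G d) \<Longrightarrow> signed (G d) t x \<in> carrier (G d)"
  using abelian_group.a_inv_closed[OF abelian] by (simp add: signed_def)

lemma fold_double_add_carrier:
  "d \<in> \<D> \<Longrightarrow> x \<in> carrier (G d) \<Longrightarrow> acc \<in> carrier (G d) \<Longrightarrow> fold (double_add d x) bs acc \<in> carrier (G d)"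
  by (induction bs arbitrary: acc) (auto simp: double_add_def gadd_eq zero_carrier add_carrier)

text \<open>\<open>binary\<close> lists the lowest bit first. After reversal, the last round doubles
  the multiple for n div 2 and adds the lowest bit.\<close>

lemma fold_double_add_eq:
  assumes "d \<in> \<D>" "x \<in> carrier (G d)"
  shows "fold (double_add d x) (rev (binary n)) \<zero>\<^bsub>G d\<^esub> = [n] \<cdot>\<^bsub>G d\<^esub> x"
proof (induction n rule: less_induct)
  case (less n)
  interpret abelian_group "G d" by (rule abelian[OF assms(1)])
  show ?case
  proof (cases "n = 0")
    case True
    then show ?thesis by (simp add: binary.simps add_pow_def)
  next
    case False
    let ?y = "[(n div 2)] \<cdot>\<^bsub>G d\<^esub> x"
    have y: "?y \<in> carrier (G d)" using assms by simp
    have "fold (double_add d x) (rev (binary n)) \<zero>\<^bsub>G d\<^esub> = double_add d x (odd n) ?y"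
      using False less[of "n div 2"] by (subst binary.simps) simp
    also have "\<dots> = (?y \<oplus>\<^bsub>G d\<^esub> ?y) \<oplus>\<^bsub>G d\<^esub> (if odd n then x else \<zero>\<^bsub>G d\<^esub>)"
      using assms y by (simp add: double_add_def gadd_eq)
    also have "?y \<oplus>\<^bsub>G d\<^esub> ?y = [(n div 2 + n div 2)] \<cdot>\<^bsub>G d\<^esub> x"
      using assms by (simp add: add.nat_pow_mult)
    also have "\<dots> \<oplus>\<^bsub>G d\<^esub> (if odd n then x else \<zero>\<^bsub>G d\<^esub>) = [(n div 2 + n div 2 + n mod 2)] \<cdot>\<^bsub>G d\<^esub> x"
      using assms by (simp add: odd_iff_mod_2_eq_one)
    also have "n div 2 + n div 2 + n mod 2 = n" by presburger
    finally show ?thesis .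
  qed
qed

lemma gmult_eq:
  assumes "d \<in> \<D>" "x \<in> carrier (G d)"
  shows "gmult d k x = [k] \<cdot>\<^bsub>G d\<^esub> x"
proof -
  have "gmult d k x = signed (G d) (k < 0) (fold (double_add d x) (rev (binary (nat \<bar>k\<bar>))) \<zero>\<^bsub>G d\<^esub>)"
    unfolding gmult_def by (intro gsigned_eq fold_double_add_carrier zero_carrier assms)
  also have "\<dots> = signed (G d) (k < 0) ([(nat \<bar>k\<bar>)] \<cdot>\<^bsub>G d\<^esub> x)"
    by (simp only: fold_double_add_eq[OF assms])
  also have "\<dots> = [k] \<cdot>\<^bsub>G d\<^esub> x"
    unfolding signed_def add_pow_def int_pow_def2 a_inv_def by (cases "k < 0") simp_all
  finally show ?thesis .
qed

lemma gmult_carrier: "d \<in> \<D> \<Longrightarrow> x \<in> carrier (G d) \<Longrightarrow> gmult d k x \<in> carrier (G d)"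
  by (simp add: gmult_def gsigned_eq signed_carrier fold_double_add_carrier zero_carrier)

text \<open>With \<open>x\<close> in the carrier, the accumulator stays there as well and its size
  is bounded by \<open>carrier_length\<close>.\<close>

lemma pt_gmult:
  assumes "pt e A enc_bits d" "pt e A enc_int k" "pt e A enc_bits x"
    "\<And>a. a \<in> A \<Longrightarrow> d a \<in> \<D> \<and> x a \<in> carrier (G (d a))"
  shows "pt e A enc_bits (\<lambda>a. gmult (d a) (k a) (x a))"
proof -
  let ?e = "enc_pair enc_bits (enc_pair enc_int enc_bits)"
  let ?D = "{p. fst p \<in> \<D> \<and> snd (snd p) \<in> carrier (G (fst p))} :: (bits \<times> int \<times> bits) set"
  obtain h where h: "polynomially_bounded h" "mono h"
    "\<And>d x. d \<in> \<D> \<Longrightarrow> x \<in> carrier (G d) \<Longrightarrow> size (enc_bits x) \<le> h (size (enc_bits d))" using carrier_length by blast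
  have k: "pt enc_int UNIV (enc_pair enc_bool enc_bits) (\<lambda>k. (k < 0, binary (nat \<bar>k\<bar>)))"
    by (rule pt_recode) (simp add: enc_int_eq)
  have k': "pt ?e ?D (enc_pair enc_bool enc_bits) (\<lambda>p. (fst (snd p) < 0, binary (nat \<bar>fst (snd p)\<bar>)))"
    by (rule pt_comp[OF k]; (rule pt_intros | simp)+)
  note sgn = pt_fst[OF k', simplified] and bin = pt_snd[OF k', simplified]
  have "pt ?e ?D enc_bits (\<lambda>p. fold (double_add (fst p) (snd (snd p))) (rev (binary (nat \<bar>fst (snd p)\<bar>))) \<zero>\<^bsub>G (fst p)\<^esub>)"
  proof (rule pt_fold[where g = h])
    show "pt ?e ?D enc_bits (\<lambda>a. \<zero>\<^bsub>G (fst a)\<^esub>)"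
      by (rule pt_group_const; (rule pt_intros | simp)+)
    let ?D' = "{(a, x, s). a \<in> ?D \<and> (\<exists>i<length (rev (binary (nat \<bar>fst (snd a)\<bar>))). x = rev (binary (nat \<bar>fst (snd a)\<bar>)) ! i \<and>
       s = fold (double_add (fst a) (snd (snd a))) (take i (rev (binary (nat \<bar>fst (snd a)\<bar>)))) \<zero>\<^bsub>G (fst a)\<^esub>)}"
    show "pt (enc_pair ?e (enc_pair enc_bool enc_bits)) ?D' enc_bits
        (\<lambda>y. double_add (fst (fst y)) (snd (snd (fst y))) (fst (snd y)) (snd (snd y)))"
      unfolding double_add_def
      by (rule pt_gadd; (rule pt_intros pt_gadd pt_group_const | force)+)
    fix a i assume a: "a \<in> ?D"
    let ?s = "fold (double_add (fst a) (snd (snd a))) (take i (rev (binary (nat \<bar>fst (snd a)\<bar>)))) \<zero>\<^bsub>G (fst a)\<^esub>"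
    have "?s \<in> carrier (G (fst a))" using a by (intro fold_double_add_carrier zero_carrier) simp_all
    then have "size (enc_bits ?s) \<le> h (size (enc_bits (fst a)))" using h(3) a by simp
    also have "\<dots> \<le> h (size (?e a))" by (rule monoD[OF h(2)]) (cases a, simp)
    finally show "size (enc_bits ?s) \<le> h (size (?e a))" .
  qed (rule pt_rev[OF bin] h)+
  then have "pt ?e ?D enc_bits (\<lambda>p. gmult (fst p) (fst (snd p)) (snd (snd p)))"
    unfolding gmult_def by (intro pt_gsigned sgn pt_fst0) auto
  from pt_comp[OF this pt_pair[OF assms(1) pt_pair[OF assms(2,3)]]] assms(4) show ?thesis by simp
qed

section \<open>Evaluations of keys and server responses\<close>

definition well_formed_key :: "bits \<Rightarrow> nat \<Rightarrow> fss_key \<Rightarrow> bool" where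
  "well_formed_key d n = (\<lambda>(s, t, cws, w). length cws = n \<and> (\<forall>cw\<in>set cws. length (fst cw) = length s) \<and> w \<in> carrier (G d))"

lemma last_word_carrier: "d \<in> \<D> \<Longrightarrow> last_word d n0 n1 \<in> carrier (G d)"
  unfolding last_word_def using abelian_group.a_inv_closed[OF abelian]
  by (simp add: gsigned_eq gadd_eq gneg_eq one_carrier Convert_carrier add_carrier signed_carrier)

lemma well_formed_party_key:
  assumes "d \<in> \<D>" "length (fst co) = length (fst (snd co))"
  shows "well_formed_key d (length \<alpha>) (party_key b d \<alpha> co)"
proof -
  obtain s0 s1 t0 where co: "co = (s0, s1, t0)" by (cases co)
  have "length (fst (fss_gen_path PRG \<alpha> ((s0, t0), (s1, \<not> t0)))) = length \<alpha> \<and>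
    (\<forall>cw\<in>set (fst (fss_gen_path PRG \<alpha> ((s0, t0), (s1, \<not> t0)))). length (fst cw) = length s0)"
    using length_gen_path[of "((s0, t0), (s1, \<not> t0))" "length s0" \<alpha>] assms(2) co by simp
  then show ?thesis
    using assms by (cases b) (simp_all add: co party_key_eq continue_key_def well_formed_key_def Let_def last_word_carrier)
qed

definition party_eval :: "bool \<Rightarrow> bits \<Rightarrow> fss_key \<Rightarrow> bits \<Rightarrow> bits" where
  "party_eval c d K x =
     (let st = eval_path x (fst (snd (snd K))) (fst K, fst (snd K))
      in gsigned d c (gadd d (Convert d (fst st)) (if snd st then snd (snd (snd K)) else \<zero>\<^bsub>G d\<^esub>)))"

lemma party_eval_eq:
  assumes "d \<in> \<D>" "well_formed_key d (length x) K"
  shows "fss_eval PRG (G d) (Convert d) c K x = party_eval c d K x" and "party_eval c d K x \<in> carrier (G d)"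
proof -
  obtain s t cws w where K: "K = (s, t, cws, w)" by (cases K)
  have wf: "length cws = length x" "\<forall>cw\<in>set cws. length (fst cw) = length (fst (s, t))" "w \<in> carrier (G d)"
    using assms(2) by (auto simp: K well_formed_key_def)
  show "fss_eval PRG (G d) (Convert d) c K x = party_eval c d K x" "party_eval c d K x \<in> carrier (G d)"
    using assms(1) wf(3) unfolding fss_eval_def party_eval_def K
    by (simp_all add: fss_eval_path_eq[OF wf(1,2)] split_beta Let_def gsigned_eq gadd_eq zero_carrier Convert_carrier
        add_carrier signed_carrier)
qed

lemma pt_party_eval:
  assumes "pt e A enc_bool c" "pt e A enc_bits d" "pt e A enc_key K" "pt e A enc_bits x"
    "\<And>a. a \<in> A \<Longrightarrow> d a \<in> \<D> \<and> well_formed_key (d a) (length (x a)) (K a)"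
  shows "pt e A enc_bits (\<lambda>a. party_eval (c a) (d a) (K a) (x a))"
proof -
  note K = assms(3)[unfolded enc_key_eq]
  note k = pt_fst[OF K] pt_fst[OF pt_snd[OF K]] pt_fst[OF pt_snd[OF pt_snd[OF K]]] pt_snd[OF pt_snd[OF pt_snd[OF K]]]
  have st: "pt e A enc_node (\<lambda>a. eval_path (x a) (fst (snd (snd (K a)))) (fst (K a), fst (snd (K a))))"
    by (rule pt_eval_path[OF assms(4) k(3) pt_pair[OF k(1,2)]])
      (use assms(5) in \<open>fastforce simp: well_formed_key_def split_beta\<close>)
  show ?thesis unfolding party_eval_def Let_def
    by (rule pt_gsigned pt_gadd pt_Convert pt_if_total pt_group_const assms k pt_fst[OF st] pt_snd[OF st]
        | simp add: assms(5))+
qed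

lemma pt_party_key:
  assumes "pt e A enc_bool b" "pt e A enc_bits d" "pt e A enc_bits \<alpha>" "pt e A enc_fss_coins co"
    "\<And>a. a \<in> A \<Longrightarrow> d a \<in> \<D> \<and> length (fst (co a)) = length (fst (snd (co a)))"
  shows "pt e A enc_key (\<lambda>a. party_key (b a) (d a) (\<alpha> a) (co a))"
proof -
  note co = assms(4)[unfolded enc_fss_coins_eq]
  note c = pt_fst[OF co] pt_fst[OF pt_snd[OF co]] pt_snd[OF pt_snd[OF co]]
  let ?n0 = "\<lambda>a. (fst (co a), snd (snd (co a)))" and ?n1 = "\<lambda>a. (fst (snd (co a)), \<not> snd (snd (co a)))"
  have "pt e A enc_key (\<lambda>a. continue_key (b a) (d a) (if b a then ?n1 a else ?n0 a) []
      (if b a then ?n1 a else ?n0 a) (if b a then ?n0 a else ?n1 a) (\<alpha> a))"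
    by (intro pt_continue_key assms pt_if_total pt_pair pt_Not c pt_const) (use assms(5) in auto)
  then show ?thesis
  proof (rule pt_cong)
    fix a assume "a \<in> A"
    then show "continue_key (b a) (d a) (if b a then ?n1 a else ?n0 a) []
      (if b a then ?n1 a else ?n0 a) (if b a then ?n0 a else ?n1 a) (\<alpha> a) = party_key (b a) (d a) (\<alpha> a) (co a)"
      using party_key_eq[of "d a" "b a" "\<alpha> a" "fst (co a)" "fst (snd (co a))" "snd (snd (co a))"] assms(5)
      by (simp add: Let_def)
  qed
qed

definition add_row :: "bool \<Rightarrow> bits \<Rightarrow> fss_key \<Rightarrow> int list \<times> bits \<Rightarrow> bits list \<Rightarrow> bits list" where
  "add_row c d K r acc = map (\<lambda>p. gadd d (snd p) (gmult d (fst p) (party_eval c d K (snd r)))) (zip (fst r) acc)"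

text \<open>The vector is updated item by item. Its dimension is read off the first row, which is
  why at least one row is required below.\<close>

definition response :: "bool \<Rightarrow> bits \<Rightarrow> fss_key \<Rightarrow> int list list \<Rightarrow> bits list \<Rightarrow> bits list" where
  "response c d K qs ids = fold (add_row c d K) (zip qs ids) (map (\<lambda>_. \<zero>\<^bsub>G d\<^esub>) (hd qs))"

definition emb_rows :: "retrieval_params \<Rightarrow> int list list" where
  "emb_rows P = map (\<lambda>j. map (\<lambda>k. emb P j k) [0..<emb_dim P]) [0..<num_items P]"

definition item_ids :: "nat \<Rightarrow> bits list" where
  "item_ids m = map (item_id m) [0..<m]"

lemma length_item_id [simp]: "length (item_id m j) = id_length m"
  by (simp add: item_id_def)

text \<open>After i rows the state is the vector of partial sums. All its entries lie in the
  carrier, where \<open>gadd\<close> and \<open>gmult\<close> agree with the group.\<close>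

lemma response_prefix:
  assumes "d \<in> \<D>" "well_formed_key d (id_length (num_items P)) K" "i \<le> num_items P"
  shows "fold (add_row c d K) (take i (zip (emb_rows P) (item_ids (num_items P)))) (map (\<lambda>_. \<zero>\<^bsub>G d\<^esub>) [0..<emb_dim P]) =
    map (\<lambda>k. \<Oplus>\<^bsub>G d\<^esub>j\<in>{..<i}. [(emb P j k)] \<cdot>\<^bsub>G d\<^esub>
      fss_eval PRG (G d) (Convert d) c K (item_id (num_items P) j)) [0..<emb_dim P]"
  using assms(3)
proof (induction i)
  case 0
  interpret abelian_group "G d" by (rule abelian[OF assms(1)])
  show ?case by simp
next
  case (Suc i)
  interpret abelian_group "G d" by (rule abelian[OF assms(1)])
  let ?ev = "\<lambda>j. fss_eval PRG (G d) (Convert d) c K (item_id (num_items P) j)"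
  have ev: "party_eval c d K (item_id (num_items P) j) = ?ev j" "?ev j \<in> carrier (G d)" for j
    using party_eval_eq[OF assms(1), of "item_id (num_items P) j" K c] assms(2) by simp_all
  have mult: "[k] \<cdot>\<^bsub>G d\<^esub> ?ev j \<in> carrier (G d)" for k :: int and j
    using gmult_carrier[OF assms(1) ev(2)] gmult_eq[OF assms(1) ev(2)] by simp
  have "zip (emb_rows P) (item_ids (num_items P)) ! i = (map (\<lambda>k. emb P i k) [0..<emb_dim P], item_id (num_items P) i)"
    using Suc.prems by (simp add: emb_rows_def item_ids_def)
  moreover have "i < length (zip (emb_rows P) (item_ids (num_items P)))"
    using Suc.prems by (simp add: emb_rows_def item_ids_def)
  ultimately have "fold (add_row c d K) (take (Suc i) (zip (emb_rows P) (item_ids (num_items P)))) (map (\<lambda>_. \<zero>\<^bsub>G d\<^esub>) [0..<emb_dim P]) =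
    add_row c d K (map (\<lambda>k. emb P i k) [0..<emb_dim P], item_id (num_items P) i)
      (map (\<lambda>k. \<Oplus>\<^bsub>G d\<^esub>j\<in>{..<i}. [(emb P j k)] \<cdot>\<^bsub>G d\<^esub> ?ev j) [0..<emb_dim P])"
    using Suc by (simp add: take_Suc_conv_app_nth)
  also have "\<dots> = map (\<lambda>k. gadd d (\<Oplus>\<^bsub>G d\<^esub>j\<in>{..<i}. [(emb P j k)] \<cdot>\<^bsub>G d\<^esub> ?ev j) (gmult d (emb P i k) (?ev i))) [0..<emb_dim P]"
    by (simp add: add_row_def ev(1) zip_map_map zip_same_conv_map)
  also have "\<dots> = map (\<lambda>k. \<Oplus>\<^bsub>G d\<^esub>j\<in>{..<Suc i}. [(emb P j k)] \<cdot>\<^bsub>G d\<^esub> ?ev j) [0..<emb_dim P]"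
  proof (rule map_cong[OF refl])
    fix k
    have "(\<Oplus>\<^bsub>G d\<^esub>j\<in>{..<i}. [(emb P j k)] \<cdot>\<^bsub>G d\<^esub> ?ev j) \<in> carrier (G d)"
      by (rule finsum_closed) (use mult in auto)
    moreover have "(\<Oplus>\<^bsub>G d\<^esub>j\<in>{..<Suc i}. [(emb P j k)] \<cdot>\<^bsub>G d\<^esub> ?ev j) =
        [(emb P i k)] \<cdot>\<^bsub>G d\<^esub> ?ev i \<oplus>\<^bsub>G d\<^esub> (\<Oplus>\<^bsub>G d\<^esub>j\<in>{..<i}. [(emb P j k)] \<cdot>\<^bsub>G d\<^esub> ?ev j)"
      unfolding lessThan_Suc by (rule finsum_insert) (use mult in auto)
    ultimately show "gadd d (\<Oplus>\<^bsub>G d\<^esub>j\<in>{..<i}. [(emb P j k)] \<cdot>\<^bsub>G d\<^esub> ?ev j) (gmult d (emb P i k) (?ev i)) =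
        (\<Oplus>\<^bsub>G d\<^esub>j\<in>{..<Suc i}. [(emb P j k)] \<cdot>\<^bsub>G d\<^esub> ?ev j)"
      using mult by (simp add: gadd_eq gmult_eq assms(1) ev(2) a_comm)
  qed
  finally show ?case .
qed

lemma hd_emb_rows: "0 < num_items P \<Longrightarrow> hd (emb_rows P) = map (\<lambda>k. emb P 0 k) [0..<emb_dim P]"
  by (simp add: emb_rows_def hd_map)

lemma server_response_eq:
  assumes "groups P ! i \<in> \<D>" "well_formed_key (groups P ! i) (id_length (num_items P)) K" "0 < num_items P"
  shows "server_response PRG G Convert P c K i = response c (groups P ! i) K (emb_rows P) (item_ids (num_items P))"
proof -
  have "take (num_items P) (zip (emb_rows P) (item_ids (num_items P))) = zip (emb_rows P) (item_ids (num_items P))"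
    by (simp add: emb_rows_def item_ids_def)
  then show ?thesis using response_prefix[OF assms(1,2) order_refl, of c] assms(3)
    by (simp add: server_response_def response_def Let_def hd_emb_rows o_def)
qed

lemma pt_add_row:
  assumes "pt e A enc_bool c" "pt e A enc_bits d" "pt e A enc_key K" "pt e A (enc_pair (enc_list enc_int) enc_bits) r"
    "pt e A (enc_list enc_bits) acc"
    "\<And>a. a \<in> A \<Longrightarrow> d a \<in> \<D> \<and> well_formed_key (d a) (length (snd (r a))) (K a)"
  shows "pt e A (enc_list enc_bits) (\<lambda>a. add_row (c a) (d a) (K a) (r a) (acc a))"
proof -
  let ?e = "enc_pair enc_bits (enc_pair enc_bits (enc_pair (enc_list enc_int) (enc_list enc_bits)))"
  let ?D = "{p. fst p \<in> \<D> \<and> fst (snd p) \<in> carrier (G (fst p))}"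
  have "pt ?e ?D (enc_list enc_bits) (\<lambda>p. map (\<lambda>q. gadd (fst p) (snd q) (gmult (fst p) (fst q) (fst (snd p))))
      (zip (fst (snd (snd p))) (snd (snd (snd p)))))"
    by (rule pt_map; (rule pt_intros pt_gadd pt_gmult | force)+)
  from pt_comp[OF this pt_pair[OF assms(2) pt_pair[OF pt_party_eval[OF assms(1-3) pt_snd[OF assms(4)] assms(6)]
      pt_pair[OF pt_fst[OF assms(4)] assms(5)]]]]
  show ?thesis using assms(6) party_eval_eq(2) by (simp add: add_row_def)
qed

end

context secemb
begin

lemma add_row_carrier:
  assumes "d \<in> \<D>" "well_formed_key d (length (snd r)) K" "set acc \<subseteq> carrier (G d)"
  shows "set (add_row c d K r acc) \<subseteq> carrier (G d) \<and> length (add_row c d K r acc) \<le> length acc"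
  using assms party_eval_eq(2)[OF assms(1,2), of c]
  by (auto simp: add_row_def gadd_eq gmult_carrier add_carrier dest!: set_zip_rightD)

lemma fold_add_row_carrier:
  assumes "d \<in> \<D>" "\<forall>r\<in>set xs. well_formed_key d (length (snd r)) K" "set acc \<subseteq> carrier (G d)"
  shows "set (fold (add_row c d K) xs acc) \<subseteq> carrier (G d) \<and> length (fold (add_row c d K) xs acc) \<le> length acc"
  using assms(2,3)
proof (induction xs arbitrary: acc)
  case (Cons r xs)
  then have r: "set (add_row c d K r acc) \<subseteq> carrier (G d) \<and> length (add_row c d K r acc) \<le> length acc"
    by (intro add_row_carrier assms) auto
  from Cons.IH[of "add_row c d K r acc"] Cons.prems(1) r show ?case by simp
qed simp

lemma pt_response:
  assumes "pt e A enc_bool c" "pt e A enc_bits d" "pt e A enc_key K" "pt e A (enc_list (enc_list enc_int)) qs"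
    "pt e A (enc_list enc_bits) ids"
    "\<And>a. a \<in> A \<Longrightarrow> d a \<in> \<D> \<and> qs a \<noteq> [] \<and> (\<forall>x\<in>set (ids a). well_formed_key (d a) (length x) (K a))"
  shows "pt e A (enc_list enc_bits) (\<lambda>a. response (c a) (d a) (K a) (qs a) (ids a))"
proof -
  let ?e = "enc_pair enc_bool (enc_pair enc_bits (enc_pair enc_key (enc_pair (enc_list (enc_list enc_int)) (enc_list enc_bits))))"
  define W where "W = {p :: bool \<times> bits \<times> fss_key \<times> int list list \<times> bits list. fst (snd p) \<in> \<D> \<and> fst (snd (snd (snd p))) \<noteq> [] \<and>
    (\<forall>x\<in>set (snd (snd (snd (snd p)))). well_formed_key (fst (snd p)) (length x) (fst (snd (snd p))))}"
  obtain h where h: "polynomially_bounded h" "mono h"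
    "\<And>d x. d \<in> \<D> \<Longrightarrow> x \<in> carrier (G d) \<Longrightarrow> size (enc_bits x) \<le> h (size (enc_bits d))"
    using carrier_length by blast
  let ?L = "\<lambda>p :: bool \<times> bits \<times> fss_key \<times> int list list \<times> bits list. zip (fst (snd (snd (snd p)))) (snd (snd (snd (snd p))))"
  let ?z = "\<lambda>p :: bool \<times> bits \<times> fss_key \<times> int list list \<times> bits list. map (\<lambda>_. \<zero>\<^bsub>G (fst (snd p))\<^esub>) (hd (fst (snd (snd (snd p)))))"
  let ?f = "\<lambda>p :: bool \<times> bits \<times> fss_key \<times> int list list \<times> bits list. add_row (fst p) (fst (snd p)) (fst (snd (snd p)))"
  have "pt ?e W (enc_list enc_bits) (\<lambda>p. fold (?f p) (?L p) (?z p))"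
  \<comment> \<open>There are at most n coordinates, each a group element of size at most h
    n.\<close>
  proof (rule pt_fold[where g = "\<lambda>n. n * Suc (h n)"])
    show "pt ?e W (enc_list (enc_pair (enc_list enc_int) enc_bits)) ?L" by (rule pt_intros)+
    show "pt ?e W (enc_list enc_bits) ?z"
      by (rule pt_map, rule pt_hd; (rule pt_intros pt_group_const | force simp: W_def)+)
    let ?D = "{(a, x, s). a \<in> W \<and> (\<exists>i<length (?L a). x = ?L a ! i \<and> s = fold (?f a) (take i (?L a)) (?z a))}"
    show "pt (enc_pair ?e (enc_pair (enc_pair (enc_list enc_int) enc_bits) (enc_list enc_bits))) ?D (enc_list enc_bits)
        (\<lambda>y. ?f (fst y) (fst (snd y)) (snd (snd y)))"
    proof (rule pt_add_row)
      fix y assume "y \<in> ?D"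
      then obtain a i s where y: "y = (a, ?L a ! i, s)" "a \<in> W" "i < length (?L a)" by auto
      then have "snd (?L a ! i) \<in> set (snd (snd (snd (snd a))))" by simp
      then show "fst (snd (fst y)) \<in> \<D> \<and> well_formed_key (fst (snd (fst y))) (length (snd (fst (snd y)))) (fst (snd (snd (fst y))))"
        using y by (simp add: W_def)
    qed (rule pt_intros)+
    fix a i assume a: "a \<in> W"
    let ?s = "fold (?f a) (take i (?L a)) (?z a)"
    have "\<forall>r\<in>set (take i (?L a)). well_formed_key (fst (snd a)) (length (snd r)) (fst (snd (snd a)))"
      using a by (auto simp: W_def dest!: in_set_takeD set_zip_rightD)
    with a have s: "set ?s \<subseteq> carrier (G (fst (snd a)))" "length ?s \<le> length (hd (fst (snd (snd (snd a)))))"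
      using fold_add_row_carrier[of "fst (snd a)" "take i (?L a)" "fst (snd (snd a))" "?z a" "fst a"] zero_carrier
      by (auto simp: W_def)
    obtain c' d' K' qs' ids' where a': "a = (c', d', K', qs', ids')" by (rule prod_cases5)
    have "qs' \<noteq> []" "d' \<in> \<D>" using a by (auto simp: W_def a')
    then have "length (hd qs') \<le> size (enc_list enc_int (hd qs'))" "size (enc_list enc_int (hd qs')) \<le> size (enc_list (enc_list enc_int) qs')"
      by (auto intro: length_le_size_enc_list size_le_size_enc_list)
    then have "size (enc_list enc_bits ?s) \<le> size (?e a) * Suc (h (size (?e a)))"
    proof (intro size_enc_list_le)
      fix x assume "x \<in> set ?s"
      then have "size (enc_bits x) \<le> h (size (enc_bits d'))" using s(1) h(3) \<open>d' \<in> \<D>\<close> by (auto simp: a')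
      also have "\<dots> \<le> h (size (?e a))" by (rule monoD[OF h(2)]) (simp add: a')
      finally show "size (enc_bits x) \<le> h (size (?e a))" .
    qed (use s(2) in \<open>simp add: a'\<close>)
    then show "size (enc_list enc_bits ?s) \<le> size (?e a) * Suc (h (size (?e a)))" .
  qed (intro pb_intros h)
  from pt_comp[OF this pt_pair[OF assms(1) pt_pair[OF assms(2) pt_pair[OF assms(3) pt_pair[OF assms(4,5)]]]]] assms(6)
  show ?thesis by (simp add: response_def W_def)
qed

end

section \<open>Item identifiers\<close>

text \<open>This describes the rounded logarithm without real numbers, so that the identifier length
  can be reached by doubling. At m = 0 both sides are false.\<close>

lemma less_id_length_iff: "k < id_length m \<longleftrightarrow> 2 ^ k < m"
proof (cases "m = 0")
  case False
  have "k < id_length m \<longleftrightarrow> real k < log 2 (real m)"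
    unfolding id_length_def zless_nat_eq_int_zless less_ceiling_iff by simp
  also have "\<dots> \<longleftrightarrow> 2 powr real k < real m"
    using False by (subst less_log_iff) auto
  also have "\<dots> \<longleftrightarrow> 2 ^ k < m"
  proof -
    have "2 powr real k = real (2 ^ k)" by (simp add: powr_realpow)
    then show ?thesis by (simp only: of_nat_less_iff)
  qed
  finally show ?thesis .
qed (simp add: id_length_def log_def)

lemma le_two_power_id_length: "m \<le> 2 ^ id_length m"
  using less_id_length_iff[of "id_length m" m] by simp

lemma id_length_le: "id_length m \<le> m"
  using less_id_length_iff[of m m] less_exp[of m] by (metis less_asym not_le)

text \<open>The strings come in increasing numerical order, most significant bit first, so for k =
  \<open>id_length m\<close> the first m of them are the item identifiers.\<close>

definition bit_strings :: "nat \<Rightarrow> bits list" where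
  "bit_strings k = map (\<lambda>j. map (\<lambda>i. bit j (k - 1 - i)) [0..<k]) [0..<2 ^ k]"

definition double_strings :: "bits list \<Rightarrow> bits list" where
  "double_strings L = map (\<lambda>s. False # s) L @ map (\<lambda>s. True # s) L"

text \<open>The new bit is the most significant one: it is \<open>False\<close> on the first half
  and \<open>True\<close> on the second.\<close>

lemma bit_strings_Suc: "bit_strings (Suc k) = double_strings (bit_strings k)"
proof (rule nth_equalityI)
  fix j assume "j < length (bit_strings (Suc k))"
  then have j: "j < 2 ^ Suc k" by (simp add: bit_strings_def)
  show "bit_strings (Suc k) ! j = double_strings (bit_strings k) ! j"
  proof (cases "j < 2 ^ k")
    case True
    have "\<not> bit j k" using True by (simp add: bit_iff_odd)
    then show ?thesis using True j
      by (auto simp: bit_strings_def double_strings_def nth_append map_upt_Suc simp del: upt_Suc)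
  next
    case False
    then obtain r where r: "j = 2 ^ k + r" "r < 2 ^ k" using j by (intro that[of "j - 2 ^ k"]) auto
    have "bit j i = bit r i" if "i < k" for i
    proof -
      have "j = 2 ^ (k - i) * 2 ^ i + r" using that r by (simp flip: power_add)
      then have "j div 2 ^ i = 2 ^ (k - i) + r div 2 ^ i" by simp
      then show ?thesis using that by (simp add: bit_iff_odd)
    qed
    moreover have "bit j k" using r by (simp add: bit_iff_odd)
    ultimately show ?thesis using r
      by (auto simp: bit_strings_def double_strings_def nth_append map_upt_Suc simp del: upt_Suc)
  qed
qed (simp add: bit_strings_def double_strings_def)

lemma take_bit_strings: "take m (bit_strings (id_length m)) = map (item_id m) [0..<m]"
  using le_two_power_id_length[of m] by (simp add: bit_strings_def take_map item_id_def[abs_def])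

text \<open>Doubling stops as soon as there are at least m strings, that is, at
  \<open>id_length m\<close>. Lengths are compared by \<open>drop\<close>, as the machine has no
  arithmetic.\<close>

lemma fold_double_strings:
  assumes "i \<le> length xs" "m = length ms"
  shows "fold (\<lambda>_ L. if drop (length L) ms \<noteq> [] then double_strings L else L) (take i xs) [[]]
    = bit_strings (min i (id_length m))"
  using assms(1)
proof (induction i)
  case 0
  show ?case by (simp add: bit_strings_def)
next
  case (Suc i)
  let ?f = "\<lambda>_ L. if drop (length L) ms \<noteq> [] then double_strings L else L"
  have "drop (length (bit_strings k)) ms \<noteq> [] \<longleftrightarrow> k < id_length m" for k
    by (simp add: bit_strings_def less_id_length_iff assms(2) not_le)
  moreover have "fold ?f (take (Suc i) xs) [[]] = ?f (xs ! i) (fold ?f (take i xs) [[]])"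
    using Suc.prems by (simp only: take_Suc_conv_app_nth[of i xs] Suc_le_eq fold_append fold.simps o_apply id_apply)
  moreover have "fold ?f (take i xs) [[]] = bit_strings (min i (id_length m))"
    using Suc by simp
  ultimately show ?case
    by (cases "i < id_length m") (simp_all add: min_def not_less bit_strings_Suc del: drop_eq_Nil)
qed

lemma pt_item_ids:
  assumes "pt e A (enc_list e1) ms"
  shows "pt e A (enc_list enc_bits) (\<lambda>a. map (item_id (length (ms a))) [0..<length (ms a)])"
proof -
  let ?f = "\<lambda>ms _ L. if drop (length L) ms \<noteq> [] then double_strings L else L"
  have dbl: "pt e' A' (enc_list enc_bits) (\<lambda>a. double_strings (L a))" if "pt e' A' (enc_list enc_bits) L" for e' :: "'z \<Rightarrow> sexp" and A' L
    unfolding double_strings_def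
    by (rule pt_append; rule pt_map[OF that]; (rule pt_intros)+)
  have "pt (enc_list e1) UNIV (enc_list enc_bits) (\<lambda>ms. fold (?f ms) ms [[]])"
  proof (rule pt_fold[where g = "\<lambda>n. (2 * n + 1) * Suc (2 * n)"])
    show "pt (enc_pair (enc_list e1) (enc_pair e1 (enc_list enc_bits)))
      {(ms, x, s). ms \<in> UNIV \<and> (\<exists>i<length ms. x = ms ! i \<and> s = fold (?f ms) (take i ms) [[]])} (enc_list enc_bits)
      (\<lambda>y. ?f (fst y) (fst (snd y)) (snd (snd y)))"
      by (rule pt_if_total pt_nonempty dbl pt_intros)+
    fix ms :: "'b list" and i assume i: "i \<le> length ms"
    let ?k = "min i (id_length (length ms))"
    \<comment> \<open>The last doubling starts from fewer than m strings and so ends with fewer than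
      2 * m; the summand 1 covers the case without doubling.\<close>
    have "2 ^ ?k \<le> 2 * length ms + 1"
    proof (cases ?k)
      case (Suc k)
      then have "k < id_length (length ms)" by auto
      then show ?thesis unfolding Suc by (simp add: less_id_length_iff)
    qed simp
    then have "size (enc_list enc_bits (bit_strings ?k)) \<le> (2 * length ms + 1) * Suc (2 * length ms)"
    proof (intro size_enc_list_le)
      fix x assume "x \<in> set (bit_strings ?k)"
      then have "length x = ?k" by (auto simp: bit_strings_def)
      then show "size (enc_bits x) \<le> 2 * length ms"
        using size_enc_bits[of x] i by simp
    qed (simp add: bit_strings_def)
    also have "\<dots> \<le> (2 * size (enc_list e1 ms) + 1) * Suc (2 * size (enc_list e1 ms))"
      using length_le_size_enc_list[of ms e1] by (intro mult_le_mono) auto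
    finally show "size (enc_list enc_bits (fold (?f ms) (take i ms) [[]])) \<le> (2 * size (enc_list e1 ms) + 1) * Suc (2 * size (enc_list e1 ms))"
      by (simp only: fold_double_strings[OF i refl])
  qed ((rule pt_intros pb_intros)+)
  then have "pt (enc_list e1) UNIV (enc_list enc_bits) (\<lambda>ms. take (length ms) (fold (?f ms) ms [[]]))"
    by - (rule pt_take pt_length pt_id | assumption)+
  then have "pt (enc_list e1) UNIV (enc_list enc_bits) (\<lambda>ms. map (item_id (length ms)) [0..<length ms])"
  proof (rule pt_cong)
    fix ms :: "'b list"
    show "take (length ms) (fold (?f ms) ms [[]]) = map (item_id (length ms)) [0..<length ms]"
      using fold_double_strings[OF order_refl refl, of ms ms]
      by (simp only: take_all order_refl min.absorb2[OF id_length_le] take_bit_strings)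
  qed
  from pt_comp[OF this assms] show ?thesis by simp
qed

section \<open>Standardizing the targets\<close>

text \<open>Each entry is paired with the rest of the list, so that one use of \<open>Choose\<close>
  yields an element together with what remains.\<close>

definition selections :: "'a list \<Rightarrow> ('a \<times> 'a list) list" where
  "selections xs = map (\<lambda>i. (xs ! i, take i xs @ drop (Suc i) xs)) [0..<length xs]"

definition select_pmf :: "'a list \<Rightarrow> ('a \<times> 'a list) pmf" where
  "select_pmf xs = map_pmf ((!) (selections xs)) (pmf_of_set {..<length (selections xs)})"

primrec sample_pmf :: "nat \<Rightarrow> 'a list \<Rightarrow> 'a list pmf" where
  "sample_pmf 0 xs = return_pmf []"
| "sample_pmf (Suc k) xs = bind_pmf (select_pmf xs) (\<lambda>p. map_pmf ((#) (fst p)) (sample_pmf k (snd p)))"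

lemma length_selections [simp]: "length (selections xs) = length xs"
  by (simp add: selections_def)

lemma set_select_pmf: "xs \<noteq> [] \<Longrightarrow> set_pmf (select_pmf xs) = set (selections xs)"
  unfolding select_pmf_def by (simp add: set_pmf_of_set lessThan_empty_iff lessThan_atLeast0 nth_image)

lemma selections_map: "selections (map f xs) = map (map_prod f (map f)) (selections xs)"
  by (auto simp: selections_def take_map drop_map)

lemma select_pmf_map:
  assumes "xs \<noteq> []" shows "select_pmf (map f xs) = map_pmf (map_prod f (map f)) (select_pmf xs)"
  unfolding select_pmf_def selections_map pmf.map_comp
  by (auto intro!: map_pmf_cong simp: set_pmf_of_set lessThan_empty_iff assms)

lemma snd_selections_nonempty: "p \<in> set (selections xs) \<Longrightarrow> Suc (length (snd p)) = length xs"
  by (auto simp: selections_def)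

text \<open>Draws go by position, so they commute with any map. The simulator samples identifiers,
  whereas \<open>standardize\<close> samples item numbers.\<close>

lemma sample_pmf_map: "k \<le> length xs \<Longrightarrow> sample_pmf k (map f xs) = map_pmf (map f) (sample_pmf k xs)"
proof (induction k arbitrary: xs)
  case (Suc k)
  then have xs: "xs \<noteq> []" by auto
  have "sample_pmf (Suc k) (map f xs) = bind_pmf (select_pmf xs) (\<lambda>p. map_pmf ((#) (f (fst p))) (sample_pmf k (map f (snd p))))"
    by (simp add: select_pmf_map[OF xs] bind_map_pmf)
  also have "\<dots> = bind_pmf (select_pmf xs) (\<lambda>p. map_pmf (map f) (map_pmf ((#) (fst p)) (sample_pmf k (snd p))))"
  proof (rule bind_pmf_cong[OF refl])
    fix p assume "p \<in> set_pmf (select_pmf xs)"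
    then have "k \<le> length (snd p)"
      using Suc.prems snd_selections_nonempty[of p xs] by (simp add: set_select_pmf xs)
    then show "map_pmf ((#) (f (fst p))) (sample_pmf k (map f (snd p))) =
        map_pmf (map f) (map_pmf ((#) (fst p)) (sample_pmf k (snd p)))"
      by (simp add: Suc.IH pmf.map_comp o_def)
  qed
  finally show ?case by (simp add: map_bind_pmf)
qed simp

definition arrangements :: "nat \<Rightarrow> 'a set \<Rightarrow> 'a list set" where
  "arrangements k S = {ys. length ys = k \<and> distinct ys \<and> set ys \<subseteq> S}"

lemma finite_arrangements: "finite S \<Longrightarrow> finite (arrangements k S)"
  by (rule finite_subset[OF _ finite_lists_length_eq[of S k]]) (auto simp: arrangements_def)

lemma card_arrangements: "finite S \<Longrightarrow> k \<le> card S \<Longrightarrow> card (arrangements k S) = \<Prod>{card S - k + 1..card S}"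
  using card_lists_distinct_length_eq[of S k] by (simp add: arrangements_def)

lemma arrangements_nonempty: "finite S \<Longrightarrow> k \<le> card S \<Longrightarrow> arrangements k S \<noteq> {}"
proof -
  assume "finite S" "k \<le> card S"
  moreover from \<open>finite S\<close> obtain xs where xs: "set xs = S" "distinct xs" using finite_distinct_list by blast
  ultimately have "take k xs \<in> arrangements k S"
    using set_take_subset[of k xs] distinct_card[of xs] by (simp add: arrangements_def)
  then show "arrangements k S \<noteq> {}" by blast
qed

lemma arrangements_Suc: "arrangements (Suc k) S = (\<Union>x\<in>S. (#) x ` arrangements k (S - {x}))"
  by (auto simp: arrangements_def length_Suc_conv image_iff)

text \<open>Arrangements split by their first element into disjoint classes of equal size, so a
  uniform element followed by a uniform arrangement of the rest is uniform.\<close>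

lemma sample_pmf_eq:
  "distinct xs \<Longrightarrow> k \<le> length xs \<Longrightarrow> sample_pmf k xs = pmf_of_set (arrangements k (set xs))"
proof (induction k arbitrary: xs)
  case 0
  have "arrangements 0 (set xs) = {[]}" by (auto simp: arrangements_def)
  then show ?case by (simp add: pmf_of_set_singleton)
next
  case (Suc k)
  let ?S = "set xs" and ?n = "length xs"
  have n: "?n \<noteq> 0" "card ?S = ?n" using Suc.prems by (auto simp: distinct_card)
  let ?r = "\<lambda>i. take i xs @ drop (Suc i) xs"
  have r: "distinct (?r i)" "set (?r i) = ?S - {xs ! i}" "length (?r i) = ?n - 1" if "i < ?n" for i
  proof -
    have split: "xs = take i xs @ xs ! i # drop (Suc i) xs" using that by (rule id_take_nth_drop)
    have "distinct (take i xs @ xs ! i # drop (Suc i) xs)" using Suc.prems(1) split by simp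
    moreover have "?S = insert (xs ! i) (set (?r i))" using arg_cong[OF split, of set] by simp
    ultimately show "distinct (?r i)" "set (?r i) = ?S - {xs ! i}" by auto
    show "length (?r i) = ?n - 1" using that by simp
  qed
  have "sample_pmf (Suc k) xs = bind_pmf (pmf_of_set {..<?n}) (\<lambda>i. map_pmf ((#) (xs ! i)) (sample_pmf k (?r i)))"
    by (simp add: select_pmf_def bind_map_pmf)
      (rule bind_pmf_cong[OF refl], use n in \<open>simp add: set_pmf_of_set lessThan_empty_iff selections_def\<close>)
  also have "\<dots> = bind_pmf (pmf_of_set {..<?n}) (\<lambda>i. pmf_of_set ((#) (xs ! i) ` arrangements k (?S - {xs ! i})))"
  proof (rule bind_pmf_cong[OF refl])
    fix i assume "i \<in> set_pmf (pmf_of_set {..<?n})"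
    then have i: "i < ?n" using n by (simp add: set_pmf_of_set lessThan_empty_iff)
    have "k \<le> card (?S - {xs ! i})" using Suc.prems n i by simp
    then have "map_pmf ((#) (xs ! i)) (pmf_of_set (arrangements k (?S - {xs ! i}))) = pmf_of_set ((#) (xs ! i) ` arrangements k (?S - {xs ! i}))"
      by (intro map_pmf_of_set_inj finite_arrangements arrangements_nonempty) auto
    then show "map_pmf ((#) (xs ! i)) (sample_pmf k (?r i)) = pmf_of_set ((#) (xs ! i) ` arrangements k (?S - {xs ! i}))"
      using Suc.IH[of "?r i"] r[OF i] Suc.prems(2) by simp
  qed
  also have "\<dots> = bind_pmf (map_pmf ((!) xs) (pmf_of_set {..<?n})) (\<lambda>x. pmf_of_set ((#) x ` arrangements k (?S - {x})))"
    by (simp add: bind_map_pmf)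
  also have "map_pmf ((!) xs) (pmf_of_set {..<?n}) = pmf_of_set ?S"
    using n Suc.prems(1) by (intro map_pmf_of_set_bij_betw bij_betw_nth) auto
  also have "bind_pmf (pmf_of_set ?S) (\<lambda>x. pmf_of_set ((#) x ` arrangements k (?S - {x}))) = pmf_of_set (arrangements (Suc k) ?S)"
    unfolding arrangements_Suc
  proof (rule pmf_of_set_UN[symmetric])
    show "finite (\<Union>x\<in>?S. (#) x ` arrangements k (?S - {x}))" by (auto intro: finite_arrangements)
    show "card ((#) x ` arrangements k (?S - {x})) = \<Prod>{?n - 1 - k + 1..?n - 1}" if "x \<in> ?S" for x
      using that n Suc.prems by (subst card_image) (auto simp: card_arrangements)
    show "(#) x ` arrangements k (?S - {x}) \<noteq> {}" if "x \<in> ?S" for x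
      using that n Suc.prems arrangements_nonempty[of "?S - {x}" k] by auto
  qed (use n in \<open>auto simp: disjoint_family_on_def\<close>)
  finally show ?case .
qed

lemma rt_select_pmf:
  assumes "pt e A (enc_list e1) xs" "\<And>a. a \<in> A \<Longrightarrow> xs a \<noteq> []"
  shows "rt e A (enc_pair e1 (enc_list e1)) (\<lambda>a. select_pmf (xs a))"
proof -
  \<comment> \<open>The state holds the prefix, the current suffix and the selections found so far,
    so the rest belonging to each entry is available in a single pass.\<close>
  let ?f = "\<lambda>x s. (fst s @ [x], tl (fst (snd s)), snd (snd s) @ [(x, fst s @ tl (fst (snd s)))])"
  have f: "fold ?f (take i us) ([], us, []) = (take i us, drop i us, take i (selections us))" if "i \<le> length us" for us :: "'b list" and i
    using that
  proof (induction i)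
    case (Suc i)
    have "selections us ! i = (us ! i, take i us @ drop (Suc i) us)" using Suc.prems by (simp add: selections_def)
    with Suc show ?case by (simp add: take_Suc_conv_app_nth drop_Suc tl_drop)
  qed simp
  let ?el = "enc_list e1" and ?es = "enc_list (enc_pair e1 (enc_list e1))"
  have sel: "pt ?el UNIV ?es (\<lambda>us. snd (snd (fold ?f us ([], us, []))))"
  proof (rule pt_snd, rule pt_snd, rule pt_fold[where g = "\<lambda>n. 2 * n + 2 + n * Suc (2 * n + 1)"])
    show "pt (enc_pair ?el (enc_pair e1 (enc_pair ?el (enc_pair ?el ?es))))
     {(a, x, s). a \<in> UNIV \<and> (\<exists>i<length a. x = a ! i \<and> s = fold ?f (take i a) ([], a, []))} (enc_pair ?el (enc_pair ?el ?es))
     (\<lambda>y. ?f (fst (snd y)) (snd (snd y)))"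
      by (rule pt_intros)+
    fix us :: "'b list" and i assume i: "i \<le> length us"
    let ?n = "size (?el us)"
    have "size (?es (take i (selections us))) \<le> ?n * Suc (2 * ?n + 1)"
    proof (rule size_enc_list_le)
      show "length (take i (selections us)) \<le> ?n" using i length_le_size_enc_list[of us e1] by simp
      fix p assume "p \<in> set (take i (selections us))"
      then obtain j where "j < length us" "p = (us ! j, take j us @ drop (Suc j) us)"
        by (auto simp: selections_def dest!: in_set_takeD)
      then show "size (enc_pair e1 ?el p) \<le> 2 * ?n + 1"
        using size_le_size_enc_list[of "us ! j" us e1] arg_cong[OF id_take_nth_drop[of j us], of "\<lambda>x. size (?el x)"] by simp
    qed
    then show "size (enc_pair ?el (enc_pair ?el ?es) (fold ?f (take i us) ([], us, []))) \<le> 2 * ?n + 2 + ?n * Suc (2 * ?n + 1)"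
      using size_enc_take[of e1 i us] size_enc_drop[of e1 i us] by (simp add: f[OF i])
  qed (rule pt_intros pb_intros)+
  have "snd (snd (fold ?f us ([], us, []))) = selections us" for us :: "'b list"
    using f[of "length us" us] by simp
  with sel have "pt ?el UNIV ?es selections" by simp
  from pt_comp[OF this assms(1)] have "pt e A ?es (\<lambda>a. selections (xs a))" by simp
  from rt_choose[OF this] assms(2) show ?thesis
    unfolding select_pmf_def by (auto simp: selections_def)
qed

text \<open>Moving an entry from the remaining to the chosen ones preserves the total size, which
  bounds the state of the loop.\<close>

lemma rt_sample_pmf:
  assumes "pt e A unary k" "pt e A (enc_list e1) xs" "\<And>a. a \<in> A \<Longrightarrow> k a \<le> length (xs a)"
  shows "rt e A (enc_list e1) (\<lambda>a. sample_pmf (k a) (xs a))"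
proof -
  let ?f = "\<lambda>s. map_pmf (\<lambda>p. (fst p # fst s, snd p)) (select_pmf (snd s))"
  have f: "map_pmf fst (fold_pmf (\<lambda>_. ?f) us (acc, ys)) = map_pmf (\<lambda>zs. rev zs @ acc) (sample_pmf (length us) ys)"
    for us :: "nat list" and acc ys :: "'b list"
  proof (induction us arbitrary: acc ys)
    case (Cons u us)
    show ?case by (simp add: map_bind_pmf bind_map_pmf Cons.IH pmf.map_comp o_def)
  qed simp
  let ?e = "enc_pair unary (enc_list e1)" and ?es = "enc_pair (enc_list e1) (enc_list e1)"
  let ?A = "{p. fst p \<le> length (snd p)} :: (nat \<times> 'b list) set"
  have "rt ?e ?A ?es (\<lambda>p. fold_pmf (\<lambda>_. ?f) [0..<fst p] ([], snd p))"
  proof (rule rt_fold[where g = "\<lambda>n. Suc n" and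
        S = "\<lambda>p i. {s. length (snd s) = length (snd p) - i \<and>
          size (enc_list e1 (fst s)) + size (enc_list e1 (snd s)) = size (enc_list e1 (snd p))}"])
    show "pt ?e ?A (enc_list (\<lambda>_. Atom)) (\<lambda>a. [0..<fst a])" by (rule pt_upt pt_intros)+
    let ?D = "{(a, x, s). a \<in> ?A \<and> (\<exists>i<length [0..<fst a]. x = [0..<fst a] ! i \<and> s \<in> {s. length (snd s) = length (snd a) - i \<and>
          size (enc_list e1 (fst s)) + size (enc_list e1 (snd s)) = size (enc_list e1 (snd a))})}"
    show "rt (enc_pair ?e (enc_pair (\<lambda>_. Atom) ?es)) ?D ?es (\<lambda>y. ?f (snd (snd y)))"
      by (rule rt_map, rule rt_select_pmf; (rule pt_intros | force)+)
    fix a :: "nat \<times> 'b list" and i and s :: "'b list \<times> 'b list"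
    assume a: "a \<in> ?A" "i < length [0..<fst a]" and s: "s \<in> {s. length (snd s) = length (snd a) - i \<and>
          size (enc_list e1 (fst s)) + size (enc_list e1 (snd s)) = size (enc_list e1 (snd a))}"
    then have ne: "snd s \<noteq> []" by auto
    show "set_pmf (?f s) \<subseteq> {s. length (snd s) = length (snd a) - Suc i \<and>
          size (enc_list e1 (fst s)) + size (enc_list e1 (snd s)) = size (enc_list e1 (snd a))}"
    proof
      fix s' assume "s' \<in> set_pmf (?f s)"
      then obtain j where j: "j < length (snd s)" "s' = (snd s ! j # fst s, take j (snd s) @ drop (Suc j) (snd s))"
        by (auto simp: set_select_pmf[OF ne] selections_def)
      then show "s' \<in> {s. length (snd s) = length (snd a) - Suc i \<and>
          size (enc_list e1 (fst s)) + size (enc_list e1 (snd s)) = size (enc_list e1 (snd a))}"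
        using s arg_cong[OF id_take_nth_drop[of j "snd s"], of "\<lambda>x. size (enc_list e1 x)"] by simp
    qed
  next
    fix a :: "nat \<times> 'b list" and i and s :: "'b list \<times> 'b list"
    assume "s \<in> {s. length (snd s) = length (snd a) - i \<and>
          size (enc_list e1 (fst s)) + size (enc_list e1 (snd s)) = size (enc_list e1 (snd a))}"
    then show "size (?es s) \<le> Suc (size (?e a))" by (cases s; cases a) auto
  qed (rule pt_intros pb_intros | force)+
  then have "rt ?e ?A (enc_list e1) (\<lambda>p. map_pmf (\<lambda>s. rev (fst s)) (fold_pmf (\<lambda>_. ?f) [0..<fst p] ([], snd p)))"
    by (rule rt_map) (rule pt_intros)+
  moreover have "map_pmf (\<lambda>s. rev (fst s)) (fold_pmf (\<lambda>_. ?f) [0..<n] ([], ys)) = sample_pmf n ys" for n and ys :: "'b list"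
  proof -
    have "map_pmf (\<lambda>s. rev (fst s)) (fold_pmf (\<lambda>_. ?f) [0..<n] ([], ys)) = map_pmf rev (map_pmf fst (fold_pmf (\<lambda>_. ?f) [0..<n] ([], ys)))"
      by (simp add: pmf.map_comp o_def)
    then show ?thesis unfolding f by (simp add: pmf.map_comp o_def)
  qed
  ultimately have "rt ?e ?A (enc_list e1) (\<lambda>p. sample_pmf (fst p) (snd p))" by simp
  from rt_comp[OF this pt_pair[OF assms(1,2)]] assms(3) show ?thesis by simp
qed

section \<open>The simulator\<close>

definition split_targets :: "bool list \<Rightarrow> bool \<Rightarrow> bits list" where
  "split_targets tg c = map fst (filter (\<lambda>p. snd p = c) (zip (map (item_id (length tg)) [0..<length tg]) tg))"

text \<open>This is \<open>standardize\<close> on identifiers instead of numbers. The comparison of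
  the two lengths and their difference are both expressed by \<open>drop\<close>.\<close>

definition standardize_ids :: "bits list \<Rightarrow> bool list \<Rightarrow> bits list pmf" where
  "standardize_ids gs tg =
     (if drop (length gs) (split_targets tg True) = []
      then map_pmf (\<lambda>ids. split_targets tg True @ ids)
             (sample_pmf (length (drop (length (split_targets tg True)) gs)) (split_targets tg False))
      else sample_pmf (length gs) (split_targets tg True))"

lemma split_targets_eq:
  "split_targets (map (\<lambda>j. j \<in> T) [0..<m]) c = map (item_id m) (filter (\<lambda>j. (j \<in> T) = c) [0..<m])"
  by (simp add: split_targets_def zip_map_map zip_same_conv_map filter_map o_def)

lemma length_split_targets: "length (split_targets tg True) + length (split_targets tg False) = length tg"
  using sum_length_filter_compl[of snd "zip (map (item_id (length tg)) [0..<length tg]) tg"]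
  by (simp add: split_targets_def)

lemma length_split_targets_mem: "x \<in> set (split_targets tg c) \<Longrightarrow> length x = id_length (length tg)"
  by (auto simp: split_targets_def item_id_def dest!: set_zip_leftD)

lemma set_sample_pmf: "k \<le> length xs \<Longrightarrow> ys \<in> set_pmf (sample_pmf k xs) \<Longrightarrow> set ys \<subseteq> set xs"
proof (induction k arbitrary: xs ys)
  case (Suc k)
  then have "xs \<noteq> []" by auto
  with Suc.prems(2) obtain p zs where p: "p \<in> set (selections xs)" "zs \<in> set_pmf (sample_pmf k (snd p))" "ys = fst p # zs"
    by (auto simp: set_select_pmf)
  then have "set zs \<subseteq> set (snd p)" using Suc.IH[of "snd p" zs] Suc.prems(1) snd_selections_nonempty[OF p(1)] by simp
  moreover have "set (snd p) \<subseteq> set xs" "fst p \<in> set xs"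
    using p(1) by (auto simp: selections_def dest: in_set_takeD in_set_dropD)
  ultimately show ?case using p(3) by auto
qed simp

text \<open>The keys of members are well formed for evaluation at the items only if the identifiers
  have the common length, so the support of the sampler matters for the running time.\<close>

lemma set_standardize_ids:
  assumes "length gs \<le> length tg" "ids \<in> set_pmf (standardize_ids gs tg)" "x \<in> set ids"
  shows "length x = id_length (length tg)"
proof -
  let ?T = "split_targets tg True" and ?F = "split_targets tg False"
  have "set ids \<subseteq> set ?T \<union> set ?F"
  proof (cases "drop (length gs) ?T = []")
    case True
    with assms(2) obtain ys where "ids = ?T @ ys" "ys \<in> set_pmf (sample_pmf (length (drop (length ?T) gs)) ?F)"
      unfolding standardize_ids_def by auto
    moreover have "length (drop (length ?T) gs) \<le> length ?F"
      using assms(1) length_split_targets[of tg] by (simp add: le_diff_conv)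
    ultimately show ?thesis using set_sample_pmf by fastforce
  next
    case False
    then have "ids \<in> set_pmf (sample_pmf (length gs) ?T)" "length gs \<le> length ?T"
      using assms(2) unfolding standardize_ids_def by auto
    then show ?thesis using set_sample_pmf[of "length gs" ?T ids] by blast
  qed
  then show ?thesis using assms(3) length_split_targets_mem by blast
qed

text \<open>Filtering \<open>[0..<m]\<close> yields the targets in increasing order, which is the
  order of \<open>sorted_list_of_set\<close>; the random part is transported by
  \<open>sample_pmf_map\<close>.\<close>

lemma standardize_ids_eq:
  assumes "T \<subseteq> {..<m}" "length gs \<le> m"
  shows "standardize_ids gs (map (\<lambda>j. j \<in> T) [0..<m]) = map_pmf (map (item_id m)) (standardize m (length gs) T)"
proof -
  let ?t = "filter (\<lambda>j. j \<in> T) [0..<m]" and ?f = "filter (\<lambda>j. j \<notin> T) [0..<m]"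
  have t: "set ?t = T" "set ?f = {..<m} - T" using assms(1) by auto
  have finT: "finite T" using assms(1) finite_subset by blast
  have card: "length ?t = card T" using t(1) distinct_card[of ?t] by simp
  have sum: "length ?t + length ?f = m" using sum_length_filter_compl[of "\<lambda>j. j \<in> T" "[0..<m]"] by simp
  have sorted: "sorted_list_of_set T = ?t"
    by (rule sorted_distinct_set_unique) (use t finT in \<open>auto simp: sorted_wrt_filter\<close>)
  have st: "split_targets (map (\<lambda>j. j \<in> T) [0..<m]) True = map (item_id m) ?t"
    "split_targets (map (\<lambda>j. j \<in> T) [0..<m]) False = map (item_id m) ?f"
    by (simp_all add: split_targets_eq)
  have arr: "{xs. distinct xs \<and> set xs \<subseteq> S \<and> length xs = k} = arrangements k S" for k and S :: "nat set"
    by (auto simp: arrangements_def)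
  show ?thesis
  proof (cases "card T \<le> length gs")
    case True
    then have "length gs - card T \<le> length ?f" using sum card assms(2) by linarith
    then have "sample_pmf (length gs - card T) (map (item_id m) ?f) =
        map_pmf (map (item_id m)) (pmf_of_set (arrangements (length gs - card T) ({..<m} - T)))"
      by (subst sample_pmf_map) (simp_all add: sample_pmf_eq t(2)[symmetric] del: set_filter)
    then show ?thesis using True
      unfolding standardize_ids_def standardize_def st arr sorted
      by (simp add: card pmf.map_comp o_def)
  next
    case False
    then have "sample_pmf (length gs) (map (item_id m) ?t) = map_pmf (map (item_id m)) (pmf_of_set (arrangements (length gs) T))"
      using card t(1) by (subst sample_pmf_map) (simp_all add: sample_pmf_eq del: set_filter)
    then show ?thesis using False
      unfolding standardize_ids_def standardize_def st arr sorted
      by (simp add: card)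
  qed
qed

lemma pt_split_targets:
  assumes "pt e A (enc_list enc_bool) tg" shows "pt e A (enc_list enc_bits) (\<lambda>a. split_targets (tg a) c)"
proof -
  have P: "pt (enc_pair (enc_list enc_bool) (enc_pair enc_bits enc_bool)) X enc_bool (\<lambda>y. snd (snd y) = c)" for X
    by (cases c) (simp_all, (rule pt_intros)+)
  have Z: "pt (enc_list enc_bool) UNIV (enc_list (enc_pair enc_bits enc_bool))
      (\<lambda>tg. zip (map (item_id (length tg)) [0..<length tg]) tg)"
    by (rule pt_zip[OF pt_item_ids[OF pt_id] pt_id])
  have "pt (enc_list enc_bool) UNIV (enc_list enc_bits) (\<lambda>tg. split_targets tg c)"
    unfolding split_targets_def by (rule pt_map[OF pt_filter[OF Z P]]) (rule pt_intros)+
  from pt_comp[OF this assms] show ?thesis by simp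
qed

lemma rt_standardize_ids:
  assumes "pt e A (enc_list enc_bits) gs" "pt e A (enc_list enc_bool) tg" "\<And>a. a \<in> A \<Longrightarrow> length (gs a) \<le> length (tg a)"
  shows "rt e A (enc_list enc_bits) (\<lambda>a. standardize_ids (gs a) (tg a))"
proof -
  let ?e = "enc_pair (enc_list enc_bits) (enc_list enc_bool)"
  let ?A = "{p. length (fst p) \<le> length (snd p)} :: (bits list \<times> bool list) set"
  have t: "pt ?e A' (enc_list enc_bits) (\<lambda>p. split_targets (snd p) c)" for A' c
    by (rule pt_split_targets) (rule pt_intros)+
  have c: "pt ?e ?A enc_bool (\<lambda>p. \<not> (drop (length (fst p)) (split_targets (snd p) True) \<noteq> []))"
    by (rule t pt_intros)+
  have "rt ?e ?A (enc_list enc_bits) (\<lambda>p. standardize_ids (fst p) (snd p))"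
    unfolding standardize_ids_def
  proof (rule rt_if)
    show "pt ?e ?A enc_bool (\<lambda>p. drop (length (fst p)) (split_targets (snd p) True) = [])" using c by simp
    show "rt ?e {p \<in> ?A. drop (length (fst p)) (split_targets (snd p) True) = []} (enc_list enc_bits)
      (\<lambda>p. map_pmf (\<lambda>ids. split_targets (snd p) True @ ids)
         (sample_pmf (length (drop (length (split_targets (snd p) True)) (fst p))) (split_targets (snd p) False)))"
    proof (rule rt_map, rule rt_sample_pmf)
      fix p :: "bits list \<times> bool list" assume "p \<in> {p \<in> ?A. drop (length (fst p)) (split_targets (snd p) True) = []}"
      then show "length (drop (length (split_targets (snd p) True)) (fst p)) \<le> length (split_targets (snd p) False)"
        using length_split_targets[of "snd p"] by (simp add: le_diff_conv)
    qed (rule t pt_intros pt_split_targets)+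
    show "rt ?e {p \<in> ?A. drop (length (fst p)) (split_targets (snd p) True) \<noteq> []} (enc_list enc_bits)
      (\<lambda>p. sample_pmf (length (fst p)) (split_targets (snd p) True))"
      by (rule rt_sample_pmf) (rule t pt_intros | force)+
  qed
  from rt_comp[OF this pt_pair[OF assms(1,2)]] assms(3) show ?thesis by simp
qed

section \<open>Simulating a single user, and the whole coalition\<close>

lemma fss_coins_eq: "fss_coins l = pair_pmf (uniform_bits l) (pair_pmf (uniform_bits l) (pmf_of_set UNIV))"
  by (simp add: fss_coins_def pair_pmf_def bind_assoc_pmf bind_return_pmf)

lemma rt_fss_coins: "pt e A unary l \<Longrightarrow> rt e A enc_fss_coins (\<lambda>a. fss_coins (l a))"
  unfolding fss_coins_eq enc_fss_coins_eq by (intro rt_pair rt_uniform_bits rt_coin)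

type_synonym member_data = "fss_key list \<times> bool list \<times> (bits list \<times> fss_coins list) \<times> (bits list \<times> bits list) list"

abbreviation enc_member :: "member_data \<Rightarrow> sexp" where
  "enc_member \<equiv> enc_pair (enc_list enc_key) (enc_pair (enc_list enc_bool)
     (enc_pair (enc_pair (enc_list enc_bits) (enc_list enc_fss_coins))
       (enc_list (enc_pair (enc_list enc_bits) (enc_list enc_bits)))))"

type_synonym user_env = "nat \<times> bits list \<times> bool \<times> int list list \<times> bool \<times> bool list"

abbreviation enc_user_env :: "user_env \<Rightarrow> sexp" where
  "enc_user_env \<equiv> enc_pair unary (enc_pair (enc_list enc_bits) (enc_pair enc_bool
     (enc_pair (enc_list (enc_list enc_int)) (enc_pair enc_bool (enc_list enc_bool)))))"

context secemb
begin

definition user_envs :: "user_env set" where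
  "user_envs = {(l, gs, b, qs, c, tg). set gs \<subseteq> \<D> \<and> length gs \<le> length qs \<and> (c \<longrightarrow> length tg = length qs)}"

definition member_data :: "bool \<Rightarrow> bits list \<Rightarrow> int list list \<Rightarrow> bool list \<Rightarrow> bits list \<Rightarrow> fss_coins list \<Rightarrow> member_data" where
  "member_data b gs qs tg ids coins =
     (let Z = zip gs (zip ids coins);
          resp = (\<lambda>c p. response c (fst p) (party_key c (fst p) (fst (snd p)) (snd (snd p))) qs (item_ids (length qs)))
      in (map (\<lambda>p. party_key b (fst p) (fst (snd p)) (snd (snd p))) Z, tg, (ids, coins), map (\<lambda>p. (resp False p, resp True p)) Z))"

text \<open>Each key is recomputed from its coins and evaluated on all items for both servers. The
  condition guarantees well-formed keys, and at least one row whenever a key is present.\<close>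

lemma pt_member_data:
  assumes "pt e A enc_bool b" "pt e A (enc_list enc_bits) gs" "pt e A (enc_list (enc_list enc_int)) qs"
    "pt e A (enc_list enc_bool) tg" "pt e A (enc_list enc_bits) ids" "pt e A (enc_list enc_fss_coins) coins"
    "\<And>a. a \<in> A \<Longrightarrow> set (gs a) \<subseteq> \<D> \<and> length (gs a) \<le> length (qs a) \<and> (\<forall>x\<in>set (ids a). length x = id_length (length (qs a))) \<and>
      (\<forall>co\<in>set (coins a). length (fst co) = length (fst (snd co)))"
  shows "pt e A enc_member (\<lambda>a. member_data (b a) (gs a) (qs a) (tg a) (ids a) (coins a))"
proof -
  let ?e = "enc_pair enc_bool (enc_pair (enc_list enc_bits) (enc_pair (enc_list (enc_list enc_int)) (enc_pair (enc_list enc_bits) (enc_list enc_fss_coins))))"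
  define W where "W = {p :: bool \<times> bits list \<times> int list list \<times> bits list \<times> fss_coins list.
    set (fst (snd p)) \<subseteq> \<D> \<and> length (fst (snd p)) \<le> length (fst (snd (snd p))) \<and>
    (\<forall>x\<in>set (fst (snd (snd (snd p)))). length x = id_length (length (fst (snd (snd p))))) \<and>
    (\<forall>co\<in>set (snd (snd (snd (snd p)))). length (fst co) = length (fst (snd co)))}"
  let ?Z = "\<lambda>p :: bool \<times> bits list \<times> int list list \<times> bits list \<times> fss_coins list. zip (fst (snd p)) (zip (fst (snd (snd (snd p)))) (snd (snd (snd (snd p)))))"
  have Z: "pt ?e W (enc_list (enc_pair enc_bits (enc_pair enc_bits enc_fss_coins))) ?Z"
    by (rule pt_intros)+
  have mem: "fst q \<in> \<D> \<and> length (fst (snd q)) = id_length (length (fst (snd (snd p)))) \<and>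
      length (fst (snd (snd q))) = length (fst (snd (snd (snd q)))) \<and> fst (snd (snd p)) \<noteq> []"
    if p: "p \<in> W" and q: "q \<in> set (?Z p)" for p q
  proof -
    obtain d x co where "q = (d, x, co)" by (cases q) auto
    with q have q': "q = (d, x, co)" "d \<in> set (fst (snd p))" "x \<in> set (fst (snd (snd (snd p))))" "co \<in> set (snd (snd (snd (snd p))))"
      by (auto dest: set_zip_leftD set_zip_rightD)
    then have "fst (snd p) \<noteq> []" by auto
    with p q' show ?thesis unfolding W_def by auto
  qed
  let ?D = "{(p, q). p \<in> W \<and> q \<in> set (?Z p)}"
  have key: "pt (enc_pair ?e (enc_pair enc_bits (enc_pair enc_bits enc_fss_coins))) ?D enc_key
      (\<lambda>y. party_key (c (fst y)) (fst (snd y)) (fst (snd (snd y))) (snd (snd (snd y))))"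
    if "pt (enc_pair ?e (enc_pair enc_bits (enc_pair enc_bits enc_fss_coins))) ?D enc_bool (\<lambda>y. c (fst y))" for c
  proof (rule pt_party_key[OF that])
    fix y assume "y \<in> ?D"
    then show "fst (snd y) \<in> \<D> \<and> length (fst (snd (snd (snd y)))) = length (fst (snd (snd (snd (snd y)))))"
      using mem[of "fst y" "snd y"] by (cases y) auto
  qed (rule pt_intros)+
  have keys: "pt ?e W (enc_list enc_key) (\<lambda>p. map (\<lambda>q. party_key (fst p) (fst q) (fst (snd q)) (snd (snd q))) (?Z p))"
    by (rule pt_map[OF Z], rule key) (rule pt_intros)+
  have resp: "pt (enc_pair ?e (enc_pair enc_bits (enc_pair enc_bits enc_fss_coins))) ?D (enc_list enc_bits)
      (\<lambda>y. response c (fst (snd y)) (party_key c (fst (snd y)) (fst (snd (snd y))) (snd (snd (snd y))))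
        (fst (snd (snd (fst y)))) (item_ids (length (fst (snd (snd (fst y)))))))" for c
  proof (rule pt_response[OF pt_const _ key[OF pt_const]])
    show "pt (enc_pair ?e (enc_pair enc_bits (enc_pair enc_bits enc_fss_coins))) ?D (enc_list enc_bits)
       (\<lambda>y. item_ids (length (fst (snd (snd (fst y))))))"
      unfolding item_ids_def by (rule pt_item_ids) (rule pt_intros)+
    fix y assume y: "y \<in> ?D"
    have m: "fst (snd y) \<in> \<D> \<and> length (fst (snd (snd y))) = id_length (length (fst (snd (snd (fst y))))) \<and>
      length (fst (snd (snd (snd y)))) = length (fst (snd (snd (snd (snd y))))) \<and> fst (snd (snd (fst y))) \<noteq> []"
      using mem[of "fst y" "snd y"] y by (cases y) auto
    then have "well_formed_key (fst (snd y)) (length (fst (snd (snd y)))) (party_key c (fst (snd y)) (fst (snd (snd y))) (snd (snd (snd y))))"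
      by (intro well_formed_party_key) auto
    with m show "fst (snd y) \<in> \<D> \<and> fst (snd (snd (fst y))) \<noteq> [] \<and>
      (\<forall>x\<in>set (item_ids (length (fst (snd (snd (fst y)))))). well_formed_key (fst (snd y)) (length x)
        (party_key c (fst (snd y)) (fst (snd (snd y))) (snd (snd (snd y)))))"
      by (auto simp: item_ids_def)
  qed (rule pt_intros)+
  have resps: "pt ?e W (enc_list (enc_pair (enc_list enc_bits) (enc_list enc_bits)))
      (\<lambda>p. map (\<lambda>q. (response False (fst q) (party_key False (fst q) (fst (snd q)) (snd (snd q))) (fst (snd (snd p))) (item_ids (length (fst (snd (snd p))))),
        response True (fst q) (party_key True (fst q) (fst (snd q)) (snd (snd q))) (fst (snd (snd p))) (item_ids (length (fst (snd (snd p))))))) (?Z p))"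
    by (rule pt_map[OF Z], rule pt_pair[OF resp resp])
  have tup: "pt e A ?e (\<lambda>a. (b a, gs a, qs a, ids a, coins a))"
    by (intro pt_pair assms)
  have in_W: "(b a, gs a, qs a, ids a, coins a) \<in> W" if "a \<in> A" for a
    using assms(7)[OF that] by (simp add: W_def)
  from pt_comp[OF keys tup in_W] pt_comp[OF resps tup in_W] assms(4-6) show ?thesis
    unfolding member_data_def Let_def by (intro pt_pair) simp_all
qed

text \<open>The first component is the row of keys for the corrupted server, the second the view of
  the user, or \<open>Atom\<close> outside the coalition. For members the protocol is run honestly
  on their true targets.\<close>

definition simulated_user :: "user_env \<Rightarrow> sexp pmf" where
  "simulated_user = (\<lambda>(l, gs, b, qs, c, tg).
     if c then map_pmf (\<lambda>p. enc_member (member_data b gs qs tg (fst p) (snd p)))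
                 (pair_pmf (standardize_ids gs tg) (replicate_pmf (length gs) (fss_coins l)))
     else map_pmf (\<lambda>ks. Cell (enc_list enc_key ks) Atom)
            (sequence_pmf (map (\<lambda>d. sim_key l d (id_length (length qs))) gs)))"

lemma sim_key_eq: "sim_key l d n = map_pmf (\<lambda>p. (fst (fst (fst p)), snd (fst (fst p)), snd (fst p), Convert d (snd p)))
    (pair_pmf (prefix_pmf l n) (uniform_bits l))"
  by (simp add: sim_key_def pair_pmf_def map_bind_pmf case_prod_unfold) (simp add: map_pmf_def)

lemma rt_sim_key:
  assumes "pt e A unary l" "pt e A enc_bits d" "pt e A unary n" "\<And>a. a \<in> A \<Longrightarrow> d a \<in> \<D>"
  shows "rt e A enc_key (\<lambda>a. sim_key (l a) (d a) (n a))"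
proof -
  let ?e = "enc_pair unary (enc_pair enc_bits unary)" and ?A = "UNIV \<times> \<D> \<times> UNIV"
  have w: "rt ?e ?A enc_corr_word (\<lambda>p. corr_word_pmf (fst p))"
    unfolding corr_word_pmf_def enc_corr_word_eq by (intro rt_pair rt_uniform_bits rt_coin pt_fst0)
  have n: "pt ?e ?A unary (\<lambda>p. snd (snd p))" by (rule pt_intros)+
  have "rt ?e ?A enc_key (\<lambda>p. sim_key (fst p) (fst (snd p)) (snd (snd p)))"
    unfolding sim_key_eq
  proof (rule rt_map)
    show "rt ?e ?A (enc_pair (enc_pair enc_node (enc_list enc_corr_word)) enc_bits)
        (\<lambda>p. pair_pmf (prefix_pmf (fst p) (snd (snd p))) (uniform_bits (fst p)))"
      unfolding prefix_pmf_def by (intro rt_pair rt_uniform_bits rt_coin pt_fst0 rt_replicate_pmf w n)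
    show "pt (enc_pair ?e (enc_pair (enc_pair enc_node (enc_list enc_corr_word)) enc_bits))
      {(p, x). p \<in> ?A \<and> x \<in> set_pmf (pair_pmf (prefix_pmf (fst p) (snd (snd p))) (uniform_bits (fst p)))} enc_key
      (\<lambda>y. (fst (fst (fst (snd y))), snd (fst (fst (snd y))), snd (fst (snd y)), Convert (fst (snd (fst y))) (snd (snd y))))"
      unfolding enc_key_eq by (rule pt_intros pt_Convert | force)+
  qed
  from rt_comp[OF this pt_pair[OF assms(1) pt_pair[OF assms(2,3)]]] assms(4) show ?thesis by simp
qed

lemma rt_simulated_user: "rt enc_user_env user_envs id simulated_user"
proof -
  let ?e = enc_user_env
  let ?id = "\<lambda>x :: user_env. id_length (length (fst (snd (snd (snd x)))))"
  \<comment> \<open>The identifier length in unary is the length of the first identifier; without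
    items it is 0.\<close>
  have nid: "pt ?e A unary ?id" for A
  proof -
    let ?ids = "\<lambda>x :: user_env. map (item_id (length (fst (snd (snd (snd x)))))) [0..<length (fst (snd (snd (snd x))))]"
    have ids: "pt ?e A (enc_list enc_bits) ?ids" for A by (rule pt_item_ids) (rule pt_intros)+
    have "pt ?e A unary (\<lambda>x. if ?ids x \<noteq> [] then length (hd (?ids x)) else 0)"
    proof (rule pt_if)
      show "pt ?e {x \<in> A. ?ids x \<noteq> []} unary (\<lambda>x. length (hd (?ids x)))"
        by (rule pt_length, rule pt_hd, rule ids) simp
    qed (rule ids pt_intros)+
    then show ?thesis
    proof (rule pt_cong)
      fix x :: user_env
      show "(if ?ids x \<noteq> [] then length (hd (?ids x)) else 0) = ?id x"
        using id_length_le[of 0] by (auto simp: hd_map)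
    qed
  qed
  have "rt ?e user_envs id (\<lambda>x. if fst (snd (snd (snd (snd x))))
     then map_pmf (\<lambda>p. enc_member (member_data (fst (snd (snd x))) (fst (snd x)) (fst (snd (snd (snd x)))) (snd (snd (snd (snd (snd x))))) (fst p) (snd p)))
        (pair_pmf (standardize_ids (fst (snd x)) (snd (snd (snd (snd (snd x)))))) (replicate_pmf (length (fst (snd x))) (fss_coins (fst x))))
     else map_pmf (\<lambda>ks. Cell (enc_list enc_key ks) Atom) (sequence_pmf (map (\<lambda>d. sim_key (fst x) d (?id x)) (fst (snd x)))))"
  proof (rule rt_if)
    show "pt ?e user_envs enc_bool (\<lambda>x. fst (snd (snd (snd (snd x)))))" by (rule pt_intros)+
    let ?C = "{x \<in> user_envs. fst (snd (snd (snd (snd x))))}"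
    let ?F = "\<lambda>x :: user_env. pair_pmf (standardize_ids (fst (snd x)) (snd (snd (snd (snd (snd x)))))) (replicate_pmf (length (fst (snd x))) (fss_coins (fst x)))"
    have coins: "rt ?e ?C (enc_list enc_fss_coins) (\<lambda>x. replicate_pmf (length (fst (snd x))) (fss_coins (fst x)))"
      by (rule rt_replicate_pmf rt_fss_coins | (rule pt_intros)+)+
    have std: "rt ?e ?C (enc_list enc_bits) (\<lambda>x. standardize_ids (fst (snd x)) (snd (snd (snd (snd (snd x))))))"
    proof (rule rt_standardize_ids)
      fix x assume "x \<in> ?C"
      then show "length (fst (snd x)) \<le> length (snd (snd (snd (snd (snd x)))))"
        by (auto simp: user_envs_def)
    qed (rule pt_intros)+
    show "rt ?e ?C id (\<lambda>x. map_pmf (\<lambda>p. enc_member (member_data (fst (snd (snd x))) (fst (snd x)) (fst (snd (snd (snd x)))) (snd (snd (snd (snd (snd x))))) (fst p) (snd p))) (?F x))"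
    proof (rule rt_map[OF rt_pair[OF std coins]], rule pt_encode[where ?e1.0 = enc_member], rule pt_member_data)
      fix y assume "y \<in> {(x, p). x \<in> ?C \<and> p \<in> set_pmf (?F x)}"
      then obtain l gs b qs tg ids coins where y: "y = ((l, gs, b, qs, True, tg), (ids, coins))"
        and gs: "set gs \<subseteq> \<D>" "length gs \<le> length qs" "length tg = length qs"
        and ids: "ids \<in> set_pmf (standardize_ids gs tg)" and coins: "coins \<in> set_pmf (replicate_pmf (length gs) (fss_coins l))"
        by (auto simp: user_envs_def)
      show "set (fst (snd (fst y))) \<subseteq> \<D> \<and> length (fst (snd (fst y))) \<le> length (fst (snd (snd (snd (fst y))))) \<and>
         (\<forall>x\<in>set (fst (snd y)). length x = id_length (length (fst (snd (snd (snd (fst y))))))) \<and>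
         (\<forall>co\<in>set (snd (snd y)). length (fst co) = length (fst (snd co)))"
        using gs set_standardize_ids[OF _ ids] coins
        by (auto simp: y set_replicate_pmf lists_eq_set fss_coins_eq)
    qed (rule pt_intros)+
    let ?C' = "{x \<in> user_envs. \<not> fst (snd (snd (snd (snd x))))}"
    have keys: "rt ?e ?C' (enc_list enc_key) (\<lambda>x. sequence_pmf (map (\<lambda>d. sim_key (fst x) d (?id x)) (fst (snd x))))"
    proof (rule rt_mapM)
      show "rt (enc_pair ?e enc_bits) {(x, d). x \<in> ?C' \<and> d \<in> set (fst (snd x))} enc_key
          (\<lambda>y. sim_key (fst (fst y)) (snd y) (?id (fst y)))"
      proof (rule rt_sim_key)
        show "pt (enc_pair ?e enc_bits) {(x, d). x \<in> ?C' \<and> d \<in> set (fst (snd x))} unary (\<lambda>y. ?id (fst y))"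
          by (rule pt_comp[OF nid[of UNIV]]) (rule pt_intros | simp)+
        fix y assume "y \<in> {(x, d). x \<in> ?C' \<and> d \<in> set (fst (snd x))}"
        then show "snd y \<in> \<D>" by (auto simp: user_envs_def)
      qed (rule pt_intros)+
    qed (rule pt_intros)+
    show "rt ?e ?C' id (\<lambda>x. map_pmf (\<lambda>ks. Cell (enc_list enc_key ks) Atom) (sequence_pmf (map (\<lambda>d. sim_key (fst x) d (?id x)) (fst (snd x)))))"
      by (rule rt_map[OF keys], rule pt_cong[where f = "\<lambda>y. enc_pair (enc_list enc_key) id (snd y, Atom)"], rule pt_encode)
        ((rule pt_intros)+, simp)
  qed
  then show ?thesis by (rule rt_cong) (auto simp: simulated_user_def)
qed

type_synonym sim_env = "nat \<times> (nat \<times> bits list) \<times> bool \<times> int list list \<times> (bool \<times> bool list) list"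

abbreviation enc_sim_env :: "sim_env \<Rightarrow> sexp" where
  "enc_sim_env \<equiv> enc_pair unary (enc_pair (enc_pair unary (enc_list enc_bits)) (enc_pair enc_bool
     (enc_pair (enc_list (enc_list enc_int)) (enc_list (enc_pair enc_bool (enc_list enc_bool))))))"

text \<open>Views are grouped by party, samples by user. The regrouping is deterministic, so users
  can be replaced one at a time before it.\<close>

definition assemble :: "int list list \<Rightarrow> bool list \<Rightarrow> sexp list \<Rightarrow> sexp" where
  "assemble qs flags comps = Cell (Cell (enc_list (enc_list enc_int) qs) (enc_list id (map car comps)))
     (enc_list id (map (\<lambda>p. cdr (fst p)) (filter snd (zip comps flags))))"

lemma pt_assemble:
  assumes "pt e A (enc_list (enc_list enc_int)) qs" "pt e A (enc_list enc_bool) flags" "pt e A (enc_list id) comps"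
  shows "pt e A id (\<lambda>a. assemble (qs a) (flags a) (comps a))"
proof -
  have car: "pt e' A' id (\<lambda>a. car (f a))" and cdr: "pt e' A' id (\<lambda>a. cdr (f a))" if "pt e' A' id f" for e' :: "'z \<Rightarrow> sexp" and A' f
  proof -
    have "pt id UNIV id car" "pt id UNIV id cdr"
      by (rule ptI[where p = Car and g = Suc], intro pb_intros, simp add: halts_in_Car)
        (rule ptI[where p = Cdr and g = Suc], intro pb_intros, simp add: halts_in_Cdr)
    from this[THEN pt_comp, OF that] show "pt e' A' id (\<lambda>a. car (f a))" "pt e' A' id (\<lambda>a. cdr (f a))" by auto
  qed
  have 1: "pt e A (enc_list id) (\<lambda>a. map car (comps a))"
    by (rule pt_map[OF assms(3)], rule car) (rule pt_intros)+
  have 2: "pt e A (enc_list (enc_pair id enc_bool)) (\<lambda>a. filter snd (zip (comps a) (flags a)))"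
    by (rule pt_filter[OF pt_zip[OF assms(3,2)]]) (rule pt_intros)+
  have 3: "pt e A (enc_list id) (\<lambda>a. map (\<lambda>p. cdr (fst p)) (filter snd (zip (comps a) (flags a))))"
    by (rule pt_map[OF 2], rule cdr) (rule pt_intros)+
  show ?thesis
    using pt_encode[OF pt_pair[OF pt_pair[OF assms(1) 1] 3]] by (simp add: assemble_def)
qed

definition simulate :: "sim_env \<Rightarrow> sexp pmf" where
  "simulate = (\<lambda>(l, (m, gs), b, qs, us). map_pmf (assemble qs (map fst us))
     (sequence_pmf (map (\<lambda>u. simulated_user (l, gs, b, qs, u)) us)))"

definition sim_envs :: "sim_env set" where
  "sim_envs = {(l, (m, gs), b, qs, us). \<forall>u\<in>set us. (l, gs, b, qs, u) \<in> user_envs}"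

lemma rt_simulate: "rt enc_sim_env sim_envs id simulate"
proof -
  let ?e = enc_sim_env
  let ?us = "\<lambda>x :: sim_env. snd (snd (snd (snd x)))" and ?qs = "\<lambda>x :: sim_env. fst (snd (snd (snd x)))"
  let ?comps = "\<lambda>x :: sim_env. sequence_pmf (map (\<lambda>u. simulated_user (fst x, snd (fst (snd x)), fst (snd (snd x)), ?qs x, u)) (?us x))"
  have comps: "rt ?e sim_envs (enc_list id) ?comps"
  proof (rule rt_mapM)
    show "rt (enc_pair ?e (enc_pair enc_bool (enc_list enc_bool))) {(x, u). x \<in> sim_envs \<and> u \<in> set (?us x)} id
        (\<lambda>y. simulated_user (fst (fst y), snd (fst (snd (fst y))), fst (snd (snd (fst y))), ?qs (fst y), snd y))"
      by (rule rt_comp[OF rt_simulated_user]) ((rule pt_intros)+, force simp: sim_envs_def)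
  qed (rule pt_intros)+
  have "rt ?e sim_envs id (\<lambda>x. map_pmf (assemble (?qs x) (map fst (?us x))) (?comps x))"
  proof (rule rt_map[OF comps], rule pt_assemble)
    show "pt (enc_pair ?e (enc_list id)) {(x, cs). x \<in> sim_envs \<and> cs \<in> set_pmf (?comps x)} (enc_list enc_bool) (\<lambda>y. map fst (?us (fst y)))"
      by (rule pt_map) (rule pt_intros)+
  qed (rule pt_intros)+
  then show ?thesis by (rule rt_cong) (auto simp: simulate_def)
qed

end

section \<open>Indistinguishability of the views\<close>

lemma sequence_pmf_map: "sequence_pmf (map (\<lambda>q. map_pmf (f q) (F q)) qs) = map_pmf (map2 f qs) (sequence_pmf (map F qs))"
  by (induction qs) (simp_all add: bind_map_pmf map_bind_pmf)

lemma sequence_pmf_map_const: "sequence_pmf (map (\<lambda>q. map_pmf g (F q)) qs) = map_pmf (map g) (sequence_pmf (map F qs))"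
  by (induction qs) (simp_all add: bind_map_pmf map_bind_pmf)

lemma map2_upt: "length ys = n \<Longrightarrow> map2 f [0..<n] ys = map (\<lambda>i. f i (ys ! i)) [0..<n]"
  by (rule nth_equalityI) auto

text \<open>Members and nonmembers of the coalition need different arguments; the two bounds are
  added.\<close>

lemma unif_indist_Un:
  assumes "unif_indist Q1 X Y" "unif_indist Q2 X Y" "\<And>l. Q l \<subseteq> Q1 l \<union> Q2 l"
  shows "unif_indist Q X Y"
  unfolding unif_indist_def
proof (intro allI impI)
  fix z D assume D: "distinguisher z D"
  obtain \<epsilon>1 where e1: "negligible \<epsilon>1" "\<And>l q. q \<in> Q1 l \<Longrightarrow> adv D l (z l) (X l q) (Y l q) \<le> \<epsilon>1 l"
    using assms(1) D unfolding unif_indist_def by blast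
  obtain \<epsilon>2 where e2: "negligible \<epsilon>2" "\<And>l q. q \<in> Q2 l \<Longrightarrow> adv D l (z l) (X l q) (Y l q) \<le> \<epsilon>2 l"
    using assms(2) D unfolding unif_indist_def by blast
  have "negligible (\<lambda>l. \<bar>\<epsilon>1 l\<bar> + \<bar>\<epsilon>2 l\<bar>)"
    by (intro negligible_add) (simp_all add: negligible_abs e1 e2)
  moreover have "adv D l (z l) (X l q) (Y l q) \<le> \<bar>\<epsilon>1 l\<bar> + \<bar>\<epsilon>2 l\<bar>" if "q \<in> Q l" for l q
  proof -
    have "q \<in> Q1 l \<or> q \<in> Q2 l" using that assms(3) by blast
    then show ?thesis using e1(2)[of q l] e2(2)[of q l] by fastforce
  qed
  ultimately show "\<exists>\<epsilon>. negligible \<epsilon> \<and> (\<forall>l. \<forall>q\<in>Q l. adv D l (z l) (X l q) (Y l q) \<le> \<epsilon> l)" by blast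
qed

section \<open>Rows of keys sent by users outside the coalition\<close>

context secemb
begin

text \<open>The list hybrid turns the other entries into advice, so samples of both kinds must have
  polynomial size; well-formedness gives this for real and simulated keys alike.\<close>

lemma key_size:
  assumes B: "polynomially_bounded B"
  shows "\<exists>g. polynomially_bounded g \<and> (\<forall>l. \<forall>(b, d, \<alpha>)\<in>point_params B l.
    \<forall>K\<in>set_pmf (real_key l b d \<alpha>) \<union> set_pmf (sim_key l d (length \<alpha>)). size (enc_key K) \<le> g l)"
proof -
  obtain h where h: "polynomially_bounded h" "mono h"
    "\<And>d x. d \<in> \<D> \<Longrightarrow> x \<in> carrier (G d) \<Longrightarrow> size (enc_bits x) \<le> h (size (enc_bits d))"
    using carrier_length by blast
  define g where "g l = 2 * l + 1 + B l * Suc (2 * l + 4) + h (2 * B l) + 3" for l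
  have bound: "size (enc_key K) \<le> g l"
    if q: "d \<in> \<D>" "length d \<le> B l" "length \<alpha> \<le> B l" and K: "K \<in> set_pmf (real_key l b d \<alpha>) \<union> set_pmf (sim_key l d (length \<alpha>))"
    for l b d \<alpha> K
  proof -
    obtain s t cws w where k: "K = (s, t, cws, w)" by (cases K)
    have "length (fst K) = l \<and> well_formed_key d (length \<alpha>) K"
    proof (cases "K \<in> set_pmf (real_key l b d \<alpha>)")
      case True
      then obtain s0 s1 t0 where "length s0 = l" "length s1 = l" "K = party_key b d \<alpha> (s0, s1, t0)"
        by (auto simp: real_key_def fss_coins_eq)
      then show ?thesis using well_formed_party_key[OF q(1), of "(s0, s1, t0)" \<alpha> b]
        by (auto simp: party_key_eq[OF q(1)] continue_key_def Let_def)
    next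
      case False
      then show ?thesis using K q(1)
        by (auto simp: sim_key_def set_prefix_pmf well_formed_key_def Convert_carrier)
    qed
    then have len: "length s = l" "length cws = length \<alpha>" "\<forall>cw\<in>set cws. length (fst cw) = l" "w \<in> carrier (G d)"
      by (auto simp: k well_formed_key_def)
    have "size (enc_bits w) \<le> h (size (enc_bits d))" by (rule h(3)[OF q(1) len(4)])
    also have "\<dots> \<le> h (2 * B l)" by (rule monoD[OF h(2)]) (use size_enc_bits[of d] q(2) in simp)
    finally have w: "size (enc_bits w) \<le> h (2 * B l)" .
    have "size (enc_list enc_corr_word cws) \<le> B l * Suc (2 * l + 4)"
      by (rule size_enc_corr_words) (use len q(3) in auto)
    then show ?thesis using w size_enc_bits[of s] size_enc_bool[of t] len(1) by (simp add: k g_def del: mult_Suc_right)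
  qed
  have "polynomially_bounded g"
    unfolding g_def by (intro pb_intros B polynomially_bounded_compose[OF h(1)])
  moreover have "size (enc_key K) \<le> g l" if "q \<in> point_params B l"
    "K \<in> set_pmf (real_key l (fst q) (fst (snd q)) (snd (snd q))) \<union> set_pmf (sim_key l (fst (snd q)) (length (snd (snd q))))" for l q K
    using that(1) by (intro bound[OF _ _ _ that(2)]) (simp_all add: point_params_def split_beta)
  ultimately show ?thesis unfolding split_beta by blast
qed

definition enc_row :: "fss_key list \<Rightarrow> sexp" where
  "enc_row ks = Cell (enc_list enc_key ks) Atom"

definition real_row :: "nat \<Rightarrow> bool \<Rightarrow> bits list \<Rightarrow> nat set \<Rightarrow> nat \<Rightarrow> fss_key list pmf" where
  "real_row l b gs T m = bind_pmf (standardize m (length gs) T) (\<lambda>idx.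
     sequence_pmf (map (\<lambda>i. real_key l b (gs ! i) (item_id m (idx ! i))) [0..<length gs]))"

definition sim_row :: "nat \<Rightarrow> bits list \<Rightarrow> nat \<Rightarrow> fss_key list pmf" where
  "sim_row l gs m = sequence_pmf (map (\<lambda>d. sim_key l d (id_length m)) gs)"

definition row_params :: "(nat \<Rightarrow> nat) \<Rightarrow> nat \<Rightarrow> (bool \<times> bits list \<times> nat set \<times> nat) set" where
  "row_params B l = {(b, gs, T, m). set gs \<subseteq> \<D> \<and> (\<forall>d\<in>set gs. length d \<le> B l) \<and> length gs \<le> B l \<and> m \<le> B l}"

lemma row_size:
  assumes B: "polynomially_bounded B"
  shows "\<exists>g. polynomially_bounded g \<and> (\<forall>l. \<forall>(b, gs, T, m)\<in>row_params B l. \<forall>ks\<in>set_pmf (real_row l b gs T m). size (enc_row ks) \<le> g l)"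
proof -
  obtain g where g: "polynomially_bounded g" and *: "\<And>l b d \<alpha> K. (b, d, \<alpha>) \<in> point_params B l \<Longrightarrow>
    K \<in> set_pmf (real_key l b d \<alpha>) \<Longrightarrow> size (enc_key K) \<le> g l"
    using key_size[OF B] by fastforce
  let ?g = "\<lambda>l. Suc (B l * Suc (g l))"
  have "size (enc_row ks) \<le> ?g l" if q: "(b, gs, T, m) \<in> row_params B l" and ks: "ks \<in> set_pmf (real_row l b gs T m)" for l b gs T m ks
  proof -
    from ks obtain idx where idx: "list_all2 (\<lambda>x p. x \<in> set_pmf p) ks (map (\<lambda>i. real_key l b (gs ! i) (item_id m (idx ! i))) [0..<length gs])"
      by (auto simp: real_row_def set_sequence_pmf)
    have "size (enc_list enc_key ks) \<le> B l * Suc (g l)"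
    proof (rule size_enc_list_le)
      show "length ks \<le> B l" using list_all2_lengthD[OF idx] q by (simp add: row_params_def)
      fix K assume "K \<in> set ks"
      from list_all2_map_mem[OF idx this] obtain i where "i \<in> set [0..<length gs]"
        and i': "K \<in> set_pmf (real_key l b (gs ! i) (item_id m (idx ! i)))" by blast
      then have i: "i < length gs" "K \<in> set_pmf (real_key l b (gs ! i) (item_id m (idx ! i)))" by simp_all
      then show "size (enc_key K) \<le> g l"
        using q id_length_le[of m] nth_mem[OF i(1)] by (intro *[OF _ i(2)]) (auto simp: row_params_def point_params_def)
    qed
    then show ?thesis by (simp add: enc_row_def del: mult_Suc_right)
  qed
  moreover have "polynomially_bounded ?g" by (intro pb_intros B g)
  ultimately show ?thesis by (intro exI[of _ ?g]) auto
qed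

text \<open>The random standardization is averaged out; for a fixed choice of items the list hybrid
  applies to independent keys, one per item.\<close>

lemma row_indist:
  assumes B: "polynomially_bounded B"
  shows "unif_indist (row_params B)
    (\<lambda>l (b, gs, T, m). map_pmf enc_row (real_row l b gs T m)) (\<lambda>l (b, gs, T, m). map_pmf enc_row (sim_row l gs m))"
proof -
  let ?X = "\<lambda>l q. map_pmf enc_key (real_key l (fst q) (fst (snd q)) (snd (snd q)))"
  let ?Y = "\<lambda>l q. map_pmf enc_key (sim_key l (fst (snd q)) (length (snd (snd q))))"
  let ?Qs = "\<lambda>l. {qs. set qs \<subseteq> point_params B l \<and> length qs \<le> B l}"
  obtain g where g: "polynomially_bounded g" "\<And>l b d \<alpha> K. (b, d, \<alpha>) \<in> point_params B l \<Longrightarrow>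
    K \<in> set_pmf (real_key l b d \<alpha>) \<union> set_pmf (sim_key l d (length \<alpha>)) \<Longrightarrow> size (enc_key K) \<le> g l"
    using key_size[OF B] by fastforce
  have list: "unif_indist ?Qs (\<lambda>l qs. map_pmf (enc_list id) (sequence_pmf (map (?X l) qs)))
      (\<lambda>l qs. map_pmf (enc_list id) (sequence_pmf (map (?Y l) qs)))"
  proof (rule unif_indist_list[OF key_indist[OF B] g(1) _ B])
    fix l q x assume "q \<in> point_params B l" "x \<in> set_pmf (?X l q) \<union> set_pmf (?Y l q)"
    then show "size x \<le> g l" using g(2)[of "fst q" "fst (snd q)" "snd (snd q)" l] by auto
  qed
  have post: "unif_indist (\<lambda>l. ?Qs l \<times> (UNIV :: unit set))
      (\<lambda>l p. map_pmf (\<lambda>x. Cell x Atom) (map_pmf (enc_list id) (sequence_pmf (map (?X l) (fst p)))))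
      (\<lambda>l p. map_pmf (\<lambda>x. Cell x Atom) (map_pmf (enc_list id) (sequence_pmf (map (?Y l) (fst p)))))"
  proof (rule unif_indist_post[OF list, where ea = "\<lambda>_. Atom" and B = "\<lambda>_. 0"])
    have "pt (enc_pair unary (enc_pair (\<lambda>_ :: unit. Atom) id)) X id (\<lambda>p. enc_pair id id (snd (snd p), Atom))" for X
      by (rule pt_encode) (rule pt_intros)+
    then show "pt (enc_pair unary (enc_pair (\<lambda>_. Atom) id)) {(l, a :: unit, x). a \<in> UNIV} id (\<lambda>p. Cell (snd (snd p)) Atom)"
      by simp
  qed (auto intro: pb_intros)
  let ?qs = "\<lambda>b gs m idx. map (\<lambda>i. (b, gs ! i, item_id m (idx ! i))) [0..<length gs]"
  have eq: "map_pmf (\<lambda>x. Cell x Atom) (map_pmf (enc_list id) (sequence_pmf (map (\<lambda>q. map_pmf enc_key (F q)) qs))) =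
    map_pmf enc_row (sequence_pmf (map F qs))" for F :: "bool \<times> bits \<times> bits \<Rightarrow> fss_key pmf" and qs
    unfolding sequence_pmf_map_const by (simp add: pmf.map_comp o_def enc_row_def[abs_def] enc_list_map)
  let ?idx = "\<lambda>q :: bool \<times> bits list \<times> nat set \<times> nat. standardize (snd (snd (snd q))) (length (fst (snd q))) (fst (snd (snd q)))"
  let ?R = "\<lambda>l q idx. map_pmf enc_row (sequence_pmf (map (\<lambda>q. real_key l (fst q) (fst (snd q)) (snd (snd q))) (?qs (fst q) (fst (snd q)) (snd (snd (snd q))) idx)))"
  let ?S = "\<lambda>l q idx. map_pmf enc_row (sequence_pmf (map (\<lambda>q. sim_key l (fst (snd q)) (length (snd (snd q)))) (?qs (fst q) (fst (snd q)) (snd (snd (snd q))) idx)))"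
  have "unif_indist (row_params B) (\<lambda>l q. bind_pmf (?idx q) (?R l q)) (\<lambda>l q. bind_pmf (?idx q) (?S l q))"
  proof (rule unif_indist_mix, rule unif_indist_reindex[OF post, where
        f = "\<lambda>l p. (?qs (fst (fst p)) (fst (snd (fst p))) (snd (snd (snd (fst p)))) (snd p), ())"])
    fix l p assume "p \<in> {(q, r). q \<in> row_params B l \<and> r \<in> set_pmf (?idx q)}"
    then have "fst p \<in> row_params B l" by auto
    then have "?qs (fst (fst p)) (fst (snd (fst p))) (snd (snd (snd (fst p)))) (snd p) \<in> ?Qs l"
      using id_length_le[of "snd (snd (snd (fst p)))"] by (fastforce simp: row_params_def point_params_def split_beta)
    then show "(?qs (fst (fst p)) (fst (snd (fst p))) (snd (snd (snd (fst p)))) (snd p), ()) \<in> ?Qs l \<times> UNIV \<and>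
      ?R l (fst p) (snd p) = map_pmf (\<lambda>x. Cell x Atom) (map_pmf (enc_list id) (sequence_pmf (map (?X l)
        (fst (?qs (fst (fst p)) (fst (snd (fst p))) (snd (snd (snd (fst p)))) (snd p), ()))))) \<and>
      ?S l (fst p) (snd p) = map_pmf (\<lambda>x. Cell x Atom) (map_pmf (enc_list id) (sequence_pmf (map (?Y l)
        (fst (?qs (fst (fst p)) (fst (snd (fst p))) (snd (snd (snd (fst p)))) (snd p), ())))))"
      by (simp only: eq fst_conv mem_Times_iff snd_conv UNIV_I simp_thms)
  qed
  then show ?thesis
  proof (rule unif_indist_reindex[where f = "\<lambda>_ q. q"])
    fix l q assume q: "q \<in> row_params B l"
    obtain b gs T m where [simp]: "q = (b, gs, T, m)" by (cases q)
    \<comment> \<open>All identifiers have the same length and simulated keys depend on no other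
      feature of an item, so the choice of items disappears.\<close>
    have "?S l q idx = map_pmf enc_row (sim_row l gs m)" for idx
    proof -
      have "map (\<lambda>q. sim_key l (fst (snd q)) (length (snd (snd q)))) (?qs b gs m idx) = map (\<lambda>d. sim_key l d (id_length m)) gs"
        by (rule nth_equalityI) auto
      then show ?thesis by (simp add: sim_row_def del: map_map)
    qed
    then show "q \<in> row_params B l \<and> (case q of (b, gs, T, m) \<Rightarrow> map_pmf enc_row (real_row l b gs T m)) = bind_pmf (?idx q) (?R l q) \<and>
        (case q of (b, gs, T, m) \<Rightarrow> map_pmf enc_row (sim_row l gs m)) = bind_pmf (?idx q) (?S l q)"
      using q by (simp add: real_row_def map_bind_pmf o_def bind_pmf_const)
  qed
qed

section \<open>Instances and the joint view\<close>

type_synonym instance_data = "retrieval_params \<times> (nat \<Rightarrow> nat set) \<times> bool \<times> nat set"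

definition user_input :: "instance_data \<Rightarrow> nat \<Rightarrow> bool \<times> bool list" where
  "user_input = (\<lambda>(P, T, b, C) u. if u \<in> C then (True, map (\<lambda>j. j \<in> T u) [0..<num_items P]) else (False, []))"

definition sim_env_of :: "nat \<Rightarrow> instance_data \<Rightarrow> sim_env" where
  "sim_env_of l = (\<lambda>(P, T, b, C). (l, (num_retrieved P, groups P), b, emb_rows P,
     map (user_input (P, T, b, C)) [0..<num_users P]))"

definition user_env_of :: "nat \<Rightarrow> instance_data \<Rightarrow> nat \<Rightarrow> user_env" where
  "user_env_of l = (\<lambda>(P, T, b, C) u. (l, groups P, b, emb_rows P, user_input (P, T, b, C) u))"

lemma enc_emb_eq: "enc_emb P = enc_list (enc_list enc_int) (emb_rows P)"
  by (simp add: enc_emb_def emb_rows_def enc_list_map)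

text \<open>The input of the simulator and the typed environment have the same code, so the typed
  results about \<open>simulate\<close> apply directly.\<close>

lemma sim_input_eq: "sim_input l P T b C = enc_sim_env (sim_env_of l (P, T, b, C))"
proof -
  have "(if u \<in> C then Cell (enc_bool True) (enc_targets (num_items P) (T u)) else Cell (enc_bool False) Atom) =
    enc_pair enc_bool (enc_list enc_bool) (user_input (P, T, b, C) u)" for u
    by (simp add: user_input_def enc_targets_def enc_list_map)
  then show ?thesis by (simp add: sim_input_def sim_env_of_def coalition_def enc_emb_eq enc_list_map)
qed

lemma sim_env_of_mem: "valid_instance \<D> P T C \<Longrightarrow> sim_env_of l (P, T, b, C) \<in> sim_envs"
  by (auto simp: valid_instance_def sim_env_of_def sim_envs_def user_envs_def user_input_def emb_rows_def)

text \<open>The matrix, the groups and one entry per user all occur in the input of the simulator,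
  so a bound on its size bounds every parameter of the instance at once.\<close>

definition instances :: "(nat \<Rightarrow> nat) \<Rightarrow> nat \<Rightarrow> instance_data set" where
  "instances S l = {(P, T, b, C). valid_instance \<D> P T C \<and> size (sim_input l P T b C) \<le> S l}"

definition real_user :: "nat \<Rightarrow> instance_data \<Rightarrow> nat \<Rightarrow> sexp pmf" where
  "real_user l = (\<lambda>(P, T, b, C) u. map_pmf (\<lambda>r.
     Cell (enc_list (\<lambda>i. enc_key (retrieval_key PRG G Convert P b r i)) [0..<num_retrieved P])
       (if u \<in> C then user_view PRG G Convert P (T u) r else Atom)) (user_coins l P (T u)))"

text \<open>The coins of different users are independent. Drawing them user by user and regrouping
  gives the joint view, which opens the way to a hybrid over users.\<close>

lemma real_view_eq:
  "real_view PRG G Convert l P T b C = map_pmf (assemble (emb_rows P) (map (\<lambda>u. u \<in> C) [0..<num_users P]))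
     (sequence_pmf (map (real_user l (P, T, b, C)) [0..<num_users P]))"
proof -
  let ?n = "num_users P"
  let ?f = "\<lambda>u r. Cell (enc_list (\<lambda>i. enc_key (retrieval_key PRG G Convert P b r i)) [0..<num_retrieved P])
       (if u \<in> C then user_view PRG G Convert P (T u) r else Atom)"
  have "map_pmf (assemble (emb_rows P) (map (\<lambda>u. u \<in> C) [0..<?n])) (sequence_pmf (map (real_user l (P, T, b, C)) [0..<?n])) =
    map_pmf (\<lambda>rs. assemble (emb_rows P) (map (\<lambda>u. u \<in> C) [0..<?n]) (map2 ?f [0..<?n] rs))
      (sequence_pmf (map (\<lambda>u. user_coins l P (T u)) [0..<?n]))"
    using sequence_pmf_map[of ?f "\<lambda>u. user_coins l P (T u)" "[0..<?n]"]
    by (simp add: real_user_def pmf.map_comp o_def)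
  also have "\<dots> = real_view PRG G Convert l P T b C"
    unfolding real_view_def
  proof (rule map_pmf_cong[OF refl])
    fix rs assume "rs \<in> set_pmf (sequence_pmf (map (\<lambda>u. user_coins l P (T u)) [0..<?n]))"
    then have n: "length rs = ?n" by (auto simp: set_sequence_pmf dest: list_all2_lengthD)
    let ?c = "map (\<lambda>u. ?f u (rs ! u)) [0..<?n]"
    have "map car ?c = map (\<lambda>r. enc_list (\<lambda>i. enc_key (retrieval_key PRG G Convert P b r i)) [0..<num_retrieved P]) rs"
      using n by (intro nth_equalityI) auto
    moreover have "map (\<lambda>p. cdr (fst p)) (filter snd (zip ?c (map (\<lambda>u. u \<in> C) [0..<?n]))) =
        map (\<lambda>u. user_view PRG G Convert P (T u) (rs ! u)) (filter (\<lambda>u. u \<in> C) [0..<?n])"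
      by (simp add: zip_map_map zip_same_conv_map filter_map o_def)
    ultimately show "assemble (emb_rows P) (map (\<lambda>u. u \<in> C) [0..<?n]) (map2 ?f [0..<?n] rs) =
       Cell (server_view PRG G Convert P b rs) (enc_list (\<lambda>u. user_view PRG G Convert P (T u) (rs ! u)) (filter (\<lambda>u. u \<in> C) [0..<?n]))"
      unfolding map2_upt[OF n] assemble_def server_view_def by (simp only: enc_emb_eq enc_list_map id_apply)
  qed
  finally show ?thesis by simp
qed

lemma retrieval_key_eq:
  "retrieval_key PRG G Convert P b (idx, coins) i = party_key b (groups P ! i) (item_id (num_items P) (idx ! i)) (coins ! i)"
  by (simp add: retrieval_key_def retrieval_keys_def party_key_def Let_def)

text \<open>The simulator knows the targets of a member and can run that user, including the answers
  of both servers; the laws are therefore equal.\<close>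

lemma real_user_member:
  assumes "valid_instance \<D> P T C" "u \<in> C"
  shows "real_user l (P, T, b, C) u = simulated_user (user_env_of l (P, T, b, C) u)"
proof -
  let ?m = "num_items P" and ?k = "num_retrieved P" and ?tg = "map (\<lambda>j. j \<in> T u) [0..<num_items P]"
  have v: "set (groups P) \<subseteq> \<D>" "?k \<le> ?m" "T u \<subseteq> {..<?m}" using assms by (auto simp: valid_instance_def)
  let ?f = "\<lambda>idx coins. enc_member (member_data b (groups P) (emb_rows P) ?tg (map (item_id ?m) idx) coins)"
  have "simulated_user (user_env_of l (P, T, b, C) u) = map_pmf (\<lambda>p. ?f (fst p) (snd p))
      (pair_pmf (standardize ?m ?k (T u)) (replicate_pmf ?k (fss_coins l)))"
    using assms(2) standardize_ids_eq[OF v(3,2)]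
    by (simp add: simulated_user_def user_env_of_def user_input_def pair_map_pmf1 pmf.map_comp o_def split_beta)
  moreover have "real_user l (P, T, b, C) u = map_pmf (\<lambda>p. ?f (fst p) (snd p))
      (pair_pmf (standardize ?m ?k (T u)) (replicate_pmf ?k (fss_coins l)))"
    unfolding real_user_def user_coins_def case_prod_conv
  proof (rule map_pmf_cong[OF refl])
    fix r assume "r \<in> set_pmf (pair_pmf (standardize ?m ?k (T u)) (replicate_pmf ?k (fss_coins l)))"
    then obtain idx coins where r: "r = (idx, coins)" and idx: "idx \<in> set_pmf (standardize ?m ?k (T u))"
      and co: "coins \<in> set_pmf (replicate_pmf ?k (fss_coins l))" by auto
    then have coins: "length coins = ?k" "\<forall>co\<in>set coins. length (fst co) = length (fst (snd co))"
      by (auto simp: set_replicate_pmf lists_eq_set fss_coins_eq)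
    have "map (item_id ?m) idx \<in> set_pmf (standardize_ids (groups P) ?tg)"
      using standardize_ids_eq[OF v(3,2)] idx by simp
    \<comment> \<open>The support of \<open>pmf_of_set\<close> is its set only if this set is finite
      and nonempty; when items are added, nonemptiness holds since no more items are retrieved than
      exist.\<close>
    have len: "length idx = ?k"
    proof -
      have "finite (T u)" using v(3) finite_subset by blast
      show ?thesis
      proof (cases "card (T u) \<le> ?k")
        case True
        let ?A = "{xs. distinct xs \<and> set xs \<subseteq> {..<?m} - T u \<and> length xs = ?k - card (T u)}"
        have A: "?A = arrangements (?k - card (T u)) ({..<?m} - T u)" by (auto simp: arrangements_def)
        have "?k - card (T u) \<le> card ({..<?m} - T u)"
          using v(2,3) \<open>finite (T u)\<close> by (simp add: card_Diff_subset)
        then have "set_pmf (pmf_of_set ?A) = ?A"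
          unfolding A by (intro set_pmf_of_set arrangements_nonempty finite_arrangements) auto
        then show ?thesis using idx True \<open>finite (T u)\<close> by (auto simp: standardize_def)
      next
        case False
        let ?A = "{xs. distinct xs \<and> set xs \<subseteq> T u \<and> length xs = ?k}"
        have A: "?A = arrangements ?k (T u)" by (auto simp: arrangements_def)
        have "set_pmf (pmf_of_set ?A) = ?A"
          unfolding A using False \<open>finite (T u)\<close> by (intro set_pmf_of_set arrangements_nonempty finite_arrangements) auto
        then show ?thesis using idx False by (simp add: standardize_def)
      qed
    qed
    let ?Z = "zip (groups P) (zip (map (item_id ?m) idx) coins)"
    have Z: "?Z = map (\<lambda>i. (groups P ! i, item_id ?m (idx ! i), coins ! i)) [0..<?k]"
      using len coins(1) by (intro nth_equalityI) auto
    \<comment> \<open>An index below \<open>?k\<close> implies that there is at least one item, so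
      the dimension can be read off the first row.\<close>
    have resp: "server_response PRG G Convert P c (retrieval_key PRG G Convert P c (idx, coins) i) i =
        response c (groups P ! i) (party_key c (groups P ! i) (item_id ?m (idx ! i)) (coins ! i)) (emb_rows P) (item_ids (length (emb_rows P)))"
      if i: "i < ?k" for c i
    proof -
      have d: "groups P ! i \<in> \<D>" using v(1) i by auto
      have "well_formed_key (groups P ! i) (id_length ?m) (party_key c (groups P ! i) (item_id ?m (idx ! i)) (coins ! i))"
        using well_formed_party_key[OF d, of "coins ! i" "item_id ?m (idx ! i)" c] coins i by simp
      moreover have "length (emb_rows P) = ?m" by (simp add: emb_rows_def)
      ultimately show ?thesis unfolding retrieval_key_eq using server_response_eq[OF d] i v(2) by simp
    qed
    have "?f idx coins = Cell (enc_list enc_key (map (\<lambda>i. party_key b (groups P ! i) (item_id ?m (idx ! i)) (coins ! i)) [0..<?k]))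
      (Cell (enc_list enc_bool ?tg) (Cell (Cell (enc_list enc_bits (map (item_id ?m) idx)) (enc_list enc_fss_coins coins))
        (enc_list (enc_pair (enc_list enc_bits) (enc_list enc_bits)) (map (\<lambda>i.
          (response False (groups P ! i) (party_key False (groups P ! i) (item_id ?m (idx ! i)) (coins ! i)) (emb_rows P) (item_ids (length (emb_rows P))),
           response True (groups P ! i) (party_key True (groups P ! i) (item_id ?m (idx ! i)) (coins ! i)) (emb_rows P) (item_ids (length (emb_rows P))))) [0..<?k]))))"
      unfolding member_data_def Let_def Z by (simp add: o_def)
    moreover have "user_view PRG G Convert P (T u) (idx, coins) =
      Cell (enc_list enc_bool ?tg) (Cell (Cell (enc_list enc_bits (map (item_id ?m) idx)) (enc_list enc_fss_coins coins))
        (enc_list (enc_pair (enc_list enc_bits) (enc_list enc_bits)) (map (\<lambda>i.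
          (response False (groups P ! i) (party_key False (groups P ! i) (item_id ?m (idx ! i)) (coins ! i)) (emb_rows P) (item_ids (length (emb_rows P))),
           response True (groups P ! i) (party_key True (groups P ! i) (item_id ?m (idx ! i)) (coins ! i)) (emb_rows P) (item_ids (length (emb_rows P))))) [0..<?k])))"
      unfolding user_view_def Let_def enc_targets_def enc_list_map
      by simp (rule enc_list_cong, simp add: resp)
    ultimately show "Cell (enc_list (\<lambda>i. enc_key (retrieval_key PRG G Convert P b r i)) [0..<?k])
       (if u \<in> C then user_view PRG G Convert P (T u) r else Atom) = ?f (fst r) (snd r)"
      using assms(2) by (simp only: r fst_conv snd_conv if_True retrieval_key_eq enc_list_map)
  qed
  ultimately show ?thesis by simp
qed

text \<open>For fixed items the coins of the key generations are independent, so the keys follow a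
  product law, as the list hybrid requires.\<close>

lemma real_user_honest:
  assumes "u \<notin> C"
  shows "real_user l (P, T, b, C) u = map_pmf enc_row (real_row l b (groups P) (T u) (num_items P))"
proof -
  let ?m = "num_items P" and ?k = "num_retrieved P"
  let ?key = "\<lambda>idx i. party_key b (groups P ! i) (item_id ?m (idx ! i))"
  have "sequence_pmf (map (\<lambda>i. real_key l b (groups P ! i) (item_id ?m (idx ! i))) [0..<?k]) =
      map_pmf (\<lambda>coins. map (\<lambda>i. ?key idx i (coins ! i)) [0..<?k]) (replicate_pmf ?k (fss_coins l))" for idx
  proof -
    have "sequence_pmf (map (\<lambda>i. real_key l b (groups P ! i) (item_id ?m (idx ! i))) [0..<?k]) =
        map_pmf (map2 (?key idx) [0..<?k]) (sequence_pmf (map (\<lambda>_. fss_coins l) [0..<?k]))"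
      unfolding real_key_def by (rule sequence_pmf_map)
    also have "sequence_pmf (map (\<lambda>_. fss_coins l) [0..<?k]) = replicate_pmf ?k (fss_coins l)"
      by (simp add: map_replicate_const sequence_pmf_replicate)
    also have "map_pmf (map2 (?key idx) [0..<?k]) (replicate_pmf ?k (fss_coins l)) =
        map_pmf (\<lambda>coins. map (\<lambda>i. ?key idx i (coins ! i)) [0..<?k]) (replicate_pmf ?k (fss_coins l))"
      by (rule map_pmf_cong[OF refl]) (auto simp: set_replicate_pmf intro!: map2_upt)
    finally show ?thesis .
  qed
  moreover have "real_user l (P, T, b, C) u = bind_pmf (standardize ?m ?k (T u)) (\<lambda>idx.
      map_pmf (\<lambda>coins. enc_row (map (\<lambda>i. ?key idx i (coins ! i)) [0..<?k])) (replicate_pmf ?k (fss_coins l)))"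
    using assms
    by (simp add: real_user_def user_coins_def pair_pmf_def map_bind_pmf retrieval_key_eq enc_row_def enc_list_map)
      (simp add: map_pmf_def)
  ultimately show ?thesis
    by (simp add: real_row_def map_bind_pmf pmf.map_comp o_def)
qed

lemma simulated_user_honest:
  "u \<notin> C \<Longrightarrow> simulated_user (user_env_of l (P, T, b, C) u) = map_pmf enc_row (sim_row l (groups P) (num_items P))"
  by (simp add: simulated_user_def user_env_of_def user_input_def sim_row_def enc_row_def[abs_def] emb_rows_def)

lemma instance_bounds:
  assumes "(P, T, b, C) \<in> instances S l"
  shows "valid_instance \<D> P T C" "num_items P \<le> S l" "num_users P \<le> S l" "num_retrieved P \<le> S l"
    "\<forall>d\<in>set (groups P). length d \<le> S l" "size (enc_list (enc_list enc_int) (emb_rows P)) \<le> S l"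
    "u < num_users P \<Longrightarrow> size (enc_user_env (user_env_of l (P, T, b, C) u)) \<le> S l"
proof -
  show v: "valid_instance \<D> P T C" using assms by (simp add: instances_def)
  let ?us = "map (user_input (P, T, b, C)) [0..<num_users P]"
  have s: "size (enc_sim_env (sim_env_of l (P, T, b, C))) \<le> S l" using assms by (simp add: instances_def sim_input_eq)
  then show emb: "size (enc_list (enc_list enc_int) (emb_rows P)) \<le> S l" by (simp add: sim_env_of_def)
  show m: "num_items P \<le> S l"
    using emb length_le_size_enc_list[of "emb_rows P" "enc_list enc_int"] by (simp add: emb_rows_def)
  then show "num_retrieved P \<le> S l" using v by (simp add: valid_instance_def)
  show "num_users P \<le> S l"
    using s length_le_size_enc_list[of ?us "enc_pair enc_bool (enc_list enc_bool)"] by (simp add: sim_env_of_def)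
  show "\<forall>d\<in>set (groups P). length d \<le> S l"
  proof
    fix d assume "d \<in> set (groups P)"
    then have "size (enc_bits d) \<le> size (enc_list enc_bits (groups P))" by (rule size_le_size_enc_list)
    then show "length d \<le> S l" using s length_le_size_enc_list[of d enc_bool] by (simp add: sim_env_of_def)
  qed
  assume "u < num_users P"
  then have "size (enc_pair enc_bool (enc_list enc_bool) (user_input (P, T, b, C) u)) \<le> size (enc_list (enc_pair enc_bool (enc_list enc_bool)) ?us)"
    by (intro size_le_size_enc_list) simp
  then show "size (enc_user_env (user_env_of l (P, T, b, C) u)) \<le> S l"
    using s by (simp add: sim_env_of_def user_env_of_def)
qed

lemma user_env_of_mem: "valid_instance \<D> P T C \<Longrightarrow> user_env_of l (P, T, b, C) u \<in> user_envs"
  by (auto simp: valid_instance_def user_env_of_def user_envs_def user_input_def emb_rows_def)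

definition user_params :: "(nat \<Rightarrow> nat) \<Rightarrow> nat \<Rightarrow> (instance_data \<times> nat) set" where
  "user_params S l = {(p, u). p \<in> instances S l \<and> u < num_users (fst p)}"

text \<open>Inside the coalition both laws coincide; outside, only the row of keys is seen and
  \<open>row_indist\<close> applies.\<close>

lemma user_indist:
  assumes S: "polynomially_bounded S"
  shows "unif_indist (user_params S) (\<lambda>l q. real_user l (fst q) (snd q)) (\<lambda>l q. simulated_user (user_env_of l (fst q) (snd q)))"
proof (rule unif_indist_Un)
  let ?C = "\<lambda>q :: instance_data \<times> nat. snd (snd (snd (fst q)))"
  show "unif_indist (\<lambda>l. {q \<in> user_params S l. snd q \<in> ?C q}) (\<lambda>l q. real_user l (fst q) (snd q)) (\<lambda>l q. simulated_user (user_env_of l (fst q) (snd q)))"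
    by (rule unif_indist_refl) (auto simp: user_params_def real_user_member instance_bounds(1))
  show "unif_indist (\<lambda>l. {q \<in> user_params S l. snd q \<notin> ?C q}) (\<lambda>l q. real_user l (fst q) (snd q)) (\<lambda>l q. simulated_user (user_env_of l (fst q) (snd q)))"
  proof -
    let ?f = "\<lambda>q :: instance_data \<times> nat. (fst (snd (snd (fst q))), groups (fst (fst q)), (fst (snd (fst q))) (snd q), num_items (fst (fst q)))"
    have aux: "?f q \<in> row_params S l \<and>
        real_user l (fst q) (snd q) = map_pmf enc_row (real_row l (fst (?f q)) (fst (snd (?f q))) (fst (snd (snd (?f q)))) (snd (snd (snd (?f q))))) \<and>
        simulated_user (user_env_of l (fst q) (snd q)) = map_pmf enc_row (sim_row l (fst (snd (?f q))) (snd (snd (snd (?f q)))))"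
      if that: "q \<in> {q \<in> user_params S l. snd q \<notin> ?C q}" for l q
    proof -
      from that obtain P T b C u where q: "q = ((P, T, b, C), u)" "(P, T, b, C) \<in> instances S l" "u \<notin> C"
        by (auto simp: user_params_def)
      note i = instance_bounds[OF q(2)]
      have "(b, groups P, T u, num_items P) \<in> row_params S l"
        using i(1-5) by (auto simp: row_params_def valid_instance_def)
      then show ?thesis using q(3) by (simp add: q(1) real_user_honest simulated_user_honest)
    qed
    show ?thesis
      by (rule unif_indist_reindex[OF row_indist[OF S, unfolded split_beta], where f = "\<lambda>_. ?f"]) (rule aux)
  qed
qed auto

lemma user_size:
  assumes S: "polynomially_bounded S"
  shows "\<exists>g. polynomially_bounded g \<and> (\<forall>l. \<forall>(p, u)\<in>user_params S l.
    \<forall>x\<in>set_pmf (real_user l p u) \<union> set_pmf (simulated_user (user_env_of l p u)). size x \<le> g l)"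
proof -
  obtain g where g: "polynomially_bounded g" "mono g"
    "\<And>x y. x \<in> user_envs \<Longrightarrow> y \<in> set_pmf (simulated_user x) \<Longrightarrow> size y \<le> g (size (enc_user_env x))"
    using rt_size[OF rt_simulated_user] by auto
  obtain h where h: "polynomially_bounded h"
    "\<And>l b gs T m ks. (b, gs, T, m) \<in> row_params S l \<Longrightarrow> ks \<in> set_pmf (real_row l b gs T m) \<Longrightarrow> size (enc_row ks) \<le> h l"
    using row_size[OF S] by fastforce
  have "size x \<le> g (S l) + h l" if pu: "(p, u) \<in> user_params S l"
    and x: "x \<in> set_pmf (real_user l p u) \<union> set_pmf (simulated_user (user_env_of l p u))" for l p u x
  proof -
    obtain P T b C where p: "p = (P, T, b, C)" by (cases p)
    with pu have i: "(P, T, b, C) \<in> instances S l" "u < num_users P" by (auto simp: user_params_def)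
    note b = instance_bounds[OF i(1)]
    have sim: "size y \<le> g (S l)" if "y \<in> set_pmf (simulated_user (user_env_of l p u))" for y
    proof -
      have "size y \<le> g (size (enc_user_env (user_env_of l p u)))"
        using that b(1) by (intro g(3)) (simp_all add: p user_env_of_mem)
      also have "\<dots> \<le> g (S l)" by (rule monoD[OF g(2)]) (use b(7)[OF i(2)] p in simp)
      finally show ?thesis .
    qed
    show ?thesis
    proof (cases "u \<in> C \<or> x \<in> set_pmf (simulated_user (user_env_of l p u))")
      case True
      then have "x \<in> set_pmf (simulated_user (user_env_of l p u))"
        using x b(1) by (auto simp: p real_user_member)
      then show ?thesis using sim by fastforce
    next
      case False
      then obtain ks where "ks \<in> set_pmf (real_row l b (groups P) (T u) (num_items P))" "x = enc_row ks"
        using x by (auto simp: p real_user_honest)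
      moreover have "(b, groups P, T u, num_items P) \<in> row_params S l"
        using b(1-5) by (auto simp: row_params_def valid_instance_def)
      ultimately show ?thesis using h(2) by fastforce
    qed
  qed
  moreover have "polynomially_bounded (\<lambda>l. g (S l) + h l)"
    by (intro pb_intros h polynomially_bounded_compose[OF g(1) S])
  ultimately show ?thesis by (intro exI[of _ "\<lambda>l. g (S l) + h l"]) auto
qed

text \<open>The list hybrid replaces the users one by one; \<open>assemble\<close> is then applied
  as post-processing, with the matrix and the membership flags as advice.\<close>

lemma view_indist:
  assumes S: "polynomially_bounded S"
  shows "unif_indist (instances S) (\<lambda>l (P, T, b, C). real_view PRG G Convert l P T b C) (\<lambda>l p. simulate (sim_env_of l p))"
proof -
  let ?X = "\<lambda>l q. real_user l (fst q) (snd q)" and ?Y = "\<lambda>l q. simulated_user (user_env_of l (fst q) (snd q))"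
  let ?Qs = "\<lambda>l. {qs. set qs \<subseteq> user_params S l \<and> length qs \<le> S l}"
  obtain g where g: "polynomially_bounded g" "\<And>l p u x. (p, u) \<in> user_params S l \<Longrightarrow>
    x \<in> set_pmf (real_user l p u) \<union> set_pmf (simulated_user (user_env_of l p u)) \<Longrightarrow> size x \<le> g l"
    using user_size[OF S] by fastforce
  have list: "unif_indist ?Qs (\<lambda>l qs. map_pmf (enc_list id) (sequence_pmf (map (?X l) qs)))
      (\<lambda>l qs. map_pmf (enc_list id) (sequence_pmf (map (?Y l) qs)))"
  proof (rule unif_indist_list[OF user_indist[OF S] g(1) _ S])
    fix l q x assume "q \<in> user_params S l" "x \<in> set_pmf (?X l q) \<union> set_pmf (?Y l q)"
    then show "size x \<le> g l" using g(2)[of "fst q" "snd q" l x] by simp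
  qed
  define A where "A l = {(qs, flags :: bool list). size (enc_list (enc_list enc_int) qs) \<le> S l \<and> length flags \<le> S l}" for l :: nat
  let ?ea = "enc_pair (enc_list (enc_list enc_int)) (enc_list enc_bool)"
  have post: "unif_indist (\<lambda>l. ?Qs l \<times> A l)
      (\<lambda>l p. map_pmf (\<lambda>x. assemble (fst (snd p)) (snd (snd p)) (elements x)) (map_pmf (enc_list id) (sequence_pmf (map (?X l) (fst p)))))
      (\<lambda>l p. map_pmf (\<lambda>x. assemble (fst (snd p)) (snd (snd p)) (elements x)) (map_pmf (enc_list id) (sequence_pmf (map (?Y l) (fst p)))))"
  proof (rule unif_indist_post[OF list, where ea = ?ea])
    show "pt (enc_pair unary (enc_pair ?ea id)) {(l, a, x). a \<in> A l} id
        (\<lambda>p. assemble (fst (fst (snd p))) (snd (fst (snd p))) (elements (snd (snd p))))"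
      by (rule pt_assemble; (rule pt_intros)+)
    show "polynomially_bounded (\<lambda>l. Suc (S l + 2 * S l))" by (intro pb_intros S)
    fix l a assume "a \<in> A l"
    then show "size (?ea a) \<le> Suc (S l + 2 * S l)"
      using size_enc_bits[of "snd a"] by (cases a) (auto simp: A_def)
  qed
  show ?thesis
  proof (rule unif_indist_reindex[OF post, where f = "\<lambda>l p. (map (\<lambda>u. (p, u)) [0..<num_users (fst p)],
        (emb_rows (fst p), map (\<lambda>u. u \<in> snd (snd (snd p))) [0..<num_users (fst p)]))"])
    fix l p assume p: "p \<in> instances S l"
    obtain P T b C where [simp]: "p = (P, T, b, C)" by (cases p)
    note i = instance_bounds[OF p[simplified]]
    let ?f = "(map (\<lambda>u. (p, u)) [0..<num_users (fst p)],
        (emb_rows (fst p), map (\<lambda>u. u \<in> snd (snd (snd p))) [0..<num_users (fst p)]))"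
    have "?f \<in> ?Qs l \<times> A l" using p i(3,6) by (auto simp: user_params_def A_def)
    moreover have "(case p of (P, T, b, C) \<Rightarrow> real_view PRG G Convert l P T b C) =
        map_pmf (\<lambda>x. assemble (fst (snd ?f)) (snd (snd ?f)) (elements x)) (map_pmf (enc_list id) (sequence_pmf (map (?X l) (fst ?f))))"
      by (simp add: real_view_eq pmf.map_comp o_def elements_enc_list)
    moreover have flags: "map (\<lambda>u. fst (user_input (P, T, b, C) u)) [0..<num_users P] = map (\<lambda>u. u \<in> C) [0..<num_users P]"
      by (simp add: user_input_def)
    have "simulate (sim_env_of l p) =
        map_pmf (\<lambda>x. assemble (fst (snd ?f)) (snd (snd ?f)) (elements x)) (map_pmf (enc_list id) (sequence_pmf (map (?Y l) (fst ?f))))"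
      by (simp add: simulate_def sim_env_of_def user_env_of_def pmf.map_comp o_def elements_enc_list flags)
    ultimately show "?f \<in> ?Qs l \<times> A l \<and> (case p of (P, T, b, C) \<Rightarrow> real_view PRG G Convert l P T b C) =
        map_pmf (\<lambda>x. assemble (fst (snd ?f)) (snd (snd ?f)) (elements x)) (map_pmf (enc_list id) (sequence_pmf (map (?X l) (fst ?f)))) \<and>
      simulate (sim_env_of l p) =
        map_pmf (\<lambda>x. assemble (fst (snd ?f)) (snd (snd ?f)) (elements x)) (map_pmf (enc_list id) (sequence_pmf (map (?Y l) (fst ?f))))"
      by blast
  qed
qed

end

theorem theoremF1:
  fixes PRG :: "bits \<Rightarrow> bits"
    and \<D> :: "bits set"
    and G :: "bits \<Rightarrow> bits ring"
    and Convert :: "bits \<Rightarrow> bits \<Rightarrow> bits"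
  assumes "pseudorandom_generator PRG"
    and "efficient_abelian_groups \<D> G"
    and "pseudorandom_conversion \<D> G Convert"
  shows "\<exists>Sim :: sexp \<Rightarrow> sexp pmf.
    ppt id {sim_input l P T b C | l P T b C. valid_instance \<D> P T C} Sim \<and>
    (\<forall>(P :: nat \<Rightarrow> retrieval_params) (T :: nat \<Rightarrow> nat \<Rightarrow> nat set)
        (b :: nat \<Rightarrow> bool) (C :: nat \<Rightarrow> nat set).
       (\<forall>l. valid_instance \<D> (P l) (T l) (C l)) \<and>
       polynomially_bounded (\<lambda>l. size (sim_input l (P l) (T l) (b l) (C l))) \<longrightarrow>
       (\<lambda>l. real_view PRG G Convert l (P l) (T l) (b l) (C l)) \<approx>\<^sub>c
       (\<lambda>l. Sim (sim_input l (P l) (T l) (b l) (C l))))"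
proof -
  interpret secemb PRG \<D> G Convert
    using assms by unfold_locales
  let ?A = "{(l, P, T, b, C) | l P T b C. valid_instance \<D> P T C}"
  let ?e = "\<lambda>(l, P, T, b, C). sim_input l P T b C"
  let ?env = "\<lambda>(l, p). sim_env_of l p"
  have "pt ?e ?A enc_sim_env ?env"
    by (rule pt_recode) (auto simp: sim_input_eq)
  then have "rt ?e ?A id (\<lambda>a. simulate (?env a))"
    by (rule rt_comp[OF rt_simulate]) (auto simp: sim_env_of_mem)
  then have "ppt ?e ?A (\<lambda>a. simulate (?env a))" by (simp add: rt_def)
  \<comment> \<open>Instances that differ only in targets outside the coalition share their code.
    \<open>Sim\<close> is a function of the code alone, so it cannot depend on these
    targets.\<close>
  from ppt_to_id[OF this] obtain Sim where Sim: "ppt id (?e ` ?A) Sim" "\<And>a. a \<in> ?A \<Longrightarrow> Sim (?e a) = simulate (?env a)"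
    by blast
  have sim: "Sim (sim_input l P T b C) = simulate (sim_env_of l (P, T, b, C))" if "valid_instance \<D> P T C" for l P T b C
    using Sim(2)[of "(l, P, T, b, C)"] that by auto
  have "?e ` ?A = {sim_input l P T b C | l P T b C. valid_instance \<D> P T C}" by force
  then have "ppt id {sim_input l P T b C | l P T b C. valid_instance \<D> P T C} Sim" using Sim(1) by simp
  \<comment> \<open>The uniform result is applied with the size of the simulator's input itself as
    the bound, so the given sequence lies in \<open>instances\<close>.\<close>
  moreover have "(\<lambda>l. real_view PRG G Convert l (P l) (T l) (b l) (C l)) \<approx>\<^sub>c (\<lambda>l. Sim (sim_input l (P l) (T l) (b l) (C l)))"
    if v: "\<And>l. valid_instance \<D> (P l) (T l) (C l)"
      and S: "polynomially_bounded (\<lambda>l. size (sim_input l (P l) (T l) (b l) (C l)))" for P T b C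
    using unif_indist_imp_comp_indist[OF view_indist[OF S], of "\<lambda>l. (P l, T l, b l, C l)"] v
    by (simp add: instances_def sim)
  ultimately show ?thesis by blast
qed

end
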